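(* Let $H:\mathbb{R}^4\to\mathbb{R}$ be $C^k$ with $k\ge2$, having a non-degenerate critical point at the origin with $H(0)=0$, and assume that no eigenvalue of the linearization $L$ of $\xi_H$ at the origin has zero real part. Then exactly two eigenvalues $\lambda_1,\lambda_2$ of $L$ have positive real part. Let $e_1,e_2$ be corresponding eigenvectors, $\mathcal N=\operatorname{span}(e_1,e_2)$, and assume $\pi|_{\mathcal N}:\mathcal N\to\mathbb{R}^2$ is nonsingular. Then near the origin the unstable submanifold $N^2_-$ of $\xi_H$ is the jet of a $C^k$ solution $z$ of $H(x,y,z_x,z_y)=0$. The analogous statement holds for the stable submanifold $N^2_+$ of $\xi_H$ (with the two eigenvalues of negative real part).
   Context: $\mathbb{R}^4$ has coordinates $(x,y,p,q)$, $\pi(x,y,p,q)=(x,y)$. The characteristic vector field is $\xi_H=H_p\partial_x+H_q\partial_y-H_x\partial_p-H_y\partial_q$, with flow $\Phi_t$; $L$ is the matrix $\begin{pmatrix}H_{xp}&H_{yp}&H_{pp}&H_{pq}\\H_{xq}&H_{yq}&H_{pq}&H_{qq}\\-H_{xx}&-H_{xy}&-H_{xp}&-H_{xq}\\-H_{xy}&-H_{yy}&-H_{yp}&-H_{yq}\end{pmatrix}$ evaluated at the origin. The local stable (resp. unstable) submanifold is the set of points $P$ in a small neighborhood of the origin with $\Phi_t(P)\to0$ as $t\to+\infty$ (resp. $t\to-\infty$). The jet of $z$ is $\{(x,y,z_x(x,y),z_y(x,y))\}$.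
   Formalization: The local stable (unstable) submanifold is taken as the points whose trajectory also stays in the small neighborhood for all t≥0 (t≤0) while tending to 0; without this, homoclinic orbits returning near the origin would make the claim false. *)

theory Defs
  imports "HOL-Analysis.Analysis" "Jordan_Normal_Form.Char_Poly"
begin

type_synonym R4 = "real \<times> real \<times> real \<times> real"

definition partial :: "'a::real_normed_vector \<Rightarrow> ('a \<Rightarrow> real) \<Rightarrow> 'a \<Rightarrow> real" where
  "partial b f = (\<lambda>x. deriv (\<lambda>t. f (x + t *\<^sub>R b)) 0)"

fun iter_partial :: "'a::real_normed_vector list \<Rightarrow> ('a \<Rightarrow> real) \<Rightarrow> 'a \<Rightarrow> real" where
  "iter_partial [] f = f"
| "iter_partial (b # ds) f = partial b (iter_partial ds f)"

definition Ck_on :: "nat \<Rightarrow> 'a::euclidean_space set \<Rightarrow> ('a \<Rightarrow> real) \<Rightarrow> bool" where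
  "Ck_on k S f \<longleftrightarrow>
     (\<forall>ds b. set ds \<subseteq> Basis \<and> length ds < k \<and> b \<in> Basis \<longrightarrow>
        (\<forall>x\<in>S. (\<lambda>t. iter_partial ds f (x + t *\<^sub>R b)) differentiable (at 0))) \<and>
     (\<forall>ds. set ds \<subseteq> Basis \<and> length ds \<le> k \<longrightarrow> continuous_on S (iter_partial ds f))"

definition ex :: R4 where "ex = (1, 0, 0, 0)"
definition ey :: R4 where "ey = (0, 1, 0, 0)"
definition ep :: R4 where "ep = (0, 0, 1, 0)"
definition eq :: R4 where "eq = (0, 0, 0, 1)"

definition pd2 :: "(R4 \<Rightarrow> real) \<Rightarrow> R4 \<Rightarrow> R4 \<Rightarrow> real" where
  "pd2 H u v = partial u (partial v H) 0"

definition e4 :: "nat \<Rightarrow> R4" where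
  "e4 i = [ex, ey, ep, eq] ! i"

definition hessian0 :: "(R4 \<Rightarrow> real) \<Rightarrow> real mat" where
  "hessian0 H = mat 4 4 (\<lambda>(i, j). pd2 H (e4 i) (e4 j))"

definition nondeg_crit0 :: "(R4 \<Rightarrow> real) \<Rightarrow> bool" where
  "nondeg_crit0 H \<longleftrightarrow> (\<forall>i<4. partial (e4 i) H 0 = 0) \<and> det (hessian0 H) \<noteq> 0"

definition xiH :: "(R4 \<Rightarrow> real) \<Rightarrow> R4 \<Rightarrow> R4" where
  "xiH H P = (partial ep H P, partial eq H P, - partial ex H P, - partial ey H P)"

(* the linearization L of xi_H at the origin, as in the paper *)
definition Lmat :: "(R4 \<Rightarrow> real) \<Rightarrow> real mat" where
  "Lmat H = mat_of_rows_list 4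
     [[ pd2 H ex ep,    pd2 H ey ep,    pd2 H ep ep,    pd2 H ep eq],
      [ pd2 H ex eq,    pd2 H ey eq,    pd2 H ep eq,    pd2 H eq eq],
      [- pd2 H ex ex, - pd2 H ex ey, - pd2 H ex ep, - pd2 H ex eq],
      [- pd2 H ex ey, - pd2 H ey ey, - pd2 H ey ep, - pd2 H ey eq]]"

definition Lc :: "(R4 \<Rightarrow> real) \<Rightarrow> complex mat" where
  "Lc H = map_mat complex_of_real (Lmat H)"

definition eigvals :: "(R4 \<Rightarrow> real) \<Rightarrow> complex multiset" where
  "eigvals H = proots (char_poly (Lc H))"

definition cvec :: "R4 \<Rightarrow> complex vec" where
  "cvec P = (case P of (x, y, p, q) \<Rightarrow>
     vec_of_list [complex_of_real x, complex_of_real y, complex_of_real p, complex_of_real q])"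

(* the (real) plane N = span(e1, e2), i.e. the real points of the complex span *)
definition span2 :: "complex vec \<Rightarrow> complex vec \<Rightarrow> R4 set" where
  "span2 e1 e2 = {P. \<exists>a b :: complex. cvec P = a \<cdot>\<^sub>v e1 + b \<cdot>\<^sub>v e2}"

definition proj :: "R4 \<Rightarrow> real \<times> real" where
  "proj P = (case P of (x, y, p, q) \<Rightarrow> (x, y))"

definition unstable_loc :: "(R4 \<Rightarrow> real) \<Rightarrow> R4 set \<Rightarrow> R4 set" where
  "unstable_loc H U = {P \<in> U. \<exists>\<gamma> :: real \<Rightarrow> R4. \<gamma> 0 = P \<and>
      (\<forall>t\<le>0. \<gamma> t \<in> U \<and> (\<gamma> has_vector_derivative xiH H (\<gamma> t)) (at t within {..0})) \<and>
      (\<gamma> \<longlongrightarrow> 0) at_bot}"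

definition stable_loc :: "(R4 \<Rightarrow> real) \<Rightarrow> R4 set \<Rightarrow> R4 set" where
  "stable_loc H U = {P \<in> U. \<exists>\<gamma> :: real \<Rightarrow> R4. \<gamma> 0 = P \<and>
      (\<forall>t\<ge>0. \<gamma> t \<in> U \<and> (\<gamma> has_vector_derivative xiH H (\<gamma> t)) (at t within {0..})) \<and>
      (\<gamma> \<longlongrightarrow> 0) at_top}"

definition zx :: "(real \<times> real \<Rightarrow> real) \<Rightarrow> real \<times> real \<Rightarrow> real" where
  "zx z = partial (1, 0) z"
definition zy :: "(real \<times> real \<Rightarrow> real) \<Rightarrow> real \<times> real \<Rightarrow> real" where
  "zy z = partial (0, 1) z"

definition jet :: "(real \<times> real \<Rightarrow> real) \<Rightarrow> (real \<times> real) set \<Rightarrow> R4 set" where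
  "jet z \<Omega> = {(x, y, zx z (x, y), zy z (x, y)) | x y. (x, y) \<in> \<Omega>}"

definition Ck_solution :: "nat \<Rightarrow> (R4 \<Rightarrow> real) \<Rightarrow> (real \<times> real) set \<Rightarrow> (real \<times> real \<Rightarrow> real) \<Rightarrow> bool" where
  "Ck_solution k H \<Omega> z \<longleftrightarrow> Ck_on k \<Omega> z \<and>
     (\<forall>x y. (x, y) \<in> \<Omega> \<longrightarrow> H (x, y, zx z (x, y), zy z (x, y)) = 0)"

end

theory Submission
  imports Defs
begin

text \<open>
  A Lyapunov--Perron argument. If \<open>e1\<close>, \<open>e2\<close> are the eigenvectors for \<open>Re l < 0\<close>, then
  \<open>\<omega>(e1, _)\<close> and \<open>\<omega>(e2, _)\<close> are left eigenvectors of \<open>L\<close> for the opposite eigenvalues, and together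
  with the base point, written in the basis \<open>proj e1\<close>, \<open>proj e2\<close>, they are coordinates in which the linear
  inhomogeneous problem becomes four scalar equations. Bounded solutions of \<open>u' = L u + f\<close> are therefore
  determined by \<open>f\<close> and by the projection of \<open>u 0\<close>, and small solutions of the Hamiltonian system on
  \<open>[0, \<infinity>)\<close> are the fixed points \<open>\<gamma> x\<close> of a contraction whose parameter \<open>x\<close> is that projection; so the stable
  manifold is the graph of the fibre part of \<open>\<gamma> x 0\<close>. Regularity follows by induction, since the derivatives
  of \<open>\<gamma>\<close> in \<open>x\<close> solve linear fixed point equations whose coefficients are as smooth as \<open>\<gamma>\<close> itself.
  The symplectic form of two variations of \<open>\<gamma> x\<close> is constant in time and tends to 0, hence the graph is
  Lagrangian, that is, a gradient; \<open>H\<close> is constant along \<open>\<gamma> x\<close> and vanishes in the limit.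
  The unstable manifold is the stable manifold of \<open>-H\<close>.
\<close>

section \<open>Functions of class \<open>C\<^sup>r\<close>\<close>

text \<open>Two points shape the proof. First, the unknown is a whole curve, an element of the
  Banach space of bounded continuous functions with the sup norm, while \<open>Ck_on\<close> speaks
  of iterated partials of real functions on Euclidean spaces. \<open>Cr\<close> bridges the gap: it
  makes sense between normed spaces and asks for a derivative whose value in every fixed direction
  is again smooth, so that all regularity proofs become inductions on the order. Second, the
  eigenspaces of the opposite half plane are never constructed. Nonsingularity of the projection
  makes the vertical plane a complement of the span of \<open>e1\<close> and \<open>e2\<close>; that
  plane is not invariant, so the linear system is triangular rather than diagonal, and it is solved
  from the growing coordinates upwards. One derivative is lost in passing from \<open>H\<close> to
  its vector field, hence the manifold is only of class \<open>k - 1\<close>; it is regained because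
  the manifold is the graph of the gradient of \<open>z\<close>. In the lowest case
  \<open>k = 2\<close> the graph is merely of class 1, which is just enough for the symmetry of its
  derivative to be meaningful.\<close>

primrec Cr :: "nat \<Rightarrow> 'a::real_normed_vector set \<Rightarrow> ('a \<Rightarrow> 'b::real_normed_vector) \<Rightarrow> bool" where
  "Cr 0 = (\<lambda>S f. continuous_on S f)"
| "Cr (Suc r) = (\<lambda>S f. \<exists>f'. (\<forall>x\<in>S. (f has_derivative f' x) (at x)) \<and> (\<forall>v. Cr r S (\<lambda>x. f' x v)))"

lemma Cr_SucE:
  assumes "Cr (Suc r) S f"
  obtains f' where "\<And>x. x \<in> S \<Longrightarrow> (f has_derivative f' x) (at x)" "\<And>v. Cr r S (\<lambda>x. f' x v)"
  using assms by auto

lemma Cr_SucI: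
  assumes "\<And>x. x \<in> S \<Longrightarrow> (f has_derivative f' x) (at x)" "\<And>v. Cr r S (\<lambda>x. f' x v)"
  shows "Cr (Suc r) S f"
  using assms by auto

lemma Cr_SucD: "Cr (Suc r) S f \<Longrightarrow> Cr r S f"
proof (induction r arbitrary: f)
  case 0
  then obtain f' where "\<And>x. x \<in> S \<Longrightarrow> (f has_derivative f' x) (at x)"
    by (auto elim: Cr_SucE)
  then show ?case
    by (auto intro!: continuous_at_imp_continuous_on dest: has_derivative_continuous)
next
  case (Suc r)
  from Suc.prems have "\<exists>f'. (\<forall>x\<in>S. (f has_derivative f' x) (at x)) \<and> (\<forall>v. Cr (Suc r) S (\<lambda>x. f' x v))" by simp
  then obtain f' where f': "\<And>x. x \<in> S \<Longrightarrow> (f has_derivative f' x) (at x)" "\<And>v. Cr (Suc r) S (\<lambda>x. f' x v)"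
    by metis
  from f'(1) Suc.IH[OF f'(2)] show ?case by (rule Cr_SucI)
qed

lemma Cr_mono: "Cr r S f \<Longrightarrow> s \<le> r \<Longrightarrow> Cr s S f"
proof (induction "r - s" arbitrary: r)
  case (Suc n)
  then obtain r' where r': "r = Suc r'" by (cases r) auto
  show ?case
    by (rule Suc.hyps(1)[of r']) (use Suc.hyps(2) Suc.prems r' Cr_SucD[of r' S f] in \<open>simp_all del: Cr.simps\<close>)
qed auto

lemma Cr_imp_continuous_on: "Cr r S f \<Longrightarrow> continuous_on S f"
  using Cr_mono[of r S f 0] by simp

lemma Cr_subset: "Cr r S f \<Longrightarrow> T \<subseteq> S \<Longrightarrow> Cr r T f"
proof (induction r arbitrary: f)
  case (Suc r)
  then show ?case by (simp only: Cr.simps) blast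
qed (auto intro: continuous_on_subset)

lemma Cr_cong:
  assumes "open S" "\<And>x. x \<in> S \<Longrightarrow> f x = g x" "Cr r S f"
  shows "Cr r S g"
proof (cases r)
  case 0
  with assms(3) show ?thesis using continuous_on_cong[OF refl assms(2), of S] by simp
next
  case (Suc s)
  from assms(3) Suc have "\<exists>f'. (\<forall>x\<in>S. (f has_derivative f' x) (at x)) \<and> (\<forall>v. Cr s S (\<lambda>x. f' x v))" by simp
  then obtain f' where f': "\<And>x. x \<in> S \<Longrightarrow> (f has_derivative f' x) (at x)" "\<And>v. Cr s S (\<lambda>x. f' x v)"
    by metis
  have "(g has_derivative f' x) (at x)" if "x \<in> S" for x
    using has_derivative_transform_within_open[OF f'(1)[OF that] assms(1) that] assms(2) by auto
  with f'(2) show ?thesis unfolding Suc by (intro Cr_SucI)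
qed

lemma Cr_const: "Cr r S (\<lambda>x. c)"
proof (induction r arbitrary: c)
  case (Suc r)
  show ?case by (rule Cr_SucI[where f' = "\<lambda>_ _. 0"]) (auto intro: Suc)
qed auto

lemma Cr_bounded_linear:
  assumes "bounded_linear T" shows "Cr r S f \<Longrightarrow> Cr r S (\<lambda>x. T (f x))"
proof (induction r arbitrary: f)
  case 0
  then show ?case using bounded_linear.continuous_on[OF assms] by simp
next
  case (Suc r)
  then have "\<exists>f'. (\<forall>x\<in>S. (f has_derivative f' x) (at x)) \<and> (\<forall>v. Cr r S (\<lambda>x. f' x v))" by simp
  then obtain f' where f': "\<And>x. x \<in> S \<Longrightarrow> (f has_derivative f' x) (at x)" "\<And>v. Cr r S (\<lambda>x. f' x v)"
    by metis
  show ?case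
    by (rule Cr_SucI[OF bounded_linear.has_derivative[OF assms f'(1)] Suc.IH[OF f'(2)]])
qed

lemma Cr_add: "Cr r S f \<Longrightarrow> Cr r S g \<Longrightarrow> Cr r S (\<lambda>x. f x + g x)"
proof (induction r arbitrary: f g)
  case 0
  then show ?case by (simp add: continuous_on_add)
next
  case (Suc r)
  from Suc.prems(1) have "\<exists>f'. (\<forall>x\<in>S. (f has_derivative f' x) (at x)) \<and> (\<forall>v. Cr r S (\<lambda>x. f' x v))" by simp
  then obtain f' where f': "\<And>x. x \<in> S \<Longrightarrow> (f has_derivative f' x) (at x)" "\<And>v. Cr r S (\<lambda>x. f' x v)"
    by metis
  from Suc.prems(2) have "\<exists>g'. (\<forall>x\<in>S. (g has_derivative g' x) (at x)) \<and> (\<forall>v. Cr r S (\<lambda>x. g' x v))" by simp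
  then obtain g' where g': "\<And>x. x \<in> S \<Longrightarrow> (g has_derivative g' x) (at x)" "\<And>v. Cr r S (\<lambda>x. g' x v)"
    by metis
  show ?case
    by (rule Cr_SucI[OF has_derivative_add[OF f'(1) g'(1)] Suc.IH[OF f'(2) g'(2)]])
qed

lemma Cr_sum: "(\<And>i. i \<in> I \<Longrightarrow> Cr r S (f i)) \<Longrightarrow> Cr r S (\<lambda>x. \<Sum>i\<in>I. f i x)"
  by (induction I rule: infinite_finite_induct) (auto intro: Cr_const Cr_add)

lemma Cr_diff: "Cr r S f \<Longrightarrow> Cr r S g \<Longrightarrow> Cr r S (\<lambda>x. f x - g x)"
  using Cr_add[of r S f "\<lambda>x. - g x"] Cr_bounded_linear[OF bounded_linear_minus[OF bounded_linear_ident], of r S g]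
  by simp

lemma Cr_bilinear:
  assumes "bounded_bilinear B"
  shows "Cr r S f \<Longrightarrow> Cr r S g \<Longrightarrow> Cr r S (\<lambda>x. B (f x) (g x))"
proof (induction r arbitrary: f g)
  case 0
  then show ?case by (simp add: bounded_bilinear.continuous_on[OF assms])
next
  case (Suc r)
  from Suc.prems(1) have "\<exists>f'. (\<forall>x\<in>S. (f has_derivative f' x) (at x)) \<and> (\<forall>v. Cr r S (\<lambda>x. f' x v))" by simp
  then obtain f' where f': "\<And>x. x \<in> S \<Longrightarrow> (f has_derivative f' x) (at x)" "\<And>v. Cr r S (\<lambda>x. f' x v)"
    by metis
  from Suc.prems(2) have "\<exists>g'. (\<forall>x\<in>S. (g has_derivative g' x) (at x)) \<and> (\<forall>v. Cr r S (\<lambda>x. g' x v))" by simp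
  then obtain g' where g': "\<And>x. x \<in> S \<Longrightarrow> (g has_derivative g' x) (at x)" "\<And>v. Cr r S (\<lambda>x. g' x v)"
    by metis
  show ?case
  proof (rule Cr_SucI[OF bounded_bilinear.FDERIV[OF assms f'(1) g'(1)]], assumption, assumption)
    fix v
    show "Cr r S (\<lambda>x. B (f x) (g' x v) + B (f' x v) (g x))"
      by (intro Cr_add Suc.IH Cr_SucD[OF Suc.prems(1)] Cr_SucD[OF Suc.prems(2)] f' g')
  qed
qed

section \<open>Comparison of \<open>Cr\<close> with iterated partial derivatives\<close>

lemma partial_eq:
  assumes "(f has_derivative D) (at x)"
  shows "((\<lambda>t. f (x + t *\<^sub>R b)) has_real_derivative D b) (at 0)" "partial b f x = D b"
proof -
  interpret D: bounded_linear D using assms by (rule has_derivative_bounded_linear)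
  have "((\<lambda>t. x + t *\<^sub>R b) has_derivative (\<lambda>t. t *\<^sub>R b)) (at 0)"
    by (auto intro!: derivative_eq_intros)
  moreover have "(f has_derivative D) (at (x + 0 *\<^sub>R b))" using assms by simp
  ultimately have "((\<lambda>t. f (x + t *\<^sub>R b)) has_derivative (\<lambda>t. D (t *\<^sub>R b))) (at 0)"
    by (rule has_derivative_compose[where g=f])
  then show *: "((\<lambda>t. f (x + t *\<^sub>R b)) has_real_derivative D b) (at 0)"
    by (simp add: has_field_derivative_def D.scaleR mult_commute_abs)
  show "partial b f x = D b"
    unfolding partial_def using * by (rule DERIV_imp_deriv)
qed

lemma Cr_iter_partial:
  assumes "open S" "Cr (r + length ds) S f"
  shows "Cr r S (iter_partial ds f)"
  using assms(2)
proof (induction ds arbitrary: r)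
  case (Cons b ds)
  from Cons.IH[of "Suc r"] Cons.prems have "Cr (Suc r) S (iter_partial ds f)" by simp
  then have "\<exists>f'. (\<forall>x\<in>S. (iter_partial ds f has_derivative f' x) (at x)) \<and> (\<forall>v. Cr r S (\<lambda>x. f' x v))" by simp
  then obtain f' where f': "\<And>x. x \<in> S \<Longrightarrow> (iter_partial ds f has_derivative f' x) (at x)" "\<And>v. Cr r S (\<lambda>x. f' x v)"
    by metis
  show ?case
    by (rule Cr_cong[OF assms(1) _ f'(2)[of b]]) (simp add: partial_eq(2)[OF f'(1)])
qed simp

lemma Cr_imp_Ck_on:
  fixes f :: "'a::euclidean_space \<Rightarrow> real"
  assumes "open S" "Cr k S f"
  shows "Ck_on k S f"
  unfolding Ck_on_def
proof (intro conjI allI impI ballI; elim conjE)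
  fix ds :: "'a list" and b x :: 'a assume "length ds < k" "x \<in> S"
  have "Cr (Suc 0) S (iter_partial ds f)"
    by (rule Cr_iter_partial[OF assms(1) Cr_mono[OF assms(2)]]) (use \<open>length ds < k\<close> in auto)
  then obtain f' where "(iter_partial ds f has_derivative f' x) (at x)"
    using \<open>x \<in> S\<close> by (auto elim: Cr_SucE)
  from partial_eq(1)[OF this]
  show "(\<lambda>t. iter_partial ds f (x + t *\<^sub>R b)) differentiable (at 0)"
    using real_differentiable_def by blast
next
  fix ds :: "'a list" assume "length ds \<le> k"
  then have "Cr 0 S (iter_partial ds f)"
    by (intro Cr_iter_partial[OF assms(1) Cr_mono[OF assms(2)]]) auto
  then show "continuous_on S (iter_partial ds f)" by simp
qed

text \<open>The increment is split into one-coordinate moves. Each move is controlled by the mean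
  value theorem along a line and by continuity of the corresponding partial at
  \<open>x\<close>.\<close>

lemma has_derivative_continuous_partials:
  fixes g :: "'a::euclidean_space \<Rightarrow> real" and x :: 'a
  assumes S: "open S" "x \<in> S"
    and der: "\<And>b y. b \<in> Basis \<Longrightarrow> y \<in> S \<Longrightarrow> ((\<lambda>t. g (y + t *\<^sub>R b)) has_real_derivative G b y) (at 0)"
    and cont: "\<And>b. b \<in> Basis \<Longrightarrow> continuous_on S (G b)"
  shows "(g has_derivative (\<lambda>h. \<Sum>b\<in>Basis. inner h b * G b x)) (at x)"
proof -
  \<comment> \<open>The estimate is uniform in the starting point \<open>x + c\<close>, because
    later coordinates are moved after \<open>x\<close> has already been left.\<close>
  have step: "\<exists>d>0. \<forall>c s. norm c < d \<and> \<bar>s\<bar> < d \<longrightarrow>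
      \<bar>g (x + c + s *\<^sub>R b) - g (x + c) - s * G b x\<bar> \<le> e * \<bar>s\<bar>" if "e > 0" "b \<in> Basis" for e b
  proof -
    from S obtain d1 where d1: "d1 > 0" "ball x d1 \<subseteq> S" by (auto simp: open_contains_ball)
    from cont[OF that(2)] S have "continuous (at x) (G b)" by (simp add: continuous_on_eq_continuous_at)
    then obtain d2 where d2: "d2 > 0" "\<And>y. dist y x < d2 \<Longrightarrow> dist (G b y) (G b x) < e"
      using \<open>e > 0\<close> unfolding continuous_at_eps_delta by blast
    define d where "d = min d1 d2 / 2"
    have "\<bar>g (x + c + s *\<^sub>R b) - g (x + c) - s * G b x\<bar> \<le> e * \<bar>s\<bar>"
      if c: "norm c < d" and s: "\<bar>s\<bar> < d" for c s
    proof -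
      have nb: "norm (c + u *\<^sub>R b) < d1 \<and> norm (c + u *\<^sub>R b) < d2" if "\<bar>u\<bar> \<le> \<bar>s\<bar>" for u
      proof -
        have "norm (c + u *\<^sub>R b) \<le> norm c + \<bar>u\<bar>"
          using norm_triangle_ineq[of c "u *\<^sub>R b"] \<open>b \<in> Basis\<close> by simp
        also have "\<dots> < 2 * d" using that c s by linarith
        finally show ?thesis by (auto simp: d_def)
      qed
      have D: "((\<lambda>u. g (x + c + u *\<^sub>R b) - u * G b x) has_vector_derivative
          G b (x + c + u *\<^sub>R b) - G b x) (at u within {-\<bar>s\<bar>..\<bar>s\<bar>})" if u: "u \<in> {-\<bar>s\<bar>..\<bar>s\<bar>}" for u
      proof -
        have "x + (c + u *\<^sub>R b) \<in> S" 
        proof (intro subsetD[OF d1(2)])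
          have "dist x (x + (c + u *\<^sub>R b)) = norm (c + u *\<^sub>R b)"
            by (metis add_diff_cancel_left' dist_commute dist_norm)
          then show "x + (c + u *\<^sub>R b) \<in> ball x d1" using nb[of u] u by auto
        qed
        then have "x + c + u *\<^sub>R b \<in> S" by (simp add: add.assoc)
        from der[OF \<open>b \<in> Basis\<close> this]
        have "((\<lambda>t. g (x + c + (u + t) *\<^sub>R b)) has_real_derivative G b (x + c + u *\<^sub>R b)) (at 0)"
          by (simp add: algebra_simps)
        then have "((\<lambda>t. g (x + c + t *\<^sub>R b)) has_real_derivative G b (x + c + u *\<^sub>R b)) (at u)"
          using DERIV_at_within_shift[of "\<lambda>t. g (x + c + t *\<^sub>R b)" _ u 0 UNIV] by (simp add: add.commute)
        then have "((\<lambda>u. g (x + c + u *\<^sub>R b) - u * G b x) has_real_derivative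
          G b (x + c + u *\<^sub>R b) - G b x) (at u)"
          by (auto intro!: derivative_eq_intros)
        then show ?thesis
          by (simp add: has_real_derivative_iff_has_vector_derivative has_vector_derivative_at_within)
      qed
      have "norm ((g (x + c + s *\<^sub>R b) - s * G b x) - (g (x + c + 0 *\<^sub>R b) - 0 * G b x)) \<le> e * norm (s - 0)"
      proof (rule differentiable_bound[where S = "{-\<bar>s\<bar>..\<bar>s\<bar>}" and f = "\<lambda>u. g (x + c + u *\<^sub>R b) - u * G b x" 
              and f' = "\<lambda>u h. h * (G b (x + c + u *\<^sub>R b) - G b x)"])
        fix u assume u: "u \<in> {-\<bar>s\<bar>..\<bar>s\<bar>}"
        from D[OF u] show "((\<lambda>u. g (x + c + u *\<^sub>R b) - u * G b x) has_derivative
            (\<lambda>h. h * (G b (x + c + u *\<^sub>R b) - G b x))) (at u within {-\<bar>s\<bar>..\<bar>s\<bar>})"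
          by (simp add: has_vector_derivative_def)
        have "dist (x + (c + u *\<^sub>R b)) x < d2" using nb[of u] u by (auto simp: dist_norm)
        from d2(2)[OF this] show "onorm (\<lambda>h. h * (G b (x + c + u *\<^sub>R b) - G b x)) \<le> e"
          by (intro onorm_le) (simp add: abs_mult dist_norm add.assoc mult.commute[of e] mult_left_mono)
      qed auto
      then show ?thesis by (simp add: algebra_simps)
    qed
    moreover have "d > 0" using d1 d2 by (simp add: d_def)
    ultimately show ?thesis by blast
  qed
  \<comment> \<open>Coordinates are added one at a time, with the free offset \<open>c\<close>
    recording the moves already made.\<close>
  have ind: "\<exists>d>0. \<forall>c h. norm c < d \<and> norm h < d \<longrightarrow>
      \<bar>g (x + c + (\<Sum>b\<in>B. inner h b *\<^sub>R b)) - g (x + c) - (\<Sum>b\<in>B. inner h b * G b x)\<bar> \<le> e * norm h"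
    if "finite B" "B \<subseteq> Basis" "e > 0" for B e
    using that
  proof (induction B arbitrary: e)
    case (insert b B)
    from insert.IH[of "e/2"] insert.prems obtain d1 where d1: "d1 > 0" "\<And>c h. norm c < d1 \<Longrightarrow> norm h < d1 \<Longrightarrow>
      \<bar>g (x + c + (\<Sum>b\<in>B. inner h b *\<^sub>R b)) - g (x + c) - (\<Sum>b\<in>B. inner h b * G b x)\<bar> \<le> e/2 * norm h"
      by auto
    from step[of "e/2" b] insert.prems obtain d2 where d2: "d2 > 0" "\<And>c s. norm c < d2 \<Longrightarrow> \<bar>s\<bar> < d2 \<Longrightarrow>
      \<bar>g (x + c + s *\<^sub>R b) - g (x + c) - s * G b x\<bar> \<le> e/2 * \<bar>s\<bar>"
      by auto
    \<comment> \<open>The bound for \<open>B\<close> is applied at the base point shifted by the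
      \<open>b\<close>-component of \<open>h\<close>; radius \<open>d1/2\<close> for both
      \<open>c\<close> and \<open>h\<close> keeps this shifted offset below
      \<open>d1\<close>.\<close>
    have "\<bar>g (x + c + (\<Sum>b\<in>insert b B. inner h b *\<^sub>R b)) - g (x + c) - (\<Sum>b\<in>insert b B. inner h b * G b x)\<bar> \<le> e * norm h"
      if c: "norm c < min (d1/2) d2" and h: "norm h < min (d1/2) d2" for c h
    proof -
      have hb: "\<bar>inner h b\<bar> \<le> norm h" using insert.prems by (simp add: Basis_le_norm)
      have "norm (c + inner h b *\<^sub>R b) \<le> norm c + norm h"
        using norm_triangle_ineq[of c "inner h b *\<^sub>R b"] insert.prems hb by simp
      then have "norm (c + inner h b *\<^sub>R b) < d1" "norm h < d1" using c h d1(1) by linarith+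
      note 1 = d1(2)[OF this]
      have 2: "\<bar>g (x + c + inner h b *\<^sub>R b) - g (x + c) - inner h b * G b x\<bar> \<le> e/2 * \<bar>inner h b\<bar>"
        using d2(2)[of c "inner h b"] c h hb by simp
      have 3: "e/2 * \<bar>inner h b\<bar> \<le> e/2 * norm h" using hb insert.prems by simp
      show ?thesis
        proof -
        have *: "\<bar>A - C - (p + q)\<bar> \<le> e * norm h"
          if "\<bar>A - B - q\<bar> \<le> e/2 * norm h" "\<bar>B - C - p\<bar> \<le> e/2 * \<bar>inner h b\<bar>" for A B C p q :: real
        proof -
          have "e * norm h = e/2 * norm h + e/2 * norm h" by simp
          with that(1) order_trans[OF that(2) 3] show ?thesis unfolding abs_le_iff by linarith
        qed
        show ?thesis
          using *[OF 1[unfolded add.assoc] 2[unfolded add.assoc]] insert.hyps by (simp add: add.assoc)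
      qed
    qed
    moreover have "min (d1/2) d2 > 0" using d1 d2 by simp
    ultimately show ?case by blast
  next
    case empty
    then show ?case by (auto intro: exI[of _ 1])
  qed
  show ?thesis
    unfolding has_derivative_at_alt
  proof (intro conjI allI impI)
    show "bounded_linear (\<lambda>h. \<Sum>b\<in>Basis. inner h b * G b x)"
      by (intro bounded_linear_sum bounded_linear_mult_left[THEN bounded_linear_compose, unfolded o_def] bounded_linear_inner_left)
    fix e :: real assume "0 < e"
    from ind[OF finite_Basis subset_refl this] obtain d where d: "d > 0" "\<And>c h. norm c < d \<Longrightarrow> norm h < d \<Longrightarrow>
      \<bar>g (x + c + h) - g (x + c) - (\<Sum>b\<in>Basis. inner h b * G b x)\<bar> \<le> e * norm h"
      by (auto simp: euclidean_representation)
    show "\<exists>d>0. \<forall>y. norm (y - x) < d \<longrightarrow>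
        norm (g y - g x - (\<Sum>b\<in>Basis. inner (y - x) b * G b x)) \<le> e * norm (y - x)"
      using d(2)[of 0 "y - x" for y] d(1) by (intro exI[of _ d]) auto
  qed
qed

text \<open>Induction on the number \<open>r\<close> of derivatives still to be taken: the partials
  of \<open>iter_partial ds f\<close> have one derivative less in reserve, and being continuous they
  assemble into a total derivative.\<close>

lemma Ck_on_imp_Cr:
  fixes f :: "'a::euclidean_space \<Rightarrow> real"
  assumes "open S" "Ck_on k S f"
  shows "Cr k S f"
proof -
  have "Cr r S (iter_partial ds f)" if "length ds + r \<le> k" "set ds \<subseteq> Basis" for r ds
    using that
  proof (induction r arbitrary: ds)
    case 0
    then show ?case using assms(2) by (simp add: Ck_on_def)
  next
    case (Suc r)
    define g where "g = iter_partial ds f"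
    have IH: "Cr r S (partial b g)" if "b \<in> Basis" for b
      using Suc.IH[of "b # ds"] Suc.prems that by (simp add: g_def)
    have der: "((\<lambda>t. g (y + t *\<^sub>R b)) has_real_derivative partial b g y) (at 0)"
      if "b \<in> Basis" "y \<in> S" for b y
      using assms(2) that Suc.prems
      unfolding Ck_on_def g_def partial_def by (auto intro!: DERIV_deriv_iff_real_differentiable[THEN iffD2])
    have "(g has_derivative (\<lambda>h. \<Sum>b\<in>Basis. inner h b * partial b g x)) (at x)" if "x \<in> S" for x
      by (rule has_derivative_continuous_partials[OF assms(1) that der])
         (auto intro: Cr_imp_continuous_on IH)
    then show ?case
      unfolding g_def[symmetric]
      by (rule Cr_SucI)
         (auto intro!: Cr_sum Cr_bounded_linear[OF bounded_linear_mult_right, of _ _ "partial b g" for b] IH)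
  qed
  from this[of "[]" k] show ?thesis by simp
qed

section \<open>Superposition operators on bounded curves\<close>

definition post :: "('a::real_normed_vector \<Rightarrow> 'b::real_normed_vector) \<Rightarrow> (real \<Rightarrow>\<^sub>C 'a) \<Rightarrow> real \<Rightarrow>\<^sub>C 'b" where
  "post T u = Bcontfun (\<lambda>t. T (u t))"

lemma apply_Bcontfun:
  assumes "continuous_on UNIV f" "\<And>t. norm (f t) \<le> B"
  shows "apply_bcontfun (Bcontfun f) = f"
  using bcontfun_normI[OF assms] by (rule Bcontfun_inverse)

lemma apply_post: assumes "bounded_linear T" shows "apply_bcontfun (post T u) t = T (u t)"
proof -
  obtain K where K: "\<And>x. norm (T x) \<le> norm x * K" "K \<ge> 0"
    using bounded_linear.nonneg_bounded[OF assms] by blast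
  have "apply_bcontfun (post T u) = (\<lambda>t. T (u t))"
    unfolding post_def
  proof (rule apply_Bcontfun)
    show "continuous_on UNIV (\<lambda>t. T (u t))"
      by (intro bounded_linear.continuous_on[OF assms]) simp
    show "norm (T (u t)) \<le> norm u * K" for t
      using K(1)[of "u t"] mult_right_mono[OF norm_bounded[of u t] K(2)] by linarith
  qed
  then show ?thesis by simp
qed

lemma bounded_linear_post: assumes "bounded_linear T" shows "bounded_linear (post T)"
proof -
  interpret T: bounded_linear T by fact
  obtain K where K: "\<And>x. norm (T x) \<le> norm x * K" "K \<ge> 0"
    using T.nonneg_bounded by blast
  show ?thesis
  proof (rule bounded_linear_intro)
    show "norm (post T u) \<le> norm u * K" for u
    proof (rule norm_bound)
      fix t
      show "norm (post T u t) \<le> norm u * K"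
      using K(1)[of "u t"] mult_right_mono[OF norm_bounded[of u t] K(2)] by (simp add: apply_post[OF assms])
    qed
  qed (auto intro!: bcontfun_eqI simp: apply_post[OF assms] T.add T.scaleR)
qed

lemma bounded_linear_apply_bcontfun: "bounded_linear (\<lambda>u. apply_bcontfun u t)"
  by (rule bounded_linear_intro[where K=1]) (auto simp: norm_bounded)

text \<open>The Nemytskii operator of \<open>\<phi>\<close>.\<close>

definition nem :: "('a::euclidean_space \<Rightarrow> 'b::real_normed_vector) \<Rightarrow> (real \<Rightarrow>\<^sub>C 'a) \<Rightarrow> real \<Rightarrow>\<^sub>C 'b" where
  "nem \<phi> u = Bcontfun (\<lambda>t. \<phi> (u t))"

text \<open>Values of a bounded curve lie in a closed ball, which is compact in finite dimension. So
  continuity of \<open>\<phi>\<close> alone makes the composition bounded, and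
  \<open>Bcontfun\<close> returns the intended function.\<close>

lemma apply_nem:
  assumes "continuous_on UNIV \<phi>"
  shows "apply_bcontfun (nem \<phi> u) t = \<phi> (u t)"
proof -
  have "compact (\<phi> ` cball 0 (norm u))"
    by (intro compact_continuous_image continuous_on_subset[OF assms]) auto
  then obtain B where B: "\<And>x. x \<in> cball 0 (norm u) \<Longrightarrow> norm (\<phi> x) \<le> B"
    by (meson bounded_iff compact_imp_bounded imageI)
  have "apply_bcontfun (nem \<phi> u) = (\<lambda>t. \<phi> (u t))"
    unfolding nem_def
  proof (rule apply_Bcontfun)
    show "continuous_on UNIV (\<lambda>t. \<phi> (u t))"
      by (intro continuous_on_compose2[OF assms]) auto
    show "norm (\<phi> (u t)) \<le> B" for t
      by (intro B) (simp add: norm_bounded)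
  qed
  then show ?thesis by simp
qed

definition smul :: "(real \<Rightarrow>\<^sub>C real) \<Rightarrow> (real \<Rightarrow>\<^sub>C 'b::real_normed_vector) \<Rightarrow> real \<Rightarrow>\<^sub>C 'b" where
  "smul s w = Bcontfun (\<lambda>t. s t *\<^sub>R w t)"

lemma norm_scale_bcontfun: "norm (apply_bcontfun s t *\<^sub>R apply_bcontfun w t) \<le> norm s * norm w"
  by (simp add: mult_mono norm_bounded norm_bounded[of s t, simplified])

lemma apply_smul: "apply_bcontfun (smul s w) t = s t *\<^sub>R w t"
proof -
  have "apply_bcontfun (smul s w) = (\<lambda>t. s t *\<^sub>R w t)"
    unfolding smul_def
    by (rule apply_Bcontfun[OF _ norm_scale_bcontfun]) (intro continuous_intros; simp)
  then show ?thesis by simp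
qed

lemma bounded_bilinear_smul: "bounded_bilinear smul"
proof
  show "\<exists>K. \<forall>a b. norm (smul a (b::real \<Rightarrow>\<^sub>C 'b::real_normed_vector)) \<le> norm a * norm b * K"
    by (rule exI[of _ 1]) (auto intro!: norm_bound simp: apply_smul norm_scale_bcontfun[simplified])
qed (auto intro!: bcontfun_eqI simp: apply_smul algebra_simps)

text \<open>One coordinate of \<open>h\<close> times a curve. The derivative of a superposition
  operator, pointwise application of a Jacobian, is a sum of such terms over \<open>Basis\<close>
  with the Jacobian columns as curves; this avoids curves of operators.\<close>

definition smulc :: "'a::euclidean_space \<Rightarrow> (real \<Rightarrow>\<^sub>C 'a) \<Rightarrow> (real \<Rightarrow>\<^sub>C 'b::real_normed_vector) \<Rightarrow> real \<Rightarrow>\<^sub>C 'b" where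
  "smulc j h w = smul (post (\<lambda>x. inner x j) h) w"

lemma apply_smulc: "apply_bcontfun (smulc j h w) t = inner (h t) j *\<^sub>R w t"
  unfolding smulc_def by (simp add: apply_smul apply_post bounded_linear_inner_left)

lemma bounded_bilinear_smulc: "bounded_bilinear (smulc j)"
  unfolding smulc_def [abs_def]
  using bounded_bilinear.comp1[OF bounded_bilinear_smul bounded_linear_post[OF bounded_linear_inner_left]] .

text \<open>All curves within distance 1 of \<open>u\<close> take values in the ball of radius
  \<open>norm u + 1\<close>, on which \<open>\<phi>\<close> is uniformly continuous; this makes the
  estimate uniform in \<open>t\<close>.\<close>

lemma nem_continuous:
  fixes \<phi> :: "'a::euclidean_space \<Rightarrow> 'b::real_normed_vector"
  assumes "continuous_on UNIV \<phi>"
  shows "continuous_on UNIV (nem \<phi>)"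
  unfolding continuous_on_iff
proof (intro ballI allI impI)
  fix u :: "real \<Rightarrow>\<^sub>C 'a" and e :: real assume "e > 0"
  have "uniformly_continuous_on (cball 0 (norm u + 1)) \<phi>"
    by (intro compact_uniformly_continuous continuous_on_subset[OF assms]) auto
  with \<open>e > 0\<close> obtain d where d: "d > 0" "\<And>x y. x \<in> cball 0 (norm u + 1) \<Longrightarrow> y \<in> cball 0 (norm u + 1) \<Longrightarrow> dist y x < d
     \<Longrightarrow> dist (\<phi> y) (\<phi> x) < e/2"
    unfolding uniformly_continuous_on_def by (meson half_gt_zero)
  have "dist (nem \<phi> w) (nem \<phi> u) < e" if "dist w u < min d 1" for w
  proof -
    have "norm w \<le> norm u + 1" using that norm_triangle_sub[of w u] by (simp add: dist_norm)
    have "dist (nem \<phi> w) (nem \<phi> u) \<le> e/2"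
    proof (rule dist_bound)
      fix t
      have "dist (\<phi> (w t)) (\<phi> (u t)) < e/2"
        using norm_bounded[of u t] norm_bounded[of w t] \<open>norm w \<le> norm u + 1\<close>
              that dist_bounded[of w t u]
        by (intro d) auto
      then show "dist (nem \<phi> w t) (nem \<phi> u t) \<le> e/2"
        by (simp add: apply_nem[OF assms])
    qed
    with \<open>e > 0\<close> show ?thesis by simp
  qed
  then show "\<exists>d>0. \<forall>x'\<in>UNIV. dist x' u < d \<longrightarrow> dist (nem \<phi> x') (nem \<phi> u) < e"
    using d(1) by (intro exI[of _ "min d 1"]) auto
qed

lemma bounded_linear_Basis:
  fixes f :: "'a::euclidean_space \<Rightarrow> 'b::real_normed_vector"
  assumes "bounded_linear f"
  shows "f h = (\<Sum>j\<in>Basis. inner h j *\<^sub>R f j)"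
proof -
  interpret bounded_linear f by fact
  have "f h = f (\<Sum>j\<in>Basis. inner h j *\<^sub>R j)" by (simp add: euclidean_representation)
  also have "\<dots> = (\<Sum>j\<in>Basis. inner h j *\<^sub>R f j)" by (simp add: sum scaleR)
  finally show ?thesis .
qed

lemma norm_linear_le_Basis:
  fixes f :: "'a::euclidean_space \<Rightarrow> 'b::real_normed_vector"
  assumes "bounded_linear f"
  shows "norm (f h) \<le> (\<Sum>j\<in>Basis. norm (f j)) * norm h"
  unfolding bounded_linear_Basis[OF assms, of h] sum_distrib_right
  by (rule sum_norm_le) (simp add: mult.commute[of "norm (f _)"] mult_right_mono Basis_le_norm)

lemma apply_bcontfun_sum: "apply_bcontfun (\<Sum>i\<in>I. f i) t = (\<Sum>i\<in>I. apply_bcontfun (f i) t)"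
  by (induction I rule: infinite_finite_induct) auto

text \<open>The Taylor remainder must be small uniformly in \<open>t\<close>. Compactness of a ball
  containing all values gives a common modulus of continuity for the columns of
  \<open>\<phi>'\<close>, and the mean value inequality is then applied separately at each
  time.\<close>

lemma nem_has_derivative:
  fixes \<phi> :: "'a::euclidean_space \<Rightarrow> 'b::real_normed_vector"
  assumes der: "\<And>x. (\<phi> has_derivative \<phi>' x) (at x)"
    and cont: "\<And>v. continuous_on UNIV (\<lambda>x. \<phi>' x v)"
  shows "(nem \<phi> has_derivative (\<lambda>h. \<Sum>j\<in>Basis. smulc j h (nem (\<lambda>x. \<phi>' x j) u))) (at u)"
  unfolding has_derivative_at_alt
proof (intro conjI allI impI)
  have c\<phi>: "continuous_on UNIV \<phi>"
    using der by (auto intro!: continuous_at_imp_continuous_on dest: has_derivative_continuous)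
  show "bounded_linear (\<lambda>h. \<Sum>j\<in>Basis. smulc j h (nem (\<lambda>x. \<phi>' x j) u))"
    by (intro bounded_linear_sum bounded_bilinear.bounded_linear_left[OF bounded_bilinear_smulc])
  fix e :: real assume "e > 0"
  \<comment> \<open>Each of the \<open>DIM('a)\<close> columns receives an equal share of
    \<open>e\<close>, since the operator norm is bounded by the sum of the column norms.\<close>
  define e' where "e' = e / DIM('a)"
  have "e' > 0" using \<open>e > 0\<close> by (simp add: e'_def)
  have "\<exists>d>0. \<forall>x\<in>cball 0 (norm u + 1). \<forall>y\<in>cball 0 (norm u + 1). dist y x < d
     \<longrightarrow> dist (\<phi>' y j) (\<phi>' x j) < e'" for j
  proof -
    have "uniformly_continuous_on (cball 0 (norm u + 1)) (\<lambda>x. \<phi>' x j)"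
      by (intro compact_uniformly_continuous continuous_on_subset[OF cont]) auto
    then show ?thesis
      using \<open>e' > 0\<close> unfolding uniformly_continuous_on_def by blast
  qed
  then obtain d where d: "\<And>j. d j > 0" "\<And>j x y. x \<in> cball 0 (norm u + 1) \<Longrightarrow> y \<in> cball 0 (norm u + 1) \<Longrightarrow> dist y x < d j
     \<Longrightarrow> dist (\<phi>' y j) (\<phi>' x j) < e'"
    by metis
  define D where "D = Min (insert 1 (d ` Basis))"
  have D: "D > 0" "D \<le> 1" "\<And>j. j \<in> Basis \<Longrightarrow> D \<le> d j"
    using d(1) unfolding D_def by (auto simp del: Min_insert simp: Min_gr_iff intro!: Min_le)
  have "norm (nem \<phi> w - nem \<phi> u - (\<Sum>j\<in>Basis. smulc j (w - u) (nem (\<lambda>x. \<phi>' x j) u))) \<le> e * norm (w - u)"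
    if w: "norm (w - u) < D" for w
  proof (rule norm_bound)
    fix t
    have wu: "norm (w t - u t) \<le> norm (w - u)" using norm_bounded[of "w - u" t] by simp
    have bl: "bounded_linear (\<phi>' x)" for x using der by (rule has_derivative_bounded_linear)
    have "norm (\<phi> (w t) - \<phi> (u t) - \<phi>' (u t) (w t - u t)) \<le> norm (w t - u t) * e"
    proof (rule differentiable_bound_linearization[where S = "ball (u t) D" and f' = \<phi>'])
      show "u t \<in> ball (u t) D" using D by simp
      show "u t + s *\<^sub>R (w t - u t) \<in> ball (u t) D" if "s \<in> {0..1}" for s
      proof -
        have "\<bar>s\<bar> * norm (w t - u t) \<le> 1 * norm (w t - u t)"
          using that by (intro mult_right_mono) auto
        then show ?thesis using w wu by (simp add: dist_norm)
      qed
      show "(\<phi> has_derivative \<phi>' x) (at x within ball (u t) D)" for x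
        using der by (rule has_derivative_at_withinI)
      show "onorm (\<phi>' x - \<phi>' (u t)) \<le> e" if x: "x \<in> ball (u t) D" for x
      proof (rule onorm_le)
        fix h
        have "norm ((\<phi>' x - \<phi>' (u t)) h) \<le> (\<Sum>j\<in>Basis. norm ((\<phi>' x - \<phi>' (u t)) j)) * norm h"
          unfolding fun_diff_def by (intro norm_linear_le_Basis bounded_linear_sub bl)
        also have "\<dots> \<le> (\<Sum>j\<in>(Basis::'a set). e') * norm h"
        proof (intro mult_right_mono sum_mono)
          fix j :: 'a assume j: "j \<in> Basis"
          have "norm (u t) \<le> norm u" by (rule norm_bounded)
          moreover have "norm x \<le> norm (u t) + 1"
            using x D norm_triangle_sub[of x "u t"] by (simp add: dist_norm norm_minus_commute)
          ultimately have "dist (\<phi>' x j) (\<phi>' (u t) j) < e'"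
            using x D(3)[OF j] by (intro d) (auto simp: dist_commute)
          then show "norm ((\<phi>' x - \<phi>' (u t)) j) \<le> e'" by (simp add: dist_norm)
        qed simp
        also have "\<dots> = e * norm h" by (simp add: e'_def)
        finally show "norm ((\<phi>' x - \<phi>' (u t)) h) \<le> e * norm h" .
      qed
    qed
    also have "\<dots> \<le> e * norm (w - u)" using wu \<open>e > 0\<close> by (simp add: mult.commute)
    finally show "norm (apply_bcontfun (nem \<phi> w - nem \<phi> u - (\<Sum>j\<in>Basis. smulc j (w - u) (nem (\<lambda>x. \<phi>' x j) u))) t) \<le> e * norm (w - u)"
      by (simp add: apply_nem c\<phi> cont apply_bcontfun_sum apply_smulc bounded_linear_Basis[OF bl, of _ "w t - u t"])
  qed
  with D(1) show "\<exists>d>0. \<forall>y. norm (y - u) < d \<longrightarrow>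
     norm (nem \<phi> y - nem \<phi> u - (\<Sum>j\<in>Basis. smulc j (y - u) (nem (\<lambda>x. \<phi>' x j) u))) \<le> e * norm (y - u)"
    by blast
qed

text \<open>By the chain rule the derivative is a sum of products of a direction derivative of
  \<open>\<gamma>\<close> with superposition operators of the columns of \<open>\<phi>'\<close>.
  These have the same form with one order less, so the induction runs over all \<open>\<phi>\<close>
  at once.\<close>

lemma Cr_nem:
  fixes \<phi> :: "'a::euclidean_space \<Rightarrow> 'b::real_normed_vector"
    and \<gamma> :: "'p::real_normed_vector \<Rightarrow> real \<Rightarrow>\<^sub>C 'a"
  assumes "Cr r UNIV \<phi>" "Cr r S \<gamma>"
  shows "Cr r S (\<lambda>x. nem \<phi> (\<gamma> x))"
  using assms
proof (induction r arbitrary: \<phi>)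
  case 0
  then show ?case
    by (auto intro!: continuous_on_compose2[OF nem_continuous])
next
  case (Suc r)
  from Suc.prems(2) have "\<exists>f'. (\<forall>x\<in>S. (\<gamma> has_derivative f' x) (at x)) \<and> (\<forall>v. Cr r S (\<lambda>x. f' x v))" by simp
  then obtain \<gamma>' where \<gamma>': "\<And>x. x \<in> S \<Longrightarrow> (\<gamma> has_derivative \<gamma>' x) (at x)"
      "\<And>v. Cr r S (\<lambda>x. \<gamma>' x v)"
    by metis
  from Suc.prems(1) have "\<exists>f'. (\<forall>x\<in>UNIV. (\<phi> has_derivative f' x) (at x)) \<and> (\<forall>v. Cr r UNIV (\<lambda>x. f' x v))" by simp
  then obtain \<phi>' where \<phi>': "\<And>x. (\<phi> has_derivative \<phi>' x) (at x)"
      "\<And>v. Cr r UNIV (\<lambda>x. \<phi>' x v)"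
    by auto
  have "((\<lambda>x. nem \<phi> (\<gamma> x)) has_derivative (\<lambda>v. \<Sum>j\<in>Basis. smulc j (\<gamma>' x v) (nem (\<lambda>x. \<phi>' x j) (\<gamma> x)))) (at x)" if "x \<in> S" for x
    by (rule has_derivative_compose[OF \<gamma>'(1)[OF that] nem_has_derivative[OF \<phi>'(1)]])
       (rule Cr_imp_continuous_on[OF \<phi>'(2)])
  note d = this
  show ?case
    by (rule Cr_SucI, erule d)
       (intro Cr_sum Cr_bilinear[OF bounded_bilinear_smulc] \<gamma>' Suc.IH \<phi>' Cr_SucD[OF Suc.prems(2)])
qed

section \<open>Fixed points depending on a parameter\<close>

instance bcontfun :: (metric_space, banach) banach ..

lemma ex1_affine_fixpoint:
  fixes A :: "'a::banach \<Rightarrow> 'a"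
  assumes "bounded_linear A" "\<And>v. norm (A v) \<le> \<kappa> * norm v" "0 \<le> \<kappa>" "\<kappa> < 1"
  shows "\<exists>!v. v = c + A v"
proof -
  interpret bounded_linear A by fact
  have "\<exists>!v. c + A v = v"
    using assms(2)[of "_ - _"] by (intro banach_fix_type[OF assms(3,4)]) (simp add: dist_norm diff)
  then show ?thesis by metis
qed

text \<open>The a priori estimate behind uniqueness, continuity and differentiability of fixed
  points: the term \<open>A v\<close> is absorbed on the left.\<close>

lemma contraction_bound:
  assumes "norm (A v) \<le> \<kappa> * norm v" "v = c + A v"
  shows "(1 - \<kappa>) * norm v \<le> norm (c :: 'a::real_normed_vector)"
proof -
  have "norm v \<le> norm c + norm (A v)" using norm_triangle_ineq[of c "A v"] assms(2) by simp
  then show ?thesis using assms(1) by (simp add: algebra_simps)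
qed

text \<open>An implicit function step: if the increments of \<open>v\<close> satisfy the linearized
  fixed point equation up to a small error, then the solution \<open>w\<close> of the exact
  linearized equation is the derivative. The error may involve the unknown increment
  \<open>v y - v x\<close>, because the contraction lets that part be absorbed.\<close>

lemma has_derivative_implicit_contraction:
  fixes v :: "'p::real_normed_vector \<Rightarrow> 'a::real_normed_vector"
  assumes A: "bounded_linear A" "\<And>k. norm (A k) \<le> \<kappa> * norm k" "\<kappa> < 1"
    and a: "bounded_linear a"
    and approx: "\<And>e. e > 0 \<Longrightarrow> \<exists>d>0. \<forall>y. norm (y - x) < d \<longrightarrow>
       norm (v y - v x - a (y - x) - A (v y - v x)) \<le> e * (norm (y - x) + norm (v y - v x))"
    and w: "\<And>h. w h = a h + A (w h)"
  shows "(v has_derivative w) (at x)"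
proof -
  interpret A: bounded_linear A by fact
  interpret a: bounded_linear a by fact
  \<comment> \<open>Only the equation for \<open>w\<close> is given; its linearity follows from
    uniqueness, since the defects of additivity and homogeneity solve the homogeneous
    equation.\<close>
  have uniq: "u = 0" if "u = A u" for u
    using contraction_bound[of A u \<kappa> 0] A(2)[of u] that A(3) by (simp add: mult_le_0_iff)
  obtain Ka where Ka: "\<And>h. norm (a h) \<le> norm h * Ka" "Ka \<ge> 0" using a.nonneg_bounded by blast
  define W where "W = Ka / (1 - \<kappa>)"
  have W: "norm (w h) \<le> norm h * W" "W \<ge> 0" for h
    using contraction_bound[of A "w h" \<kappa> "a h", OF A(2) w] Ka(1)[of h] Ka(2) A(3)
    by (auto simp: W_def field_simps)
  have Aw: "A (w h) = w h - a h" for h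
    using w[of h] by (metis add_diff_cancel_left')
  have wl: "bounded_linear w"
  proof (rule bounded_linear_intro)
    show "w (x + y) = w x + w y" for x y
    proof -
      have "w (x + y) - (w x + w y) = A (w (x + y) - (w x + w y))"
        by (simp add: A.diff A.add a.add Aw)
      from uniq[OF this] show ?thesis by simp
    qed
    show "w (r *\<^sub>R x) = r *\<^sub>R w x" for r x
    proof -
      have "w (r *\<^sub>R x) - r *\<^sub>R w x = A (w (r *\<^sub>R x) - r *\<^sub>R w x)"
        by (simp add: A.diff A.scaleR a.scaleR Aw scaleR_diff_right)
      from uniq[OF this] show ?thesis by simp
    qed
    show "norm (w h) \<le> norm h * W" for h by (rule W)
  qed
  show ?thesis
    unfolding has_derivative_at_alt
  proof (intro conjI wl allI impI)
    fix e :: real assume "e > 0"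
    \<comment> \<open>The first entry lets half of \<open>(1 - \<kappa>) * norm R\<close> be
      absorbed. The second leaves exactly \<open>e * norm h\<close> after dividing by the other
      half; the factor \<open>1 + W\<close> comes from
      \<open>norm D \<le> norm R + norm h * W\<close>.\<close>
    define \<epsilon> where "\<epsilon> = min ((1 - \<kappa>)/2) (e * (1 - \<kappa>) / (2 * (1 + W)))"
    have "\<epsilon> > 0" using \<open>e > 0\<close> A(3) W(2) by (simp add: \<epsilon>_def)
    from approx[OF this] obtain d where d: "d > 0" "\<And>y. norm (y - x) < d \<Longrightarrow>
       norm (v y - v x - a (y - x) - A (v y - v x)) \<le> \<epsilon> * (norm (y - x) + norm (v y - v x))" by blast
    have "norm (v y - v x - w (y - x)) \<le> e * norm (y - x)" if "norm (y - x) < d" for y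
    proof -
      define h where "h = y - x"
      define D where "D = v y - v x"
      define R where "R = D - w h"
      have "R = (D - a h - A D) + A R"
        by (simp add: R_def A.diff Aw)
      from contraction_bound[of A R \<kappa>, OF A(2) this] d(2)[OF that]
      have "(1 - \<kappa>) * norm R \<le> \<epsilon> * (norm h + norm D)" by (simp add: D_def h_def)
      also have "norm D \<le> norm R + norm h * W"
        using norm_triangle_ineq[of R "w h"] W(1)[of h] by (simp add: R_def)
      then have "\<epsilon> * (norm h + norm D) \<le> \<epsilon> * (norm h + (norm R + norm h * W))"
        using \<open>\<epsilon> > 0\<close> by simp
      also have "\<dots> = \<epsilon> * norm R + \<epsilon> * (1 + W) * norm h" by (simp add: algebra_simps)
      also have "\<dots> \<le> (1 - \<kappa>)/2 * norm R + e * (1 - \<kappa>) / 2 * norm h"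
      proof (intro add_mono mult_right_mono)
        have "\<epsilon> * (1 + W) \<le> e * (1 - \<kappa>) / (2 * (1 + W)) * (1 + W)"
          using W(2) by (intro mult_right_mono) (auto simp: \<epsilon>_def)
        also have "\<dots> = e * (1 - \<kappa>) / 2" using W(2) by (simp add: field_simps)
        finally show "\<epsilon> * (1 + W) \<le> e * (1 - \<kappa>) / 2" .
        show "\<epsilon> \<le> (1 - \<kappa>) / 2" unfolding \<epsilon>_def by (rule min.cobounded1)
      qed auto
      finally have "(1 - \<kappa>) * norm R \<le> (1 - \<kappa>)/2 * norm R + e * (1 - \<kappa>) / 2 * norm h" .
      moreover have "(1 - \<kappa>) * norm R = (1 - \<kappa>)/2 * norm R + (1 - \<kappa>)/2 * norm R" by simp
      moreover have "e * (1 - \<kappa>) / 2 * norm h = (1 - \<kappa>) / 2 * (e * norm h)" by simp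
      ultimately have "(1 - \<kappa>)/2 * norm R \<le> (1 - \<kappa>) / 2 * (e * norm h)" by linarith
      then have "norm R \<le> e * norm h" using A(3) by (subst (asm) mult_le_cancel_left_pos) auto
      then show ?thesis by (simp add: R_def D_def h_def)
    qed
    with d(1) show "\<exists>d>0. \<forall>y. norm (y - x) < d \<longrightarrow> norm (v y - v x - w (y - x)) \<le> e * norm (y - x)"
      by blast
  qed
qed

lemma has_derivative_approxE:
  assumes "(f has_derivative f') (at x)" "e > 0"
  shows "\<exists>d>0. \<forall>y. norm (y - x) < d \<longrightarrow> norm (f y - f x - f' (y - x)) \<le> e * norm (y - x)"
  using assms unfolding has_derivative_at_alt by blast

text \<open>Differentiating \<open>v = c + A v\<close> gives an equation with the same operator
  \<open>A\<close> and a new inhomogeneity containing \<open>v\<close> itself. Hence the induction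
  keeps \<open>A\<close> and generalizes \<open>c\<close> and \<open>v\<close>; smoothness of
  \<open>v\<close> one order lower feeds the inhomogeneity.\<close>

lemma Cr_linear_fixpoint:
  fixes A :: "'p::real_normed_vector \<Rightarrow> 'a::banach \<Rightarrow>\<^sub>L 'a"
  assumes "open S" "0 \<le> \<kappa>" "\<kappa> < 1" "\<And>x. x \<in> S \<Longrightarrow> norm (A x) \<le> \<kappa>"
    and "Cr r S A" "Cr r S c" "\<And>x. x \<in> S \<Longrightarrow> v x = c x + A x (v x)"
  shows "Cr r S v"
  using assms(5-)
proof (induction r arbitrary: c v)
  case 0
  have "isCont v x" if x: "x \<in> S" for x
  proof -
    have bound: "norm (v y - v x) \<le> (norm (c y - c x) + norm (A y - A x) * norm (v x)) / (1 - \<kappa>)" if "y \<in> S" for y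
    proof -
      have "norm (A y (v y - v x)) \<le> \<kappa> * norm (v y - v x)"
        using norm_blinfun[of "A y" "v y - v x"] assms(4)[OF that]
        by (meson mult_right_mono norm_ge_zero order_trans)
      moreover have "v y - v x = (c y - c x + (A y - A x) (v x)) + A y (v y - v x)"
      proof -
        have Av: "A z (v z) = v z - c z" if "z \<in> S" for z
          using "0"(3)[OF that] by (metis add_diff_cancel_left')
        show ?thesis by (simp add: blinfun.diff_left blinfun.diff_right Av x that)
      qed
      ultimately have "(1 - \<kappa>) * norm (v y - v x) \<le> norm (c y - c x + (A y - A x) (v x))"
        by (rule contraction_bound)
      also have "\<dots> \<le> norm (c y - c x) + norm (A y - A x) * norm (v x)"
        using norm_triangle_ineq[of "c y - c x" "(A y - A x) (v x)"] norm_blinfun[of "A y - A x" "v x"] by linarith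
      finally show ?thesis using assms(3) by (simp add: field_simps)
    qed
    have "isCont A x" "isCont c x" using 0 x assms(1) by (auto simp: continuous_on_eq_continuous_at)
    then have "((\<lambda>y. (norm (c y - c x) + norm (A y - A x) * norm (v x)) / (1 - \<kappa>)) \<longlongrightarrow>
        (norm (c x - c x) + norm (A x - A x) * norm (v x)) / (1 - \<kappa>)) (at x)"
      using assms(3) unfolding isCont_def by (intro tendsto_intros) auto
    then have lim: "((\<lambda>y. (norm (c y - c x) + norm (A y - A x) * norm (v x)) / (1 - \<kappa>)) \<longlongrightarrow> 0) (at x)" by simp
    have "eventually (\<lambda>y. y \<in> S) (at x)"
      using assms(1) x by (auto simp: eventually_at_topological)
    then have "((\<lambda>y. v y - v x) \<longlongrightarrow> 0) (at x)"
      by (intro Lim_null_comparison[OF _ lim]) (auto elim!: eventually_mono intro: bound)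
    then show ?thesis by (simp add: isCont_def LIM_zero_iff)
  qed
  then show ?case by (auto intro: continuous_at_imp_continuous_on)
next
  case (Suc r)
  from Suc.prems(1) have "\<exists>f'. (\<forall>x\<in>S. (A has_derivative f' x) (at x)) \<and> (\<forall>v. Cr r S (\<lambda>x. f' x v))" by simp
  then obtain A' where A': "\<And>x. x \<in> S \<Longrightarrow> (A has_derivative A' x) (at x)"
      "\<And>v. Cr r S (\<lambda>x. A' x v)"
    by metis
  from Suc.prems(2) have "\<exists>f'. (\<forall>x\<in>S. (c has_derivative f' x) (at x)) \<and> (\<forall>v. Cr r S (\<lambda>x. f' x v))" by simp
  then obtain c' where c': "\<And>x. x \<in> S \<Longrightarrow> (c has_derivative c' x) (at x)"
      "\<And>v. Cr r S (\<lambda>x. c' x v)"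
    by metis
  have cr: "Cr r S A" "Cr r S c" using Suc.prems(1,2) by (auto simp del: Cr.simps intro: Cr_SucD)
  have v: "Cr r S v" by (rule Suc.IH[OF cr Suc.prems(3)])
  have An: "norm (A x k) \<le> \<kappa> * norm k" if "x \<in> S" for x k
    using norm_blinfun[of "A x" k] assms(4)[OF that]
    by (meson mult_right_mono norm_ge_zero order_trans)
  \<comment> \<open>The inhomogeneity of the formally differentiated equation; \<open>w\<close> is
    the candidate derivative.\<close>
  define a where "a x h = c' x h + A' x h (v x)" for x h
  define w where "w x h = (THE w. w = a x h + A x w)" for x h
  have w: "w x h = a x h + A x (w x h)" if "x \<in> S" for x h
    unfolding w_def by (rule theI'[OF ex1_affine_fixpoint[OF blinfun.bounded_linear_right An[OF that] assms(2,3)]])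
  have "(v has_derivative w x) (at x)" if x: "x \<in> S" for x
  proof (rule has_derivative_implicit_contraction[OF blinfun.bounded_linear_right An[OF x] assms(3) _ _ w[OF x]])
    show "bounded_linear (a x)"
      unfolding a_def
      by (intro bounded_linear_add has_derivative_bounded_linear[OF c'(1)[OF x]]
            bounded_linear_compose[OF blinfun.bounded_linear_left has_derivative_bounded_linear[OF A'(1)[OF x]]])
    fix e :: real assume "e > 0"
    obtain d0 where d0: "d0 > 0" "ball x d0 \<subseteq> S" using assms(1) x by (auto simp: open_contains_ball)
    from has_derivative_approxE[OF c'(1)[OF x], of "e/2"] \<open>e > 0\<close>
    obtain d1 where d1: "d1 > 0" "\<And>y. norm (y - x) < d1 \<Longrightarrow> norm (c y - c x - c' x (y - x)) \<le> e/2 * norm (y - x)"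
      by auto
    \<comment> \<open>The error of \<open>A\<close> acts on the fixed vector \<open>v x\<close>, so
      it must be smaller by the factor \<open>norm (v x)\<close>; adding 1 avoids division by
      zero.\<close>
    define e2 where "e2 = e / 2 / (norm (v x) + 1)"
    have e2: "e2 > 0" "e2 * norm (v x) \<le> e/2"
      using \<open>e > 0\<close> by (auto simp: e2_def field_simps add_pos_nonneg add_nonneg_pos)
    from has_derivative_approxE[OF A'(1)[OF x] e2(1)]
    obtain d2 where d2: "d2 > 0" "\<And>y. norm (y - x) < d2 \<Longrightarrow> norm (A y - A x - A' x (y - x)) \<le> e2 * norm (y - x)"
      by auto
    from has_derivative_continuous[OF A'(1)[OF x]] \<open>e > 0\<close>
    obtain d3 where d3: "d3 > 0" "\<And>y. norm (y - x) < d3 \<Longrightarrow> norm (A y - A x) < e"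
      unfolding continuous_at_eps_delta dist_norm by blast
    have "norm (v y - v x - a x (y - x) - A x (v y - v x)) \<le> e * (norm (y - x) + norm (v y - v x))"
      if y: "norm (y - x) < Min {d0, d1, d2, d3}" for y
    proof -
      have yS: "y \<in> S" using y d0(2) by (auto simp: dist_norm norm_minus_commute)
      \<comment> \<open>Three errors: the remainder of \<open>c\<close>, the remainder of
        \<open>A\<close> at \<open>v x\<close>, and the mixed term. The last is only small relative
        to \<open>v y - v x\<close>, which the criterion above allows.\<close>
      have "v y - v x - a x (y - x) - A x (v y - v x) =
         (c y - c x - c' x (y - x)) + (A y - A x - A' x (y - x)) (v x) + (A y - A x) (v y - v x)"
      proof -
        have Av: "A z (v z) = v z - c z" if "z \<in> S" for z
          using Suc.prems(3)[OF that] by (metis add_diff_cancel_left')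
        show ?thesis by (simp add: a_def blinfun.diff_left blinfun.diff_right Av x yS)
      qed
      also have "norm \<dots> \<le> norm (c y - c x - c' x (y - x)) + norm ((A y - A x - A' x (y - x)) (v x))
          + norm ((A y - A x) (v y - v x))"
        by (intro norm_triangle_le order_refl add_mono)
      also have "\<dots> \<le> e/2 * norm (y - x) + e/2 * norm (y - x) + e * norm (v y - v x)"
      proof (intro add_mono)
        show "norm (c y - c x - c' x (y - x)) \<le> e/2 * norm (y - x)" using y d1 by simp
        have "norm ((A y - A x - A' x (y - x)) (v x)) \<le> e2 * norm (y - x) * norm (v x)"
          using norm_blinfun[of "A y - A x - A' x (y - x)" "v x"] d2(2)[of y] y
          by (meson Min_gr_iff finite.intros insertCI mult_right_mono norm_ge_zero order_trans insert_not_empty)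
        also have "\<dots> = (e2 * norm (v x)) * norm (y - x)" by simp
        also have "\<dots> \<le> e/2 * norm (y - x)" using e2(2) by (rule mult_right_mono) simp
        finally show "norm ((A y - A x - A' x (y - x)) (v x)) \<le> e/2 * norm (y - x)" .
        have "norm (A y - A x) \<le> e" using d3(2)[of y] y by simp
        then show "norm ((A y - A x) (v y - v x)) \<le> e * norm (v y - v x)"
          using norm_blinfun[of "A y - A x" "v y - v x"] by (meson mult_right_mono norm_ge_zero order_trans)
      qed
      finally show ?thesis by (simp add: algebra_simps)
    qed
    then show "\<exists>d>0. \<forall>y. norm (y - x) < d \<longrightarrow>
       norm (v y - v x - a x (y - x) - A x (v y - v x)) \<le> e * (norm (y - x) + norm (v y - v x))"
      using d0 d1 d2 d3 by (intro exI[of _ "Min {d0, d1, d2, d3}"]) auto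
  qed
  then show ?case
  proof (rule Cr_SucI)
    fix h
    have "Cr r S (\<lambda>x. a x h)"
      unfolding a_def by (intro Cr_add c' A' v Cr_bilinear[OF bounded_bilinear_blinfun_apply])
    then show "Cr r S (\<lambda>x. w x h)" by (rule Suc.IH[OF cr(1)]) (rule w)
  qed
qed

lemma bounded_bilinear_linear_comp:
  assumes "bounded_bilinear B" "bounded_linear T"
  shows "bounded_bilinear (\<lambda>x y. T (B x y))"
proof -
  interpret B: bounded_bilinear B by fact
  interpret T: bounded_linear T by fact
  obtain k where k: "\<And>x y. norm (B x y) \<le> norm x * norm y * k" using B.bounded by blast
  obtain l where l: "\<And>z. norm (T z) \<le> norm z * l" "l \<ge> 0" using T.nonneg_bounded by blast
  have "norm (T (B x y)) \<le> norm x * norm y * (k * l)" for x y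
    using order_trans[OF l(1) mult_right_mono[OF k l(2)]] by (simp add: mult.assoc)
  then show ?thesis
    by unfold_locales (auto simp only: B.add_left B.add_right B.scaleR_left B.scaleR_right T.add T.scaleR)
qed

text \<open>Regularity of a given continuous family of fixed points, separated from its existence.
  The assumption \<open>contr\<close> concerns the linearization along the curves
  \<open>\<gamma> x\<close>, with a constant uniform in \<open>x\<close>.\<close>

locale nem_fixpoint =
  fixes S :: "'p::real_normed_vector set" and F :: "'a::euclidean_space \<Rightarrow> 'a" and F' :: "'a \<Rightarrow> 'a \<Rightarrow> 'a"
    and E :: "'p \<Rightarrow> real \<Rightarrow>\<^sub>C 'a" and K :: "(real \<Rightarrow>\<^sub>C 'a) \<Rightarrow> real \<Rightarrow>\<^sub>C 'a"
    and \<gamma> :: "'p \<Rightarrow> real \<Rightarrow>\<^sub>C 'a" and \<kappa> :: real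
  assumes S: "open S"
    and \<kappa>: "0 \<le> \<kappa>" "\<kappa> < 1"
    and F': "\<And>x. (F has_derivative F' x) (at x)" "\<And>v. continuous_on UNIV (\<lambda>x. F' x v)"
    and E: "bounded_linear E" and K: "bounded_linear K"
    and fixpoint: "\<And>x. x \<in> S \<Longrightarrow> \<gamma> x = E x + K (nem F (\<gamma> x))"
    and cont: "continuous_on S \<gamma>"
    and contr: "\<And>x h. x \<in> S \<Longrightarrow> norm (K (\<Sum>j\<in>Basis. smulc j h (nem (\<lambda>x. F' x j) (\<gamma> x)))) \<le> \<kappa> * norm h"
begin

definition DN where "DN x h = (\<Sum>j\<in>Basis. smulc j h (nem (\<lambda>x. F' x j) (\<gamma> x)))"

text \<open>The same operator as \<open>K\<close> composed with \<open>DN x\<close>, but written so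
  that it depends linearly on the curves of Jacobian columns; smoothness of
  \<open>x \<mapsto> A x\<close> in operator norm then reduces to \<open>Cr_nem\<close>.\<close>

definition A where "A x = (\<Sum>j\<in>Basis. Blinfun (\<lambda>h. K (smulc j h (nem (\<lambda>x. F' x j) (\<gamma> x)))))"

lemma bounded_bilinear_K_smulc: "bounded_bilinear (\<lambda>h w. K (smulc j h w))"
  by (rule bounded_bilinear_linear_comp[OF bounded_bilinear_smulc K])

lemma A_apply: "blinfun_apply (A x) h = K (DN x h)"
proof -
  interpret K: bounded_linear K by (rule K)
  have "bounded_linear (\<lambda>h. K (smulc j h w))" for j w
    by (rule bounded_bilinear.bounded_linear_left[OF bounded_bilinear_K_smulc])
  note * = bounded_linear_Blinfun_apply[OF this]
  show ?thesis
    unfolding A_def DN_def blinfun.sum_left K.sum * ..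
qed

lemma norm_A: "x \<in> S \<Longrightarrow> norm (A x) \<le> \<kappa>"
  using contr by (intro norm_blinfun_bound \<kappa>(1)) (simp add: A_apply DN_def)

definition \<gamma>' where "\<gamma>' x h = (THE w. w = E h + K (DN x w))"

lemma \<gamma>'_eq: "x \<in> S \<Longrightarrow> \<gamma>' x h = E h + K (DN x (\<gamma>' x h))"
  unfolding \<gamma>'_def A_apply[symmetric]
  by (rule theI'[of "\<lambda>w. w = E h + blinfun_apply (A x) w", OF ex1_affine_fixpoint[OF blinfun.bounded_linear_right _ \<kappa>]])
     (simp add: A_apply DN_def contr)

lemma has_derivative_\<gamma>:
  assumes "x \<in> S"
  shows "(\<gamma> has_derivative \<gamma>' x) (at x)"
proof (rule has_derivative_implicit_contraction[where A = "\<lambda>h. blinfun_apply (A x) h", OF blinfun.bounded_linear_right _ \<kappa>(2) E])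
  interpret K: bounded_linear K by (rule K)
  show "norm (A x k) \<le> \<kappa> * norm k" for k using contr assms by (simp add: A_apply DN_def)
  show "\<gamma>' x h = E h + A x (\<gamma>' x h)" for h unfolding A_apply by (rule \<gamma>'_eq[OF assms])
  fix e :: real assume "e > 0"
  obtain k where k: "\<And>u. norm (K u) \<le> norm u * k" "k > 0" using K.pos_bounded by blast
  have "e / k > 0" using \<open>e > 0\<close> k(2) by simp
  have "(nem F has_derivative DN x) (at (\<gamma> x))"
    using nem_has_derivative[OF F'] by (simp add: DN_def[abs_def])
  from has_derivative_approxE[OF this \<open>e / k > 0\<close>] obtain d where d: "d > 0" "\<And>u. norm (u - \<gamma> x) < d \<Longrightarrow>
     norm (nem F u - nem F (\<gamma> x) - DN x (u - \<gamma> x)) \<le> e / k * norm (u - \<gamma> x)" by blast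
  have "isCont \<gamma> x" using cont S assms by (simp add: continuous_on_eq_continuous_at)
  with d(1) obtain d1 where d1: "d1 > 0" "\<And>y. norm (y - x) < d1 \<Longrightarrow> norm (\<gamma> y - \<gamma> x) < d"
    unfolding continuous_at_eps_delta dist_norm by blast
  obtain d0 where d0: "d0 > 0" "ball x d0 \<subseteq> S" using S assms by (auto simp: open_contains_ball)
  have "norm (\<gamma> y - \<gamma> x - E (y - x) - A x (\<gamma> y - \<gamma> x)) \<le> e * (norm (y - x) + norm (\<gamma> y - \<gamma> x))"
    if y: "norm (y - x) < min d0 d1" for y
  proof -
    have yS: "y \<in> S" using y d0(2) by (auto simp: dist_norm norm_minus_commute)
    \<comment> \<open>The parameter enters linearly through \<open>E\<close>, so it cancels exactly
      and only the remainder of the superposition operator survives.\<close>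
    have "\<gamma> y - \<gamma> x - E (y - x) - A x (\<gamma> y - \<gamma> x) = K (nem F (\<gamma> y) - nem F (\<gamma> x) - DN x (\<gamma> y - \<gamma> x))"
    proof -
      have KN: "K (nem F (\<gamma> z)) = \<gamma> z - E z" if "z \<in> S" for z
        using fixpoint[OF that] by (metis add_diff_cancel_left')
      show ?thesis by (simp add: A_apply K.diff linear_diff[OF bounded_linear.linear[OF E]] KN assms yS)
    qed
    also have "norm \<dots> \<le> norm (nem F (\<gamma> y) - nem F (\<gamma> x) - DN x (\<gamma> y - \<gamma> x)) * k" by (rule k)
    also have "\<dots> \<le> (e / k * norm (\<gamma> y - \<gamma> x)) * k"
      using y k(2) by (intro mult_right_mono d d1) auto
    also have "\<dots> = e * norm (\<gamma> y - \<gamma> x)" using k(2) by simp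
    also have "\<dots> \<le> e * (norm (y - x) + norm (\<gamma> y - \<gamma> x))" using \<open>e > 0\<close> by simp
    finally show ?thesis .
  qed
  then show "\<exists>d>0. \<forall>y. norm (y - x) < d \<longrightarrow>
     norm (\<gamma> y - \<gamma> x - E (y - x) - A x (\<gamma> y - \<gamma> x)) \<le> e * (norm (y - x) + norm (\<gamma> y - \<gamma> x))"
    using d0(1) d1(1) by (intro exI[of _ "min d0 d1"]) auto
qed

lemma Cr_\<gamma>:
  assumes "\<And>v. Cr m UNIV (\<lambda>x. F' x v)" "r \<le> Suc m"
  shows "Cr r S \<gamma>"
  using assms(2)
proof (induction r)
  case 0
  then show ?case using cont by simp
next
  case (Suc r)
  then have IH: "Cr r S \<gamma>" and "r \<le> m" by auto
  \<comment> \<open>Currying: a bounded bilinear map is a bounded linear map into the space of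
    bounded operators, so \<open>Cr_bounded_linear\<close> applies to each summand of
    \<open>A\<close>.\<close>
  have T: "bounded_linear (\<lambda>w. Blinfun (\<lambda>h. K (smulc j h w)))" for j :: 'a
    by (rule iffD1[OF transfer_bounded_bilinear_bounded_linearI bounded_bilinear.flip[OF bounded_bilinear_K_smulc[of j]]])
       (simp add: bounded_linear_Blinfun_apply bounded_bilinear.bounded_linear_left[OF bounded_bilinear_K_smulc])
  have A: "Cr r S A"
    unfolding A_def
  proof (rule Cr_sum)
    fix j :: 'a
    have "Cr r S (\<lambda>x. nem (\<lambda>x. F' x j) (\<gamma> x))"
      by (rule Cr_nem[OF Cr_mono[OF assms(1) \<open>r \<le> m\<close>] IH])
    from Cr_bounded_linear[OF T this]
    show "Cr r S (\<lambda>x. Blinfun (\<lambda>h. K (smulc j h (nem (\<lambda>x. F' x j) (\<gamma> x)))))" .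
  qed
  show ?case
    by (rule Cr_SucI[OF has_derivative_\<gamma>], assumption)
       (rule Cr_linear_fixpoint[OF S \<kappa> norm_A A Cr_const], assumption, unfold A_apply, rule \<gamma>'_eq)
qed

end

section \<open>Scalar linear equations on a half line\<close>

lemma has_vector_derivative_exp:
  "((\<lambda>t. exp (l * complex_of_real t)) has_vector_derivative l * exp (l * of_real t)) (at t within S)"
  by (rule has_vector_derivative_real_field) (auto intro!: derivative_eq_intros)

lemma integral_has_vector_derivative_atLeast:
  fixes g :: "real \<Rightarrow> 'a::banach"
  assumes "continuous_on {a..} g" "t \<ge> a"
  shows "((\<lambda>t. integral {a..t} g) has_vector_derivative g t) (at t within {a..})"
proof -
  have "at t within {a..t+1} = at t within {a..}"
    by (rule at_within_nhd[where S = "{..<t+1}"]) auto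
  moreover have "((\<lambda>t. integral {a..t} g) has_vector_derivative g t) (at t within {a..t+1})"
    by (rule integral_has_vector_derivative) (use assms in \<open>auto intro: continuous_on_subset\<close>)
  ultimately show ?thesis by simp
qed

lemma norm_exp_mult: "norm (exp (c * complex_of_real s)) = exp (Re c * s)"
  by (simp add: norm_exp_eq_Re)

lemma exp_linear_ode:
  assumes "\<And>t. t \<ge> 0 \<Longrightarrow> (m has_vector_derivative \<mu> * m t) (at t within {0..})" "t \<ge> 0"
  shows "m t = exp (\<mu> * complex_of_real t) * m 0"
proof -
  have "((\<lambda>t. exp (- \<mu> * complex_of_real t) * m t) has_vector_derivative 0) (at s within {0..})" if "s \<in> {0..}" for s
    by (rule has_vector_derivative_eq_rhs[OF has_vector_derivative_mult[OF has_vector_derivative_exp assms(1)]])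
       (use that in auto)
  then obtain c where c: "\<And>s. s \<in> {0..} \<Longrightarrow> exp (- \<mu> * complex_of_real s) * m s = c"
    using has_vector_derivative_zero_constant[of "{0..}" "\<lambda>t. exp (- \<mu> * complex_of_real t) * m t"] by blast
  have "exp (- \<mu> * complex_of_real t) * m t = m 0" using c[of 0] c[of t] assms(2) by simp
  then show ?thesis by (simp add: exp_minus field_simps)
qed

lemma bounded_growing_ode_zero:
  assumes "\<And>t. t \<ge> 0 \<Longrightarrow> (m has_vector_derivative \<mu> * m t) (at t within {0..})"
    and "Re \<mu> > 0" "\<And>t. t \<ge> 0 \<Longrightarrow> norm (m t) \<le> B" "t \<ge> 0"
  shows "m t = 0"
proof -
  have eq: "m t = exp (\<mu> * complex_of_real t) * m 0" if "t \<ge> 0" for t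
    using exp_linear_ode[OF assms(1) that] by simp
  have "m 0 = 0"
  proof (rule ccontr)
    assume "m 0 \<noteq> 0"
    have B: "B \<ge> 0" using order_trans[OF norm_ge_zero assms(3)[of 0]] by simp
    \<comment> \<open>At this time the linear lower bound for the exponential already gives
      \<open>norm (m T) \<ge> norm (m 0) + B\<close>, contradicting the bound
      \<open>B\<close>.\<close>
    define T where "T = B / (norm (m 0) * Re \<mu>)"
    have T: "T \<ge> 0" using B assms(2) by (simp add: T_def)
    have "norm (m T) = exp (Re \<mu> * T) * norm (m 0)"
      by (subst eq[OF T]) (simp add: norm_mult norm_exp_mult)
    moreover have "(1 + Re \<mu> * T) * norm (m 0) \<le> exp (Re \<mu> * T) * norm (m 0)"
      by (intro mult_right_mono exp_ge_add_one_self) auto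
    moreover have "(1 + Re \<mu> * T) * norm (m 0) = norm (m 0) + B"
      using \<open>m 0 \<noteq> 0\<close> assms(2) by (simp add: T_def field_simps)
    moreover have "norm (m 0) > 0" using \<open>m 0 \<noteq> 0\<close> by simp
    ultimately show False using assms(3)[OF T] by linarith
  qed
  then show ?thesis using eq[OF assms(4)] by simp
qed

text \<open>Curves on \<open>[0, \<infinity>)\<close> are encoded as bounded continuous functions on the whole line that are constant for \<open>t \<le> 0\<close>.\<close>

definition halfline :: "(real \<Rightarrow> 'a) \<Rightarrow> real \<Rightarrow>\<^sub>C 'a::real_normed_vector" where
  "halfline g = Bcontfun (\<lambda>t. g (max t 0))"

lemma apply_halfline:
  assumes "continuous_on {0..} g" "\<And>t. t \<ge> 0 \<Longrightarrow> norm (g t) \<le> B"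
  shows "apply_bcontfun (halfline g) = (\<lambda>t. g (max t 0))"
  unfolding halfline_def
  by (rule apply_Bcontfun[where B=B])
     (auto intro!: continuous_on_compose2[OF assms(1)] continuous_intros assms(2))

lemma has_vector_derivative_halfline:
  assumes "continuous_on {0..} g" "\<And>t. t \<ge> 0 \<Longrightarrow> norm (g t) \<le> B"
    and "(g has_vector_derivative d) (at t within {0..})" "t \<ge> 0"
  shows "(apply_bcontfun (halfline g) has_vector_derivative d) (at t within {0..})"
  by (rule has_vector_derivative_transform[OF _ _ assms(3)])
     (use assms(4) in \<open>auto simp: apply_halfline[OF assms(1,2)]\<close>)

lemma tendsto_halfline:
  assumes "continuous_on {0..} g" "\<And>t. t \<ge> 0 \<Longrightarrow> norm (g t) \<le> B" "(g \<longlongrightarrow> l) at_top"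
  shows "(apply_bcontfun (halfline g) \<longlongrightarrow> l) at_top"
  by (rule Lim_transform_eventually[OF assms(3)])
     (auto simp: apply_halfline[OF assms(1,2)] eventually_at_top_linorder intro!: exI[of _ 0])

lemma has_vector_derivative_imp_continuous_on:
  assumes "\<And>t. t \<in> S \<Longrightarrow> (f has_vector_derivative f' t) (at t within S)"
  shows "continuous_on S f"
  using assms by (auto simp: continuous_on_eq_continuous_within intro: has_vector_derivative_continuous)

definition expc :: "complex \<Rightarrow> real \<Rightarrow>\<^sub>C complex" where
  "expc l = halfline (\<lambda>t. exp (l * of_real t))"

lemma expc:
  assumes "Re l < 0"
  shows expc_0: "apply_bcontfun (expc l) 0 = 1"
    and expc_neg: "t < 0 \<Longrightarrow> apply_bcontfun (expc l) t = expc l 0"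
    and expc_deriv: "t \<ge> 0 \<Longrightarrow> (apply_bcontfun (expc l) has_vector_derivative l * expc l t) (at t within {0..})"
    and expc_lim: "(apply_bcontfun (expc l) \<longlongrightarrow> 0) at_top"
proof -
  have c: "continuous_on {0..} (\<lambda>t. exp (l * complex_of_real t))" by (intro continuous_intros)
  have b: "norm (exp (l * complex_of_real t)) \<le> 1" if "t \<ge> 0" for t
    using that assms by (simp add: norm_exp_mult mult_nonpos_nonneg)
  note a = apply_halfline[OF c b, folded expc_def]
  show "apply_bcontfun (expc l) 0 = 1" by (simp add: a)
  show "t < 0 \<Longrightarrow> apply_bcontfun (expc l) t = expc l 0" by (simp add: a)
  show "(apply_bcontfun (expc l) has_vector_derivative l * expc l t) (at t within {0..})" if "t \<ge> 0"
    using has_vector_derivative_halfline[OF c b has_vector_derivative_exp that, folded expc_def] that by (simp add: a)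
  have "filterlim (\<lambda>t. Re l * t) at_bot at_top"
    using assms by (intro filterlim_tendsto_neg_mult_at_bot[OF tendsto_const] filterlim_ident)
  then have "((\<lambda>t. exp (Re l * t)) \<longlongrightarrow> 0) at_top"
    by (rule filterlim_compose[OF exp_at_bot])
  then have "((\<lambda>t. exp (l * complex_of_real t)) \<longlongrightarrow> 0) at_top"
    by (subst tendsto_norm_zero_iff[symmetric]) (simp add: norm_exp_mult)
  then show "(apply_bcontfun (expc l) \<longlongrightarrow> 0) at_top"
    unfolding expc_def by (intro tendsto_halfline[OF c b])
qed

text \<open>The only bounded solution of \<open>m' = \<mu> m + f\<close> on \<open>[0, \<infinity>)\<close> when \<open>Re \<mu> > 0\<close>.\<close>

definition solU_fun :: "complex \<Rightarrow> (real \<Rightarrow> complex) \<Rightarrow> real \<Rightarrow> complex" where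
  "solU_fun \<mu> f t = - exp (\<mu> * of_real t) * integral {t..} (\<lambda>s. exp (- \<mu> * of_real s) * f s)"

definition solU :: "complex \<Rightarrow> (real \<Rightarrow>\<^sub>C complex) \<Rightarrow> real \<Rightarrow>\<^sub>C complex" where
  "solU \<mu> f = halfline (solU_fun \<mu> f)"

lemma exp_integrable:
  assumes "Re \<mu> > 0"
  shows "(\<lambda>s. exp (- \<mu> * complex_of_real s) * apply_bcontfun f s) integrable_on {t..}"
proof (rule measurable_bounded_by_integrable_imp_integrable)
  show "(\<lambda>s. exp (- \<mu> * complex_of_real s) * apply_bcontfun f s) \<in> borel_measurable (lebesgue_on {t..})"
    by (intro continuous_imp_measurable_on_sets_lebesgue continuous_intros) auto
  show "(\<lambda>s. exp (- Re \<mu> * s) * norm f) integrable_on {t..}"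
    using has_integral_exp_minus_to_infinity[OF assms, of t]
    by (intro integrable_on_mult_left) (auto simp: integrable_on_def)
  show "norm (exp (- \<mu> * complex_of_real s) * apply_bcontfun f s) \<le> exp (- Re \<mu> * s) * norm f" for s
    by (simp add: norm_mult norm_exp_eq_Re norm_bounded)
qed auto

text \<open>Only values of \<open>f\<close> after time \<open>t\<close> enter the integral. The
  bound \<open>B\<close> is therefore required only there, which gives boundedness and, with a tail
  bound, decay.\<close>

lemma solU_fun_bound:
  assumes "Re \<mu> > 0" "\<And>s. s \<ge> t \<Longrightarrow> norm (apply_bcontfun f s) \<le> B"
  shows "norm (solU_fun \<mu> f t) \<le> B / Re \<mu>"
proof -
  have "norm (integral {t..} (\<lambda>s. exp (- \<mu> * of_real s) * f s)) \<le> integral {t..} (\<lambda>s. exp (- Re \<mu> * s) * B)"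
  proof (rule integral_norm_bound_integral[OF exp_integrable[OF assms(1)]])
    show "(\<lambda>s. exp (- Re \<mu> * s) * B) integrable_on {t..}"
      using has_integral_exp_minus_to_infinity[OF assms(1), of t]
      by (intro integrable_on_mult_left) (auto simp: integrable_on_def)
  qed (use assms(2) in \<open>simp add: norm_mult norm_exp_eq_Re\<close>)
  also have "\<dots> = exp (- Re \<mu> * t) / Re \<mu> * B"
    using integral_unique[OF has_integral_mult_left[OF has_integral_exp_minus_to_infinity[OF assms(1), of t], of B]] .
  finally have "exp (Re \<mu> * t) * norm (integral {t..} (\<lambda>s. exp (- \<mu> * of_real s) * f s)) \<le> 
      exp (Re \<mu> * t) * (exp (- Re \<mu> * t) / Re \<mu> * B)" by (intro mult_left_mono) auto
  also have "\<dots> = B / Re \<mu>" by (simp add: exp_minus)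
  finally show ?thesis by (simp add: solU_fun_def norm_mult norm_exp_mult)
qed

lemma solU_fun_deriv:
  assumes "Re \<mu> > 0" "t \<ge> 0"
  shows "(solU_fun \<mu> (apply_bcontfun f) has_vector_derivative \<mu> * solU_fun \<mu> f t + f t) (at t within {0..})"
proof -
  define g where "g = (\<lambda>s. exp (- \<mu> * complex_of_real s) * apply_bcontfun f s)"
  have int: "g integrable_on {t..}" for t unfolding g_def by (rule exp_integrable[OF assms(1)])
  have cont: "continuous_on S g" for S unfolding g_def by (intro continuous_intros; simp)
  \<comment> \<open>The tail integral becomes a constant minus an integral with variable upper
    limit, to which the fundamental theorem applies.\<close>
  have J: "integral {t..} g = integral {0..} g - integral {0..t} g" if "t \<ge> 0" for t
  proof -
    have "(g has_integral integral {0..t} g + integral {t..} g) ({0..t} \<union> {t..})"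
      by (rule has_integral_Un)
         (auto intro!: integrable_integral int integrable_continuous_real cont negligible_subset[OF negligible_sing[of t]])
    moreover have "{0..t} \<union> {t..} = {0..}" using that by auto
    ultimately show ?thesis by (auto dest: integral_unique)
  qed
  have d: "((\<lambda>t. - exp (\<mu> * of_real t) * (integral {0..} g - integral {0..t} g)) has_vector_derivative
      (- exp (\<mu> * of_real t)) * (0 - g t) + (- (\<mu> * exp (\<mu> * of_real t))) * (integral {0..} g - integral {0..t} g))
      (at t within {0..})"
    by (intro has_vector_derivative_mult has_vector_derivative_minus has_vector_derivative_exp
       has_vector_derivative_diff has_vector_derivative_const integral_has_vector_derivative_atLeast cont assms)
  have e: "exp (\<mu> * complex_of_real t) * g t = f t" by (simp add: g_def exp_minus)
  have "(- exp (\<mu> * of_real t)) * (0 - g t) + (- (\<mu> * exp (\<mu> * of_real t))) * (integral {0..} g - integral {0..t} g)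
     = \<mu> * solU_fun \<mu> f t + f t"
    unfolding solU_fun_def g_def[symmetric] J[OF assms(2)] e[symmetric] by (simp add: algebra_simps)
  with d have d': "((\<lambda>t. - exp (\<mu> * of_real t) * (integral {0..} g - integral {0..t} g)) has_vector_derivative
     \<mu> * solU_fun \<mu> f t + f t) (at t within {0..})" by simp
  have "solU_fun \<mu> f s = - exp (\<mu> * of_real s) * (integral {0..} g - integral {0..s} g)" if "s \<in> {0..}" for s
    using that unfolding solU_fun_def g_def[symmetric] by (subst J) auto
  then show ?thesis
    by (intro has_vector_derivative_transform[OF _ _ d']) (use assms(2) in auto)
qed

lemma
  assumes "Re \<mu> > 0"
  shows apply_solU: "apply_bcontfun (solU \<mu> f) = (\<lambda>t. solU_fun \<mu> f (max t 0))"
    and solU_deriv: "t \<ge> 0 \<Longrightarrow> (apply_bcontfun (solU \<mu> f) has_vector_derivative \<mu> * solU \<mu> f t + f t) (at t within {0..})"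
    and solU_lim: "(apply_bcontfun f \<longlongrightarrow> 0) at_top \<Longrightarrow> (apply_bcontfun (solU \<mu> f) \<longlongrightarrow> 0) at_top"
proof -
  have c: "continuous_on {0..} (solU_fun \<mu> f)"
    by (rule has_vector_derivative_imp_continuous_on[OF solU_fun_deriv]) (use assms in auto)
  have b: "norm (solU_fun \<mu> f t) \<le> norm f / Re \<mu>" for t
    by (rule solU_fun_bound[OF assms]) (rule norm_bounded)
  show a: "apply_bcontfun (solU \<mu> f) = (\<lambda>t. solU_fun \<mu> f (max t 0))"
    unfolding solU_def by (rule apply_halfline[OF c b])
  show "(apply_bcontfun (solU \<mu> f) has_vector_derivative \<mu> * solU \<mu> f t + f t) (at t within {0..})" if "t \<ge> 0"
    using has_vector_derivative_halfline[OF c b solU_fun_deriv[OF assms that] that, folded solU_def] that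
    by (simp add: a)
  show "(apply_bcontfun (solU \<mu> f) \<longlongrightarrow> 0) at_top" if lim: "(apply_bcontfun f \<longlongrightarrow> 0) at_top"
    unfolding solU_def
  proof (rule tendsto_halfline[OF c b], rule tendstoI)
    fix e :: real assume "e > 0"
    then have "e/2 * Re \<mu> > 0" using assms by simp
    from tendstoD[OF lim this] obtain T where T: "\<And>s. s \<ge> T \<Longrightarrow> norm (f s) < e/2 * Re \<mu>"
      by (auto simp: eventually_at_top_linorder)
    have "norm (solU_fun \<mu> f t) \<le> e/2 * Re \<mu> / Re \<mu>" if "t \<ge> T" for t
      by (rule solU_fun_bound[OF assms]) (use T that in \<open>auto intro!: less_imp_le\<close>)
    then have "dist (solU_fun \<mu> f t) 0 < e" if "t \<ge> T" for t
      using that \<open>e > 0\<close> assms by (force simp: field_simps)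
    then show "eventually (\<lambda>t. dist (solU_fun \<mu> f t) 0 < e) at_top"
      by (auto simp: eventually_at_top_linorder)
  qed
qed

lemma bounded_linear_solU:
  assumes "Re \<mu> > 0"
  shows "bounded_linear (solU \<mu>)"
proof (rule bounded_linear_intro[where K = "1 / Re \<mu>"])
  fix f g :: "real \<Rightarrow>\<^sub>C complex" and r :: real
  have "solU_fun \<mu> (f + g) t = solU_fun \<mu> f t + solU_fun \<mu> g t" for t
    using integral_add[OF exp_integrable[OF assms, of f t] exp_integrable[OF assms, of g t]]
    by (simp add: solU_fun_def distrib_left)
  then show "solU \<mu> (f + g) = solU \<mu> f + solU \<mu> g"
    by (intro bcontfun_eqI) (simp add: apply_solU[OF assms])
  have "solU_fun \<mu> (r *\<^sub>R f) t = r *\<^sub>R solU_fun \<mu> f t" for t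
    by (simp add: solU_fun_def integral_cmul)
  then show "solU \<mu> (r *\<^sub>R f) = r *\<^sub>R solU \<mu> f"
    by (intro bcontfun_eqI) (simp add: apply_solU[OF assms])
  show "norm (solU \<mu> f) \<le> norm f * (1 / Re \<mu>)"
    using solU_fun_bound[OF assms norm_bounded, of f] by (intro norm_bound) (simp add: apply_solU[OF assms])
qed

text \<open>The solution of \<open>w' = l w + f\<close> with \<open>w 0 = 0\<close>, used for \<open>Re l < 0\<close>.\<close>

definition solW_fun :: "complex \<Rightarrow> (real \<Rightarrow> complex) \<Rightarrow> real \<Rightarrow> complex" where
  "solW_fun l f t = exp (l * of_real t) * integral {0..t} (\<lambda>s. exp (- l * of_real s) * f s)"

definition solW :: "complex \<Rightarrow> (real \<Rightarrow>\<^sub>C complex) \<Rightarrow> real \<Rightarrow>\<^sub>C complex" where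
  "solW l f = halfline (solW_fun l f)"

lemma exp_integrable_compact:
  "(\<lambda>s. exp (- l * complex_of_real s) * apply_bcontfun f s) integrable_on {a..b}"
  by (intro integrable_continuous_real continuous_intros; simp)

text \<open>The lower limit \<open>T\<close> is free: \<open>T = 0\<close> gives boundedness of the
  solution, a large \<open>T\<close> makes the contribution of the tail of \<open>f\<close>
  small.\<close>

lemma exp_integral_bound:
  assumes "Re l < 0" "T \<le> t" "\<And>s. s \<ge> T \<Longrightarrow> norm (apply_bcontfun f s) \<le> B" "B \<ge> 0"
  shows "norm (exp (l * of_real t) * integral {T..t} (\<lambda>s. exp (- l * of_real s) * f s)) \<le> B / (- Re l)"
proof -
  have i: "((\<lambda>s. exp (- Re l * s) * B) has_integral
      (exp (- Re l * t) / (- Re l) * B - exp (- Re l * T) / (- Re l) * B)) {T..t}"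
    by (rule fundamental_theorem_of_calculus[OF assms(2)])
       (use assms(1) in \<open>auto intro!: derivative_eq_intros simp: has_real_derivative_iff_has_vector_derivative[symmetric]\<close>)
  have "norm (integral {T..t} (\<lambda>s. exp (- l * of_real s) * f s)) \<le> integral {T..t} (\<lambda>s. exp (- Re l * s) * B)"
    by (rule integral_norm_bound_integral[OF exp_integrable_compact])
       (use i assms(3) in \<open>auto simp: norm_mult norm_exp_eq_Re integrable_on_def\<close>)
  also have "\<dots> = exp (- Re l * t) / (- Re l) * B - exp (- Re l * T) / (- Re l) * B"
    using integral_unique[OF i] .
  also have "\<dots> \<le> exp (- Re l * t) / (- Re l) * B" using assms(1,4) by (simp add: divide_nonneg_neg)
  finally have "exp (Re l * t) * norm (integral {T..t} (\<lambda>s. exp (- l * of_real s) * f s)) \<le>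
     exp (Re l * t) * (exp (- Re l * t) / (- Re l) * B)" by (intro mult_left_mono) auto
  also have "\<dots> = B / (- Re l)" by (simp add: exp_minus)
  finally show ?thesis by (simp add: norm_mult norm_exp_mult)
qed

lemma solW_fun_bound:
  assumes "Re l < 0" "t \<ge> 0"
  shows "norm (solW_fun l (apply_bcontfun f) t) \<le> norm f / (- Re l)"
  unfolding solW_fun_def by (rule exp_integral_bound[OF assms norm_bounded norm_ge_zero])

lemma solW_fun_deriv:
  assumes "t \<ge> 0"
  shows "(solW_fun l (apply_bcontfun f) has_vector_derivative l * solW_fun l f t + f t) (at t within {0..})"
proof -
  have "(solW_fun l (apply_bcontfun f) has_vector_derivative 
     exp (l * of_real t) * (exp (- l * of_real t) * f t) + l * exp (l * of_real t) * integral {0..t} (\<lambda>s. exp (- l * of_real s) * f s))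
       (at t within {0..})"
    unfolding solW_fun_def [abs_def]
    by (intro has_vector_derivative_mult has_vector_derivative_exp integral_has_vector_derivative_atLeast assms continuous_intros) auto
  moreover have "exp (l * of_real t) * (exp (- l * of_real t) * f t) = f t" by (simp add: exp_minus)
  ultimately show ?thesis by (simp only: solW_fun_def mult.assoc add.commute)
qed

text \<open>For decay of the solution: the history up to \<open>T\<close> is damped exponentially,
  while what is added after \<open>T\<close> is as small as the tail of \<open>f\<close>.\<close>

lemma solW_fun_split:
  assumes "0 \<le> T" "T \<le> t"
  shows "solW_fun l (apply_bcontfun f) t = exp (l * of_real (t - T)) * solW_fun l f T +
     exp (l * of_real t) * integral {T..t} (\<lambda>s. exp (- l * of_real s) * f s)"
proof -
  have "integral {0..T} (\<lambda>s. exp (- l * of_real s) * f s) + integral {T..t} (\<lambda>s. exp (- l * of_real s) * f s)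
     = integral {0..t} (\<lambda>s. exp (- l * complex_of_real s) * f s)"
    by (rule Henstock_Kurzweil_Integration.integral_combine[OF assms exp_integrable_compact])
  moreover have "exp (l * of_real (t - T)) * exp (l * complex_of_real T) = exp (l * of_real t)"
    by (simp add: exp_add[symmetric] algebra_simps)
  ultimately show ?thesis
    unfolding solW_fun_def mult.assoc[symmetric] by (simp add: distrib_left[symmetric])
qed

lemma
  assumes "Re l < 0"
  shows apply_solW: "apply_bcontfun (solW l f) = (\<lambda>t. solW_fun l f (max t 0))"
    and solW_deriv: "t \<ge> 0 \<Longrightarrow> (apply_bcontfun (solW l f) has_vector_derivative l * solW l f t + f t) (at t within {0..})"
    and solW_lim: "(apply_bcontfun f \<longlongrightarrow> 0) at_top \<Longrightarrow> (apply_bcontfun (solW l f) \<longlongrightarrow> 0) at_top"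
    and solW_0: "apply_bcontfun (solW l f) 0 = 0"
proof -
  have c: "continuous_on {0..} (solW_fun l f)"
    by (rule has_vector_derivative_imp_continuous_on[OF solW_fun_deriv]) auto
  note b = solW_fun_bound[OF assms]
  show a: "apply_bcontfun (solW l f) = (\<lambda>t. solW_fun l f (max t 0))"
    unfolding solW_def by (rule apply_halfline[OF c b])
  show "apply_bcontfun (solW l f) 0 = 0" by (simp add: a solW_fun_def)
  show "(apply_bcontfun (solW l f) has_vector_derivative l * solW l f t + f t) (at t within {0..})" if "t \<ge> 0"
    using has_vector_derivative_halfline[OF c b solW_fun_deriv[OF that] that, folded solW_def] that
    by (simp add: a)
  show "(apply_bcontfun (solW l f) \<longlongrightarrow> 0) at_top" if lim: "(apply_bcontfun f \<longlongrightarrow> 0) at_top"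
    unfolding solW_def
  proof (rule tendsto_halfline[OF c b], assumption, rule tendstoI)
    fix e :: real assume "e > 0"
    then have "e/2 * (- Re l) > 0" using assms by (simp add: mult_pos_neg)
    from tendstoD[OF lim this] obtain T0 where T0: "\<And>s. s \<ge> T0 \<Longrightarrow> norm (f s) < e/2 * (- Re l)"
      by (auto simp: eventually_at_top_linorder)
    define T where "T = max T0 0"
    have T: "T \<ge> 0" "\<And>s. s \<ge> T \<Longrightarrow> norm (f s) \<le> e/2 * (- Re l)"
      using T0 by (auto simp: T_def intro!: less_imp_le)
    have tail: "norm (exp (l * of_real t) * integral {T..t} (\<lambda>s. exp (- l * of_real s) * f s)) \<le> e/2" if "t \<ge> T" for t
    proof -
      have "norm (exp (l * of_real t) * integral {T..t} (\<lambda>s. exp (- l * of_real s) * f s)) \<le> e/2 * (- Re l) / (- Re l)"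
        by (rule exp_integral_bound[OF assms that T(2)]) (use \<open>e/2 * (- Re l) > 0\<close> in auto)
      then show ?thesis using assms by simp
    qed
    have "filterlim (\<lambda>t. t - T) at_top at_top"
      using filterlim_tendsto_add_at_top[OF tendsto_const[of "-T"] filterlim_ident] by simp
    then have "filterlim (\<lambda>t. Re l * (t - T)) at_bot at_top"
      using assms by (intro filterlim_tendsto_neg_mult_at_bot[OF tendsto_const])
    then have "((\<lambda>t. exp (Re l * (t - T)) * norm (solW_fun l f T)) \<longlongrightarrow> 0 * norm (solW_fun l f T)) at_top"
      by (intro tendsto_mult tendsto_const filterlim_compose[OF exp_at_bot])
    then have "eventually (\<lambda>t. dist (exp (Re l * (t - T)) * norm (solW_fun l f T)) 0 < e/2) at_top"
      using \<open>e > 0\<close> by (intro tendstoD) auto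
    then show "eventually (\<lambda>t. dist (solW_fun l f t) 0 < e) at_top"
      using eventually_ge_at_top[of T]
    proof eventually_elim
      case (elim t)
      have "norm (solW_fun l f t) \<le> norm (exp (l * of_real (t - T)) * solW_fun l f T) + e/2"
        unfolding solW_fun_split[OF T(1) elim(2)] using tail[OF elim(2)] norm_triangle_mono order_refl by blast
      also have "norm (exp (l * of_real (t - T)) * solW_fun l f T) = exp (Re l * (t - T)) * norm (solW_fun l f T)"
        by (simp only: norm_mult norm_exp_mult)
      finally show ?case using elim(1) by (simp add: dist_norm)
    qed
  qed
qed

lemma bounded_linear_solW:
  assumes "Re l < 0"
  shows "bounded_linear (solW l)"
proof (rule bounded_linear_intro[where K = "1 / (- Re l)"])
  fix f g :: "real \<Rightarrow>\<^sub>C complex" and r :: real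
  have "solW_fun l (f + g) t = solW_fun l f t + solW_fun l g t" for t
    using integral_add[OF exp_integrable_compact[of l f 0 t] exp_integrable_compact[of l g 0 t]]
    by (simp add: solW_fun_def distrib_left)
  then show "solW l (f + g) = solW l f + solW l g"
    by (intro bcontfun_eqI) (simp add: apply_solW[OF assms])
  have "solW_fun l (r *\<^sub>R f) t = r *\<^sub>R solW_fun l f t" for t
    by (simp add: solW_fun_def integral_cmul)
  then show "solW l (r *\<^sub>R f) = r *\<^sub>R solW l f"
    by (intro bcontfun_eqI) (simp add: apply_solW[OF assms])
  show "norm (solW l f) \<le> norm f * (1 / (- Re l))"
    using solW_fun_bound[OF assms] by (intro norm_bound) (simp add: apply_solW[OF assms])
qed

section \<open>Stable manifolds of vector fields\<close>

text \<open>Uniform limits of decaying curves decay. This makes the domain of the contraction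
  complete and transfers decay from \<open>\<gamma>\<close> to its derivatives, which are limits of
  difference quotients.\<close>

lemma closed_tendsto_0: "closed {u :: real \<Rightarrow>\<^sub>C 'a::real_normed_vector. (apply_bcontfun u \<longlongrightarrow> 0) at_top}"
  unfolding closed_sequential_limits
proof safe
  fix f :: "nat \<Rightarrow> real \<Rightarrow>\<^sub>C 'a" and l
  assume f: "\<forall>n. f n \<in> {u. (apply_bcontfun u \<longlongrightarrow> 0) at_top}" and "f \<longlonglongrightarrow> l"
  show "(apply_bcontfun l \<longlongrightarrow> 0) at_top"
  proof (rule tendstoI)
    fix e :: real assume "e > 0"
    then have "e/2 > 0" by simp
    from LIMSEQ_D[OF \<open>f \<longlonglongrightarrow> l\<close> this] obtain n where n: "norm (f n - l) < e/2" by blast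
    from f have "(apply_bcontfun (f n) \<longlongrightarrow> 0) at_top" by blast
    from tendstoD[OF this \<open>e/2 > 0\<close>]
    show "eventually (\<lambda>t. dist (l t) 0 < e) at_top"
    proof eventually_elim
      case (elim t)
      have "norm (f n t - l t) < e/2" using n norm_bounded[of "f n - l" t] by simp
      then show ?case using elim norm_triangle_sub[of "l t" "f n t"] by (simp add: norm_minus_commute)
    qed
  qed
qed

lemma has_vector_derivative_shift_halfline:
  assumes "(u has_vector_derivative d) (at (s + t) within {0..})" "0 \<le> s" "0 \<le> t"
  shows "((\<lambda>s. u (s + t)) has_vector_derivative d) (at s within {0..})"
proof -
  have "(\<lambda>s. s + t) ` {0..} \<subseteq> {0..}" using assms(3) by auto
  then have "(u has_vector_derivative d) (at (s + t) within (\<lambda>s. s + t) ` {0..})"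
    by (rule has_vector_derivative_within_subset[OF assms(1)])
  moreover have "((\<lambda>s. s + t) has_vector_derivative 1) (at s within {0..})"
    by (auto intro!: derivative_eq_intros)
  ultimately show ?thesis
    using vector_diff_chain_within[of "\<lambda>s. s + t" 1 s "{0..}" u d] by (simp add: o_def)
qed

lemma has_vector_derivative_imp_quotient:
  fixes f :: "'p::real_normed_vector \<Rightarrow> 'a::real_normed_vector"
  assumes "((\<lambda>s. f (x + s *\<^sub>R h)) has_vector_derivative v) (at 0)"
  shows "((\<lambda>s. (f (x + s *\<^sub>R h) - f x) /\<^sub>R s) \<longlongrightarrow> v) (at 0)"
proof -
  have "((\<lambda>s. (f (x + s *\<^sub>R h) - f x - s *\<^sub>R v) /\<^sub>R norm s) \<longlongrightarrow> 0) (at 0)"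
    using assms by (simp add: has_vector_derivative_def has_derivative_at_within)
  then have lim: "((\<lambda>s. norm ((f (x + s *\<^sub>R h) - f x - s *\<^sub>R v) /\<^sub>R norm s)) \<longlongrightarrow> 0) (at 0)"
    by (rule tendsto_norm_zero)
  have "((\<lambda>s. (f (x + s *\<^sub>R h) - f x) /\<^sub>R s - v) \<longlongrightarrow> 0) (at 0)"
  proof (rule Lim_null_comparison[OF _ lim])
    have "norm ((f (x + s *\<^sub>R h) - f x) /\<^sub>R s - v) = norm ((f (x + s *\<^sub>R h) - f x - s *\<^sub>R v) /\<^sub>R norm s)" if "s \<noteq> 0" for s
    proof -
      have "(f (x + s *\<^sub>R h) - f x) /\<^sub>R s - v = (f (x + s *\<^sub>R h) - f x - s *\<^sub>R v) /\<^sub>R s"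
        using that by (simp add: scaleR_diff_right)
      then show ?thesis by simp
    qed
    then show "eventually (\<lambda>s. norm ((f (x + s *\<^sub>R h) - f x) /\<^sub>R s - v) \<le>
        norm ((f (x + s *\<^sub>R h) - f x - s *\<^sub>R v) /\<^sub>R norm s)) (at 0)"
      by (simp add: eventually_at_filter)
  qed
  then show ?thesis by (simp add: LIM_zero_iff)
qed

definition stable_set :: "('a::real_normed_vector \<Rightarrow> 'a) \<Rightarrow> 'a set \<Rightarrow> 'a set" where
  "stable_set \<xi> U = {P \<in> U. \<exists>c :: real \<Rightarrow> 'a. c 0 = P \<and>
      (\<forall>t\<ge>0. c t \<in> U \<and> (c has_vector_derivative \<xi> (c t)) (at t within {0..})) \<and>
      (c \<longlongrightarrow> 0) at_top}"

text \<open>The projection \<open>p\<close> need not be spectral: \<open>K f\<close> is normalized by \<open>p (K f 0) = 0\<close>, which makes \<open>p\<close> of the initial value the parameter of the stable manifold.\<close>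

locale stable_splitting =
  fixes L :: "'a::euclidean_space \<Rightarrow> 'a" and p :: "'a \<Rightarrow> 'p::euclidean_space"
    and K :: "(real \<Rightarrow>\<^sub>C 'a) \<Rightarrow> real \<Rightarrow>\<^sub>C 'a" and E :: "'p \<Rightarrow> real \<Rightarrow>\<^sub>C 'a"
  assumes L: "bounded_linear L" and p: "bounded_linear p" "\<And>P. norm (p P) \<le> norm P"
    and K: "bounded_linear K" and E: "bounded_linear E"
    and K_deriv: "\<And>f t. t \<ge> 0 \<Longrightarrow> (apply_bcontfun (K f) has_vector_derivative L (K f t) + f t) (at t within {0..})"
    and K_proj: "\<And>f. p (K f 0) = 0"
    and K_lim: "\<And>f. (apply_bcontfun f \<longlongrightarrow> 0) at_top \<Longrightarrow> (apply_bcontfun (K f) \<longlongrightarrow> 0) at_top"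
    and K_neg: "\<And>f t. t < 0 \<Longrightarrow> apply_bcontfun (K f) t = K f 0"
    and E_deriv: "\<And>x t. t \<ge> 0 \<Longrightarrow> (apply_bcontfun (E x) has_vector_derivative L (E x t)) (at t within {0..})"
    and E_proj: "\<And>x. p (E x 0) = x"
    and E_lim: "\<And>x. (apply_bcontfun (E x) \<longlongrightarrow> 0) at_top"
    and E_neg: "\<And>x t. t < 0 \<Longrightarrow> apply_bcontfun (E x) t = E x 0"
    and linear_unique: "\<And>u t B. (\<And>t. t \<ge> 0 \<Longrightarrow> (u has_vector_derivative L (u t)) (at t within {0..})) \<Longrightarrow>
      (\<And>t. t \<ge> 0 \<Longrightarrow> norm (u t) \<le> B) \<Longrightarrow> p (u 0) = 0 \<Longrightarrow> t \<ge> 0 \<Longrightarrow> u t = 0"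

locale stable_vector_field = stable_splitting L p K E
  for L :: "'a::euclidean_space \<Rightarrow> 'a" and p :: "'a \<Rightarrow> 'p::euclidean_space" and K E +
  fixes \<xi> :: "'a \<Rightarrow> 'a" and \<xi>' :: "'a \<Rightarrow> 'a \<Rightarrow> 'a"
  assumes \<xi>': "\<And>P. (\<xi> has_derivative \<xi>' P) (at P)" and \<xi>'_cont: "\<And>v. continuous_on UNIV (\<lambda>P. \<xi>' P v)"
    and \<xi>_0: "\<xi> 0 = 0" and \<xi>'_0: "\<And>v. \<xi>' 0 v = L v"
begin

definition F where "F P = \<xi> P - L P"
definition F' where "F' P v = \<xi>' P v - L v"

lemma F': "(F has_derivative F' P) (at P)"
  unfolding F_def [abs_def] F'_def
  by (intro has_derivative_diff \<xi>' bounded_linear_imp_has_derivative L)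

lemma F'_cont: "continuous_on UNIV (\<lambda>P. F' P v)"
  unfolding F'_def by (intro continuous_intros \<xi>'_cont)

lemma F_cont: "continuous_on UNIV F"
  using F' by (auto intro!: continuous_at_imp_continuous_on dest: has_derivative_continuous)

lemma F_0: "F 0 = 0" using \<xi>_0 L by (simp add: F_def linear_simps)

text \<open>\<open>F'\<close> vanishes at 0, but continuity is available only for each fixed
  direction; finitely many columns suffice to bound the operator.\<close>

lemma F'_small:
  assumes "\<eta> > 0"
  obtains \<delta> where "\<delta> > 0" "\<And>P h. norm P \<le> \<delta> \<Longrightarrow> norm (F' P h) \<le> \<eta> * norm h"
proof -
  define e where "e = \<eta> / DIM('a)"
  have e: "e > 0" using assms by (simp add: e_def)
  have "\<exists>d>0. \<forall>P. norm P < d \<longrightarrow> norm (F' P j) < e" for j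
  proof -
    have "continuous (at 0) (\<lambda>P. F' P j)" using F'_cont by (simp add: continuous_on_eq_continuous_at)
    moreover have "F' 0 j = 0" by (simp add: F'_def \<xi>'_0)
    ultimately show ?thesis using e unfolding continuous_at_eps_delta by force
  qed
  then obtain d where d: "\<And>j. d j > 0" "\<And>P j. norm P < d j \<Longrightarrow> norm (F' P j) < e" by metis
  \<comment> \<open>Halving turns the closed condition \<open>norm P \<le> \<delta>\<close> into the
    strict one needed for every \<open>d j\<close>.\<close>
  define \<delta> where "\<delta> = Min (insert 1 (d ` Basis)) / 2"
  have m: "Min (insert 1 (d ` Basis)) > 0" using d(1) by (auto simp del: Min_insert)
  show thesis
  proof (rule that)
    show "\<delta> > 0" using m by (simp add: \<delta>_def)
    fix P h :: 'a assume P: "norm P \<le> \<delta>"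
    have "norm (F' P h) \<le> (\<Sum>j\<in>Basis. norm (F' P j)) * norm h"
      by (rule norm_linear_le_Basis[OF has_derivative_bounded_linear[OF F']])
    also have "\<dots> \<le> (\<Sum>j\<in>(Basis::'a set). e) * norm h"
    proof (intro mult_right_mono sum_mono)
      fix j :: 'a assume "j \<in> Basis"
      then have "Min (insert 1 (d ` Basis)) \<le> d j" by (intro Min_le) auto
      then have "norm P < d j" using P m unfolding \<delta>_def by linarith
      then show "norm (F' P j) \<le> e" using d(2)[of P j] by simp
    qed simp
    also have "\<dots> = \<eta> * norm h" by (simp add: e_def)
    finally show "norm (F' P h) \<le> \<eta> * norm h" .
  qed
qed

text \<open>The Lyapunov--Perron operator: \<open>T x u\<close> is the bounded solution of
  \<open>v' = L v + F u\<close> on the half line whose initial value projects to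
  \<open>x\<close>.\<close>

definition T where "T x u = E x + K (nem F u)"

lemma T_deriv:
  assumes "t \<ge> 0"
  shows "(apply_bcontfun (T x u) has_vector_derivative L (T x u t) + F (u t)) (at t within {0..})"
  using has_vector_derivative_add[OF E_deriv[OF assms, of x] K_deriv[OF assms, of "nem F u"]] L
  by (simp add: T_def apply_nem[OF F_cont] linear_simps plus_bcontfun.rep_eq[abs_def] add.assoc)

lemma T_proj: "p (T x u 0) = x"
  using p(1) by (simp add: T_def linear_simps E_proj K_proj)

lemma T_lim:
  assumes "(apply_bcontfun u \<longlongrightarrow> 0) at_top"
  shows "(apply_bcontfun (T x u) \<longlongrightarrow> 0) at_top"
proof -
  have "isCont F 0" using F_cont by (simp add: continuous_on_eq_continuous_at)
  then have "((\<lambda>t. F (u t)) \<longlongrightarrow> F 0) at_top" by (rule isCont_tendsto_compose[OF _ assms])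
  moreover have "apply_bcontfun (nem F u) = (\<lambda>t. F (u t))"
    by (rule ext) (rule apply_nem[OF F_cont])
  ultimately have "(apply_bcontfun (nem F u) \<longlongrightarrow> 0) at_top"
    by (simp add: F_0)
  from tendsto_add[OF E_lim K_lim[OF this], of x] show ?thesis
    by (simp add: T_def plus_bcontfun.rep_eq[abs_def])
qed

text \<open>The difference \<open>u - T x u\<close> is bounded, solves the homogeneous linear
  equation and has initial projection 0, so it vanishes on the half line. The convention of
  constancy for \<open>t < 0\<close> extends this to equality of the encoded curves.\<close>

lemma solution_imp_fixpoint:
  assumes "\<And>t. t \<ge> 0 \<Longrightarrow> (apply_bcontfun u has_vector_derivative \<xi> (u t)) (at t within {0..})"
    and "\<And>t. t < 0 \<Longrightarrow> apply_bcontfun u t = u 0" "p (u 0) = x"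
  shows "u = T x u"
proof (rule bcontfun_eqI)
  fix t
  have pos: "(u - T x u) t = 0" if "t \<ge> 0" for t
  proof (rule linear_unique[OF _ norm_bounded _ that])
    fix t :: real assume t: "t \<ge> 0"
    from has_vector_derivative_diff[OF assms(1)[OF t] T_deriv[OF t, of x u]]
    show "(apply_bcontfun (u - T x u) has_vector_derivative L ((u - T x u) t)) (at t within {0..})"
      using L by (simp add: F_def linear_simps minus_bcontfun.rep_eq[abs_def] algebra_simps)
  next
    show "p ((u - T x u) 0) = 0"
      using p(1) T_proj[of x u] assms(3) by (simp add: linear_simps)
  qed
  show "u t = T x u t"
  proof (cases "t \<ge> 0")
    case True
    then show ?thesis using pos[of t] by simp
  next
    case False
    then have "T x u t = T x u 0" by (simp add: T_def K_neg E_neg)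
    then show ?thesis using False pos[of 0] assms(2)[of t] by simp
  qed
qed

theorem local_stable_manifold:
  obtains r \<gamma> \<gamma>' where "r > 0"
    and "\<And>x t. x \<in> ball 0 r \<Longrightarrow> t \<ge> 0 \<Longrightarrow> (apply_bcontfun (\<gamma> x) has_vector_derivative \<xi> (\<gamma> x t)) (at t within {0..})"
    and "\<And>x. x \<in> ball 0 r \<Longrightarrow> (apply_bcontfun (\<gamma> x) \<longlongrightarrow> 0) at_top"
    and "\<And>x. x \<in> ball 0 r \<Longrightarrow> p (\<gamma> x 0) = x"
    and "\<And>x. x \<in> ball 0 r \<Longrightarrow> (\<gamma> has_derivative \<gamma>' x) (at x)"
    and "\<And>x h t. x \<in> ball 0 r \<Longrightarrow> t \<ge> 0 \<Longrightarrow>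
       (apply_bcontfun (\<gamma>' x h) has_vector_derivative \<xi>' (\<gamma> x t) (\<gamma>' x h t)) (at t within {0..})"
    and "\<And>x h. x \<in> ball 0 r \<Longrightarrow> (apply_bcontfun (\<gamma>' x h) \<longlongrightarrow> 0) at_top"
    and "\<And>m. (\<And>v. Cr m UNIV (\<lambda>P. \<xi>' P v)) \<Longrightarrow> Cr (Suc m) (ball 0 r) \<gamma>"
    and "\<exists>U \<Omega>. open U \<and> 0 \<in> U \<and> open \<Omega> \<and> 0 \<in> \<Omega> \<and> \<Omega> \<subseteq> ball 0 r \<and>
        stable_set \<xi> U = (\<lambda>x. \<gamma> x 0) ` \<Omega> \<inter> U"
proof -
  obtain k where k: "k > 0" "\<And>u. norm (K u) \<le> norm u * k"
    using bounded_linear.pos_bounded[OF K] by blast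
  obtain e where e: "e > 0" "\<And>u. norm (E u) \<le> norm u * e"
    using bounded_linear.pos_bounded[OF E] by blast
  \<comment> \<open>With Lipschitz constant \<open>\<eta>\<close> for \<open>F\<close>, the map
    \<open>u \<mapsto> K (nem F u)\<close> contracts by \<open>\<eta> * k = 1/2\<close>.\<close>
  define \<eta> where "\<eta> = 1 / (2 * k)"
  have \<eta>: "\<eta> > 0" "\<eta> * k = 1/2" using k(1) by (auto simp: \<eta>_def)
  obtain \<delta> where \<delta>: "\<delta> > 0" "\<And>P h. norm P \<le> \<delta> \<Longrightarrow> norm (F' P h) \<le> \<eta> * norm h"
    using F'_small[OF \<eta>(1)] by blast
  have F_lip: "norm (F P - F Q) \<le> \<eta> * norm (P - Q)" if "P \<in> cball 0 \<delta>" "Q \<in> cball 0 \<delta>" for P Q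
  proof (rule differentiable_bound[OF convex_cball has_derivative_at_withinI[OF F'] _ that])
    show "onorm (F' P) \<le> \<eta>" if "P \<in> cball 0 \<delta>" for P
      using that \<delta>(2) by (intro onorm_le) auto
  qed
  have N_lip: "norm (nem F u - nem F v) \<le> \<eta> * norm (u - v)" if "norm u \<le> \<delta>" "norm v \<le> \<delta>" for u v
  proof (rule norm_bound)
    fix t
    have "norm (F (u t) - F (v t)) \<le> \<eta> * norm (u t - v t)"
      using that norm_bounded[of u t] norm_bounded[of v t] by (intro F_lip) auto
    also have "\<dots> \<le> \<eta> * norm (u - v)" using \<eta>(1) norm_bounded[of "u - v" t] by simp
    finally show "norm ((nem F u - nem F v) t) \<le> \<eta> * norm (u - v)" by (simp add: apply_nem[OF F_cont])
  qed
  have KN_lip: "norm (K (nem F u) - K (nem F v)) \<le> 1/2 * norm (u - v)" if "norm u \<le> \<delta>" "norm v \<le> \<delta>" for u v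
  proof -
    have "norm (K (nem F u) - K (nem F v)) \<le> norm (nem F u - nem F v) * k"
      using k(2)[of "nem F u - nem F v"] K by (simp add: linear_simps)
    also have "\<dots> \<le> (\<eta> * norm (u - v)) * k" using N_lip[OF that] k(1) by (intro mult_right_mono) auto
    also have "\<dots> = 1/2 * norm (u - v)" using \<eta>(2) by (metis mult.commute mult.left_commute)
    finally show ?thesis .
  qed
  have "nem F 0 = 0" by (rule bcontfun_eqI) (simp add: apply_nem[OF F_cont] F_0)
  then have KN0: "K (nem F 0) = 0" using K by (simp add: linear_simps)
  \<comment> \<open>The ball of radius \<open>\<delta>\<close> is shared:
    \<open>norm (E x) \<le> \<delta>/2\<close> because \<open>r * e \<le> \<delta>/2\<close>, and
    the nonlinear term takes the other half. Moreover \<open>r \<le> \<delta>\<close>, so curves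
    confined to the ball of radius \<open>r\<close> fall under the uniqueness statement.\<close>
  define r where "r = min \<delta> (\<delta> / (2 * e))"
  have r: "r > 0" "r \<le> \<delta>" "r * e \<le> \<delta> / 2"
    using \<delta>(1) e(1) by (auto simp: r_def min_def field_simps)
  \<comment> \<open>Decay is built into the complete set, so that the fixed point inherits
    it.\<close>
  define Z where "Z = cball (0 :: real \<Rightarrow>\<^sub>C 'a) \<delta> \<inter> {u. (apply_bcontfun u \<longlongrightarrow> 0) at_top}"
  have "complete Z" unfolding Z_def
    by (simp add: complete_eq_closed closed_Int closed_tendsto_0)
  have "0 \<in> Z" using \<delta>(1) by (simp add: Z_def zero_bcontfun.rep_eq[abs_def])
  have T_lip: "dist (T x u) (T x v) \<le> 1/2 * dist u v" if "norm u \<le> \<delta>" "norm v \<le> \<delta>" for x u v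
    using KN_lip[OF that] by (simp add: T_def dist_norm)
  have ex: "\<exists>!u. u \<in> Z \<and> T x u = u" if x: "x \<in> ball 0 r" for x
  proof (rule Banach_fix[OF \<open>complete Z\<close>, where c = "1/2"])
    show "T x ` Z \<subseteq> Z"
    proof safe
      fix u assume "u \<in> Z"
      then have u: "norm u \<le> \<delta>" "(apply_bcontfun u \<longlongrightarrow> 0) at_top" by (auto simp: Z_def)
      have "norm (E x) \<le> \<delta> / 2"
      proof -
        have "norm x * e \<le> r * e" using x e(1) by (intro mult_right_mono) auto
        then show ?thesis using e(2)[of x] r(3) by linarith
      qed
      moreover have "norm (K (nem F u)) \<le> \<delta> / 2"
        using KN_lip[OF u(1), of 0] \<delta>(1) u(1) KN0 by simp
      ultimately have "norm (T x u) \<le> \<delta>"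
        using norm_triangle_ineq[of "E x" "K (nem F u)"] by (simp add: T_def)
      then show "T x u \<in> Z" using T_lim[OF u(2)] by (simp add: Z_def)
    qed
    show "Z \<noteq> {}" using \<open>0 \<in> Z\<close> by blast
  qed (use T_lip in \<open>auto simp: Z_def\<close>)
  define \<gamma> where "\<gamma> x = (THE u. u \<in> Z \<and> T x u = u)" for x
  have \<gamma>: "\<gamma> x \<in> Z" "T x (\<gamma> x) = \<gamma> x" if "x \<in> ball 0 r" for x
    using theI'[OF ex[OF that]] by (auto simp: \<gamma>_def)
  then have \<gamma>n: "norm (\<gamma> x) \<le> \<delta>" and \<gamma>lim: "(apply_bcontfun (\<gamma> x) \<longlongrightarrow> 0) at_top" if "x \<in> ball 0 r" for x
    using that by (auto simp: Z_def)
  \<comment> \<open>Uniqueness in the whole ball of radius \<open>\<delta>\<close>; it identifies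
    solutions that stay in \<open>U\<close>, as well as time shifts of \<open>\<gamma> x\<close>,
    with members of the family.\<close>
  have uniq: "u = \<gamma> x" if "x \<in> ball 0 r" "norm u \<le> \<delta>" "u = T x u" for x u
  proof -
    have "dist u (\<gamma> x) \<le> 1/2 * dist u (\<gamma> x)"
      using T_lip[OF that(2) \<gamma>n[OF that(1)], of x] \<gamma>(2)[OF that(1)] that(3) by simp
    then have "dist u (\<gamma> x) = 0" using zero_le_dist[of u "\<gamma> x"] by linarith
    then show ?thesis by simp
  qed
  have \<gamma>0: "\<gamma> 0 = 0"
    by (rule uniq[symmetric]) (use r \<delta> KN0 E in \<open>auto simp: T_def linear_simps\<close>)
  have lip: "dist (\<gamma> x) (\<gamma> y) \<le> 2 * e * dist x y" if "x \<in> ball 0 r" "y \<in> ball 0 r" for x y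
  proof -
    have "\<gamma> x - \<gamma> y = E (x - y) + (K (nem F (\<gamma> x)) - K (nem F (\<gamma> y)))"
      using \<gamma>(2)[OF that(1)] \<gamma>(2)[OF that(2)] E unfolding T_def
      by (metis (no_types, lifting) add_diff_add bounded_linear.axioms(1) linear_diff bounded_linear.linear)
    then have "norm (\<gamma> x - \<gamma> y) \<le> norm (E (x - y)) + norm (K (nem F (\<gamma> x)) - K (nem F (\<gamma> y)))"
      by (simp only: norm_triangle_ineq)
    also have "\<dots> \<le> norm (x - y) * e + 1/2 * norm (\<gamma> x - \<gamma> y)"
      by (intro add_mono e KN_lip \<gamma>n that)
    finally show ?thesis by (simp add: dist_norm algebra_simps)
  qed
  have cont: "continuous_on (ball 0 r) \<gamma>"
    by (rule lipschitz_on_continuous_on[OF lipschitz_onI[OF lip]]) (use e(1) in auto)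
  interpret nf: nem_fixpoint "ball 0 r" F F' E K \<gamma> "1/2"
  proof (rule nem_fixpoint.intro)
    show "\<gamma> x = E x + K (nem F (\<gamma> x))" if "x \<in> ball 0 r" for x
      using \<gamma>(2)[OF that] by (simp add: T_def)
    show "norm (K (\<Sum>j\<in>Basis. smulc j h (nem (\<lambda>x. F' x j) (\<gamma> x)))) \<le> 1/2 * norm h" if "x \<in> ball 0 r" for x h
    proof -
      have "norm (\<Sum>j\<in>Basis. smulc j h (nem (\<lambda>x. F' x j) (\<gamma> x))) \<le> \<eta> * norm h"
      proof (rule norm_bound)
        fix t
        have "(\<Sum>j\<in>Basis. smulc j h (nem (\<lambda>x. F' x j) (\<gamma> x))) t = F' (\<gamma> x t) (h t)"
          by (simp add: apply_bcontfun_sum apply_smulc apply_nem[OF F'_cont]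
             bounded_linear_Basis[OF has_derivative_bounded_linear[OF F'], of _ "h t"])
        moreover have "norm (F' (\<gamma> x t) (h t)) \<le> \<eta> * norm (h t)"
          using norm_bounded[of "\<gamma> x" t] \<gamma>n[OF that] by (intro \<delta>(2)) simp
        moreover have "\<eta> * norm (h t) \<le> \<eta> * norm h" using norm_bounded[of h t] \<eta>(1) by simp
        ultimately show "norm ((\<Sum>j\<in>Basis. smulc j h (nem (\<lambda>x. F' x j) (\<gamma> x))) t) \<le> \<eta> * norm h" by simp
      qed
      then have "norm (\<Sum>j\<in>Basis. smulc j h (nem (\<lambda>x. F' x j) (\<gamma> x))) * k \<le> (\<eta> * norm h) * k"
        using k(1) by (intro mult_right_mono) auto
      also have "\<dots> = 1/2 * norm h" using \<eta>(2) by (metis mult.commute mult.left_commute)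
      finally show ?thesis using k(2) order_trans by blast
    qed
  qed (fact F' F'_cont E K cont | simp)+
  have DN: "nf.DN x h t = F' (\<gamma> x t) (h t)" for x h t
    by (simp add: nf.DN_def apply_bcontfun_sum apply_smulc apply_nem[OF F'_cont]
       bounded_linear_Basis[OF has_derivative_bounded_linear[OF F'], of _ "h t"])
  have sol: "(apply_bcontfun (\<gamma> x) has_vector_derivative \<xi> (\<gamma> x t)) (at t within {0..})"
    if "x \<in> ball 0 r" "t \<ge> 0" for x t
    using T_deriv[OF that(2), of x "\<gamma> x"] \<gamma>(2)[OF that(1)] by (simp add: F_def)
  have proj: "p (\<gamma> x 0) = x" if "x \<in> ball 0 r" for x
    using T_proj[of x "\<gamma> x"] \<gamma>(2)[OF that] by simp
  have neg: "apply_bcontfun (\<gamma> x) t = \<gamma> x 0" if "x \<in> ball 0 r" "t < 0" for x t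
  proof -
    have "T x (\<gamma> x) t = T x (\<gamma> x) 0" using that(2) by (simp add: T_def K_neg E_neg)
    then show ?thesis using \<gamma>(2)[OF that(1)] by simp
  qed
  have derivative_sol: "(apply_bcontfun (nf.\<gamma>' x h) has_vector_derivative \<xi>' (\<gamma> x t) (nf.\<gamma>' x h t)) (at t within {0..})"
    if "x \<in> ball 0 r" "t \<ge> 0" for x h t
  proof -
    have "(apply_bcontfun (E h + K (nf.DN x (nf.\<gamma>' x h))) has_vector_derivative 
         L ((E h + K (nf.DN x (nf.\<gamma>' x h))) t) + F' (\<gamma> x t) (nf.\<gamma>' x h t)) (at t within {0..})"
      using has_vector_derivative_add[OF E_deriv[OF that(2), of h] K_deriv[OF that(2), of "nf.DN x (nf.\<gamma>' x h)"]] L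
      by (simp add: linear_simps plus_bcontfun.rep_eq[abs_def] add.assoc DN)
    then show ?thesis
      unfolding nf.\<gamma>'_eq[OF that(1), of h, symmetric] by (simp add: F'_def)
  qed
  \<comment> \<open>Differentiation in \<open>x\<close> takes place in the sup norm, so
    \<open>nf.\<gamma>' x h\<close> is a uniform limit of difference quotients, each of which
    decays.\<close>
  have derivative_lim: "(apply_bcontfun (nf.\<gamma>' x h) \<longlongrightarrow> 0) at_top" if x: "x \<in> ball 0 r" for x h
  proof -
    have "((\<lambda>s. \<gamma> (x + s *\<^sub>R h)) has_vector_derivative nf.\<gamma>' x h) (at 0)"
    proof -
      have "((\<lambda>s. x + s *\<^sub>R h) has_derivative (\<lambda>s. s *\<^sub>R h)) (at (0::real))"
        by (auto intro!: derivative_eq_intros)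
      from has_derivative_compose[OF this, of \<gamma> "nf.\<gamma>' x"] nf.has_derivative_\<gamma>[OF x]
      have "((\<lambda>s. \<gamma> (x + s *\<^sub>R h)) has_derivative (\<lambda>s. nf.\<gamma>' x (s *\<^sub>R h))) (at 0)" by simp
      then show ?thesis
        using has_derivative_bounded_linear[OF nf.has_derivative_\<gamma>[OF x]]
        by (simp add: has_vector_derivative_def linear_simps)
    qed
    then have lim: "((\<lambda>s. (\<gamma> (x + s *\<^sub>R h) - \<gamma> x) /\<^sub>R s) \<longlongrightarrow> nf.\<gamma>' x h) (at 0)"
      by (rule has_vector_derivative_imp_quotient)
    have "((\<lambda>s. x + s *\<^sub>R h) \<longlongrightarrow> x + 0 *\<^sub>R h) (at (0::real))" by (intro tendsto_intros)
    then have "eventually (\<lambda>s. x + s *\<^sub>R h \<in> ball 0 r) (at (0::real))"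
      by (rule topological_tendstoD) (use x in auto)
    then have "eventually (\<lambda>s. (\<gamma> (x + s *\<^sub>R h) - \<gamma> x) /\<^sub>R s \<in> {u. (apply_bcontfun u \<longlongrightarrow> 0) at_top}) (at (0::real))"
    proof eventually_elim
      case (elim s)
      from tendsto_scaleR[OF tendsto_const tendsto_diff[OF \<gamma>lim[OF elim] \<gamma>lim[OF x]], of "inverse s"]
      show ?case by (simp add: minus_bcontfun.rep_eq[abs_def] scaleR_bcontfun.rep_eq[abs_def])
    qed
    from Lim_in_closed_set[OF closed_tendsto_0 this _ lim] show ?thesis by simp
  qed
  have smooth: "Cr (Suc m) (ball 0 r) \<gamma>" if "\<And>v. Cr m UNIV (\<lambda>P. \<xi>' P v)" for m
    by (rule nf.Cr_\<gamma>[OF _ order_refl]) (unfold F'_def, intro Cr_diff Cr_const that)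
  \<comment> \<open>Bounding the whole curve, and not only its initial point, makes \<open>\<Omega>\<close> invariant under the projected flow.\<close>
  define \<Omega> where "\<Omega> = ball 0 r \<inter> \<gamma> -` ball 0 r"
  define U where "U = ball 0 r \<inter> p -` \<Omega>"
  have "open \<Omega>" unfolding \<Omega>_def by (intro continuous_open_preimage cont) auto
  moreover have "open U"
    unfolding U_def
    by (intro continuous_open_preimage[OF linear_continuous_on[OF p(1)]] \<open>open \<Omega>\<close>) auto
  moreover have "0 \<in> \<Omega>" using r(1) \<gamma>0 by (simp add: \<Omega>_def)
  moreover have "0 \<in> U" using r(1) \<open>0 \<in> \<Omega>\<close> p(1) by (simp add: U_def linear_simps)
  moreover have "stable_set \<xi> U = (\<lambda>x. \<gamma> x 0) ` \<Omega> \<inter> U"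
  proof (intro equalityI subsetI)
    fix P assume "P \<in> stable_set \<xi> U"
    then obtain c where c: "P \<in> U" "c 0 = P" "\<And>t. t \<ge> 0 \<Longrightarrow> c t \<in> U"
      "\<And>t. t \<ge> 0 \<Longrightarrow> (c has_vector_derivative \<xi> (c t)) (at t within {0..})"
      by (auto simp: stable_set_def)
    have cc: "continuous_on {0..} c"
      by (rule has_vector_derivative_imp_continuous_on[OF c(4)]) auto
    have cb: "norm (c t) \<le> r" if "t \<ge> 0" for t using c(3)[OF that] by (simp add: U_def)
    note ac = apply_halfline[OF cc cb]
    have x: "p P \<in> \<Omega>" using c(1) by (simp add: U_def)
    then have xr: "p P \<in> ball 0 r" by (simp add: \<Omega>_def)
    \<comment> \<open>A solution staying in \<open>U\<close> has norm at most \<open>r\<close>,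
      hence is a fixed point inside the ball of uniqueness.\<close>
    have "halfline c = \<gamma> (p P)"
    proof (rule uniq[OF xr])
      have "norm (halfline c) \<le> r" by (rule norm_bound) (simp add: ac cb)
      then show "norm (halfline c) \<le> \<delta>" using r(2) by simp
      show "halfline c = T (p P) (halfline c)"
        by (rule solution_imp_fixpoint)
           (use has_vector_derivative_halfline[OF cc cb c(4)] c(2) in \<open>auto simp: ac\<close>)
    qed
    from this[symmetric] have "\<gamma> (p P) 0 = P" using c(2) by (simp add: ac)
    then show "P \<in> (\<lambda>x. \<gamma> x 0) ` \<Omega> \<inter> U" using x c(1) by force
  next
    fix P assume "P \<in> (\<lambda>x. \<gamma> x 0) ` \<Omega> \<inter> U"
    then obtain x where x: "x \<in> \<Omega>" "P = \<gamma> x 0" "P \<in> U" by auto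
    then have xr: "x \<in> ball 0 r" and nx: "norm (\<gamma> x) < r" by (auto simp: \<Omega>_def)
    \<comment> \<open>The shift of \<open>\<gamma> x\<close> by \<open>t\<close> is a solution of no
      larger norm, so it is \<open>\<gamma> y\<close> for the projection \<open>y\<close> of its
      starting point; the norm bound then puts \<open>y\<close> into
      \<open>\<Omega>\<close>.\<close>
    have "\<gamma> x t \<in> U" if t: "t \<ge> 0" for t
    proof -
      define y where "y = p (\<gamma> x t)"
      have nt: "norm (\<gamma> x t) < r" using norm_bounded[of "\<gamma> x" t] nx by simp
      then have yr: "y \<in> ball 0 r" using p(2)[of "\<gamma> x t"] by (simp add: y_def)
      define c where "c s = \<gamma> x (s + t)" for s
      have c: "(c has_vector_derivative \<xi> (c s)) (at s within {0..})" if "s \<ge> 0" for s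
        unfolding c_def using that t by (intro has_vector_derivative_shift_halfline sol xr) auto
      have cc: "continuous_on {0..} c"
        by (rule has_vector_derivative_imp_continuous_on[OF c]) auto
      have cb: "norm (c s) \<le> norm (\<gamma> x)" if "s \<ge> 0" for s by (simp add: c_def norm_bounded)
      note ac = apply_halfline[OF cc cb]
      have nc: "norm (halfline c) \<le> norm (\<gamma> x)" by (rule norm_bound) (simp add: ac cb)
      have "halfline c = \<gamma> y"
      proof (rule uniq[OF yr])
        show "norm (halfline c) \<le> \<delta>" using nc nx r(2) by simp
        show "halfline c = T y (halfline c)"
        by (rule solution_imp_fixpoint)
           (use has_vector_derivative_halfline[OF cc cb c] in \<open>auto simp: ac c_def y_def\<close>)
      qed
      then have "norm (\<gamma> y) < r" using nc nx by simp
      then have "y \<in> \<Omega>" using yr by (simp add: \<Omega>_def)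
      then show ?thesis using nt by (simp add: U_def y_def)
    qed
    then show "P \<in> stable_set \<xi> U"
      using x sol[OF xr] \<gamma>lim[OF xr] unfolding stable_set_def by blast
  qed
  ultimately have "\<exists>U \<Omega>. open U \<and> 0 \<in> U \<and> open \<Omega> \<and> 0 \<in> \<Omega> \<and> \<Omega> \<subseteq> ball 0 r \<and>
        stable_set \<xi> U = (\<lambda>x. \<gamma> x 0) ` \<Omega> \<inter> U"
    by (intro exI[of _ U] exI[of _ \<Omega>]) (auto simp: \<Omega>_def)
  from that[OF r(1) sol \<gamma>lim proj nf.has_derivative_\<gamma> derivative_sol derivative_lim smooth this]
  show thesis .
qed

end

section \<open>Hamiltonian vector fields\<close>

lemma second_difference_mean:
  fixes f :: "'a::real_normed_vector \<Rightarrow> real"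
  assumes f': "\<And>x. (f has_derivative f' x) (at x)"
    and f'': "\<And>x. ((\<lambda>x. f' x a) has_derivative f'' x) (at x)"
    and "s > 0"
  obtains \<xi> \<eta> where "0 < \<xi>" "\<xi> < s" "0 < \<eta>" "\<eta> < s"
    "f (x + s *\<^sub>R a + s *\<^sub>R b) - f (x + s *\<^sub>R a) - f (x + s *\<^sub>R b) + f x = s * (s * f'' (x + \<xi> *\<^sub>R a + \<eta> *\<^sub>R b) b)"
proof -
  have line: "((\<lambda>u. g (y + u *\<^sub>R v)) has_real_derivative g' (y + u *\<^sub>R v) v) (at u)"
    if "\<And>x. (g has_derivative g' x) (at x)" for g :: "'a \<Rightarrow> real" and g' y u v
  proof -
    have "((\<lambda>u. y + u *\<^sub>R v) has_derivative (\<lambda>u. u *\<^sub>R v)) (at u)"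
      by (auto intro!: derivative_eq_intros)
    from has_derivative_compose[OF this that]
    have "((\<lambda>u. g (y + u *\<^sub>R v)) has_derivative (\<lambda>w. w * g' (y + u *\<^sub>R v) v)) (at u)"
      using has_derivative_bounded_linear[OF that] by (simp add: linear_simps)
    then show ?thesis by (simp add: has_field_derivative_def mult_commute_abs)
  qed
  \<comment> \<open>The second difference is the increment of \<open>\<phi>\<close>. One mean value
    theorem along \<open>a\<close> produces a difference of \<open>f' _ a\<close>, a second along
    \<open>b\<close> produces \<open>f''\<close>.\<close>
  define \<phi> where "\<phi> u = f (x + s *\<^sub>R b + u *\<^sub>R a) - f (x + u *\<^sub>R a)" for u
  have "\<exists>\<xi>>0. \<xi> < s \<and> \<phi> s - \<phi> 0 = (s - 0) * (f' (x + s *\<^sub>R b + \<xi> *\<^sub>R a) a - f' (x + \<xi> *\<^sub>R a) a)"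
    unfolding \<phi>_def by (rule MVT2[OF \<open>s > 0\<close>]) (intro DERIV_diff line f')
  then obtain \<xi> where \<xi>: "0 < \<xi>" "\<xi> < s" "\<phi> s - \<phi> 0 = s * (f' (x + s *\<^sub>R b + \<xi> *\<^sub>R a) a - f' (x + \<xi> *\<^sub>R a) a)"
    by auto
  have "\<exists>\<eta>>0. \<eta> < s \<and> f' (x + \<xi> *\<^sub>R a + s *\<^sub>R b) a - f' (x + \<xi> *\<^sub>R a + 0 *\<^sub>R b) a = (s - 0) * f'' (x + \<xi> *\<^sub>R a + \<eta> *\<^sub>R b) b"
    by (rule MVT2[OF \<open>s > 0\<close>, where f = "\<lambda>u. f' (x + \<xi> *\<^sub>R a + u *\<^sub>R b) a"]) (rule line[OF f''])
  then obtain \<eta> where \<eta>: "0 < \<eta>" "\<eta> < s" "f' (x + \<xi> *\<^sub>R a + s *\<^sub>R b) a - f' (x + \<xi> *\<^sub>R a) a = s * f'' (x + \<xi> *\<^sub>R a + \<eta> *\<^sub>R b) b"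
    by auto
  show thesis
    using \<xi>(3) \<eta>(3) by (intro that[OF \<xi>(1,2) \<eta>(1,2)]) (simp add: \<phi>_def add_ac)
qed

text \<open>The second difference is symmetric in \<open>a\<close> and \<open>b\<close>, so the mean
  values of the two mixed derivatives coincide at points arbitrarily close to \<open>x\<close>;
  continuity at \<open>x\<close> concludes.\<close>

lemma second_derivative_symmetric:
  fixes f :: "'a::real_normed_vector \<Rightarrow> real"
  assumes f': "\<And>x. (f has_derivative f' x) (at x)"
    and f'': "\<And>a x. ((\<lambda>x. f' x a) has_derivative f'' x a) (at x)"
    and cont: "\<And>a b. isCont (\<lambda>x. f'' x a b) x"
  shows "f'' x a b = f'' x b a"
proof (rule ccontr)
  assume "f'' x a b \<noteq> f'' x b a"
  then have e: "\<bar>f'' x a b - f'' x b a\<bar> / 2 > 0" (is "?e > 0") by simp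
  obtain d1 where d1: "d1 > 0" "\<And>y. norm (y - x) < d1 \<Longrightarrow> norm (f'' y a b - f'' x a b) < ?e"
    using cont[of a b] e unfolding continuous_at_eps_delta dist_norm by blast
  obtain d2 where d2: "d2 > 0" "\<And>y. norm (y - x) < d2 \<Longrightarrow> norm (f'' y b a - f'' x b a) < ?e"
    using cont[of b a] e unfolding continuous_at_eps_delta dist_norm by blast
  \<comment> \<open>Small enough that both intermediate points lie within \<open>d1\<close> and
    \<open>d2\<close> of \<open>x\<close>; the summand 1 covers vanishing directions.\<close>
  define s where "s = min d1 d2 / (1 + norm a + norm b)"
  have pos: "1 + norm a + norm b > 0" by (simp add: add_pos_nonneg)
  have s: "s > 0" using d1 d2 pos by (simp add: s_def)
  have near: "norm (x + u *\<^sub>R v + w *\<^sub>R v' - x) < min d1 d2" if "0 < u" "u < s" "0 < w" "w < s" "{v, v'} = {a, b}" for u v w v'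
  proof -
    have "norm v + norm v' \<le> norm a + norm b" using that(5) by (auto simp: doubleton_eq_iff)
    have "norm (x + u *\<^sub>R v + w *\<^sub>R v' - x) \<le> u * norm v + w * norm v'"
      using norm_triangle_ineq[of "u *\<^sub>R v" "w *\<^sub>R v'"] that by simp
    also have "\<dots> \<le> s * norm v + s * norm v'" using that by (intro add_mono mult_right_mono) auto
    also have "\<dots> = s * (norm v + norm v')" by (simp add: distrib_left)
    also have "\<dots> \<le> s * (norm a + norm b)" using \<open>norm v + norm v' \<le> norm a + norm b\<close> s by simp
    also have "\<dots> < s * (1 + norm a + norm b)" using s by simp
    also have "\<dots> = min d1 d2" using pos by (simp add: s_def)
    finally show ?thesis .
  qed
  obtain \<xi> \<eta> where 1: "0 < \<xi>" "\<xi> < s" "0 < \<eta>" "\<eta> < s"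
    "f (x + s *\<^sub>R a + s *\<^sub>R b) - f (x + s *\<^sub>R a) - f (x + s *\<^sub>R b) + f x = s * (s * f'' (x + \<xi> *\<^sub>R a + \<eta> *\<^sub>R b) a b)"
    using second_difference_mean[where f = f and f'' = "\<lambda>x. f'' x a" and x = x and b = b, OF f' f'' s] by metis
  obtain \<xi>' \<eta>' where 2: "0 < \<xi>'" "\<xi>' < s" "0 < \<eta>'" "\<eta>' < s"
    "f (x + s *\<^sub>R b + s *\<^sub>R a) - f (x + s *\<^sub>R b) - f (x + s *\<^sub>R a) + f x = s * (s * f'' (x + \<xi>' *\<^sub>R b + \<eta>' *\<^sub>R a) b a)"
    using second_difference_mean[where f = f and f'' = "\<lambda>x. f'' x b" and x = x and b = a, OF f' f'' s] by metis
  have "s * (s * f'' (x + \<xi> *\<^sub>R a + \<eta> *\<^sub>R b) a b) = s * (s * f'' (x + \<xi>' *\<^sub>R b + \<eta>' *\<^sub>R a) b a)"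
    unfolding 1(5)[symmetric] 2(5)[symmetric] by (simp add: add_ac)
  then have eq: "f'' (x + \<xi> *\<^sub>R a + \<eta> *\<^sub>R b) a b = f'' (x + \<xi>' *\<^sub>R b + \<eta>' *\<^sub>R a) b a" using s by simp
  have "norm (f'' (x + \<xi> *\<^sub>R a + \<eta> *\<^sub>R b) a b - f'' x a b) < ?e"
    by (rule d1(2)) (use near[OF 1(1-4)] in auto)
  moreover have "norm (f'' (x + \<xi>' *\<^sub>R b + \<eta>' *\<^sub>R a) b a - f'' x b a) < ?e"
    by (rule d2(2)) (use near[OF 2(1-4), of b a] in auto)
  moreover have "\<bar>A - B\<bar> \<le> \<bar>X - A\<bar> + \<bar>X - B\<bar>" for X A B :: real by linarith
  ultimately show False unfolding eq real_norm_def by (smt (verit) field_sum_of_halves)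
qed

section \<open>The symplectic form and the Hamiltonian vector field\<close>

lemma R4_expand: "(x, y, p, q) = x *\<^sub>R ex + y *\<^sub>R ey + p *\<^sub>R ep + q *\<^sub>R Defs.eq"
  by (simp add: ex_def ey_def ep_def eq_def)

lemma linear_R4:
  assumes "bounded_linear (f :: R4 \<Rightarrow> real)"
  shows "f (x, y, p, q) = x * f ex + y * f ey + p * f ep + q * f Defs.eq"
  unfolding R4_expand[of x y p q] using assms by (simp add: linear_simps)

definition symp :: "R4 \<Rightarrow> R4 \<Rightarrow> real" where
  "symp u v = (case u of (x, y, p, q) \<Rightarrow> case v of (x', y', p', q') \<Rightarrow> x * p' + y * q' - p * x' - q * y')"

lemma bounded_bilinear_symp: "bounded_bilinear symp"
proof -
  have "bounded_bilinear (\<lambda>u v :: R4. fst u * fst (snd (snd v)) + fst (snd u) * snd (snd (snd v))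
      - fst (snd (snd u)) * fst v - snd (snd (snd u)) * fst (snd v))"
  proof (rule bounded_bilinear.intro)
    show "\<exists>K. \<forall>u v :: R4. norm (fst u * fst (snd (snd v)) + fst (snd u) * snd (snd (snd v))
      - fst (snd (snd u)) * fst v - snd (snd (snd u)) * fst (snd v)) \<le> norm u * norm v * K"
    proof (intro exI allI)
      fix u v :: R4
      have n: "norm (fst u) \<le> norm u \<and> norm (fst (snd u)) \<le> norm u \<and> norm (fst (snd (snd u))) \<le> norm u \<and> norm (snd (snd (snd u))) \<le> norm u" for u :: R4
      proof -
        obtain x y p q where u: "u = (x, y, p, q)" by (metis surj_pair)
        have "norm (y, p, q) \<le> norm u" "norm (p, q) \<le> norm (y, p, q)"
          by (simp_all only: u norm_snd_le)
        then show ?thesis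
          using norm_fst_le[of x "(y, p, q)"] norm_fst_le[of y "(p, q)"] norm_fst_le[of p q] norm_snd_le[of q p]
          unfolding u fst_conv snd_conv by linarith
      qed
      have m: "\<bar>a * b\<bar> \<le> norm u * norm v" if "\<bar>a\<bar> \<le> norm u" "\<bar>b\<bar> \<le> norm v" for a b
        using that by (simp add: abs_mult mult_mono)
      have "\<bar>fst u * fst (snd (snd v))\<bar> \<le> norm u * norm v" "\<bar>fst (snd u) * snd (snd (snd v))\<bar> \<le> norm u * norm v"
         "\<bar>fst (snd (snd u)) * fst v\<bar> \<le> norm u * norm v" "\<bar>snd (snd (snd u)) * fst (snd v)\<bar> \<le> norm u * norm v"
        using n[of u] n[of v] by (auto intro!: m)
      then show "norm (fst u * fst (snd (snd v)) + fst (snd u) * snd (snd (snd v))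
        - fst (snd (snd u)) * fst v - snd (snd (snd u)) * fst (snd v)) \<le> norm u * norm v * 4"
        unfolding real_norm_def by linarith
    qed
  qed (auto simp: algebra_simps)
  moreover have "symp = (\<lambda>u v. fst u * fst (snd (snd v)) + fst (snd u) * snd (snd (snd v))
      - fst (snd (snd u)) * fst v - snd (snd (snd u)) * fst (snd v))"
    by (auto simp: fun_eq_iff symp_def split: prod.splits)
  ultimately show ?thesis by simp
qed

text \<open>Here \<open>n\<close> counts the derivatives beyond the second: for \<open>H\<close> of
  class \<open>k = n + 2\<close> the second derivative has class \<open>n\<close> and
  \<open>xiH H\<close> has class \<open>n + 1\<close>.\<close>

locale hamiltonian =
  fixes H :: "R4 \<Rightarrow> real" and n :: nat
    and H' :: "R4 \<Rightarrow> R4 \<Rightarrow> real" and H'' :: "R4 \<Rightarrow> R4 \<Rightarrow> R4 \<Rightarrow> real"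
  assumes H': "\<And>P. (H has_derivative H' P) (at P)"
    and H'': "\<And>v P. ((\<lambda>P. H' P v) has_derivative H'' P v) (at P)"
    and H''_Cr: "\<And>v w. Cr n UNIV (\<lambda>P. H'' P v w)"
begin

lemma H''_sym: "H'' P u v = H'' P v u"
proof (rule second_derivative_symmetric[OF H' H''])
  show "isCont (\<lambda>P. H'' P v w) P" for v w
    using Cr_imp_continuous_on[OF H''_Cr[of v w]] continuous_on_eq_continuous_at[OF open_UNIV] by blast
qed

lemma partial_H: "partial v H = (\<lambda>P. H' P v)"
  by (rule ext) (rule partial_eq(2)[OF H'])

lemma pd2_H: "pd2 H u v = H'' 0 v u"
  unfolding pd2_def partial_H by (rule partial_eq(2)[OF H''])

lemma xiH_eq: "xiH H P = (H' P ep, H' P Defs.eq, - H' P ex, - H' P ey)"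
  by (simp add: xiH_def partial_H)

definition xi' where "xi' P h = (H'' P ep h, H'' P Defs.eq h, - H'' P ex h, - H'' P ey h)"

lemma xiH_has_derivative: "(xiH H has_derivative xi' P) (at P)"
  unfolding xiH_eq[abs_def] xi'_def [abs_def] by (intro has_derivative_Pair has_derivative_minus H'')

lemma xi'_Cr: "Cr n UNIV (\<lambda>P. xi' P h)"
proof -
  have "xi' P h = H'' P ep h *\<^sub>R ex + H'' P Defs.eq h *\<^sub>R ey + (H'' P ex h *\<^sub>R (- ep) + H'' P ey h *\<^sub>R (- Defs.eq))" for P
    by (simp add: xi'_def ex_def ey_def ep_def eq_def)
  then show ?thesis
    by (simp only:) (intro Cr_add Cr_bounded_linear[OF bounded_linear_scaleR_left] H''_Cr)
qed

text \<open>\<open>xi' P\<close> is the symplectic matrix times the Hessian, and symmetry of the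
  Hessian makes such a product skew for \<open>symp\<close>. Along variations of a solution this
  says that their symplectic product does not change in time.\<close>

lemma symp_xi': "symp (xi' P u) v + symp u (xi' P v) = 0"
proof -
  obtain x y p q where u: "u = (x, y, p, q)" by (metis surj_pair)
  obtain x' y' p' q' where v: "v = (x', y', p', q')" by (metis surj_pair)
  note lin = linear_R4[OF has_derivative_bounded_linear[OF H'']]
  show ?thesis
    unfolding u v xi'_def symp_def prod.case lin
    using H''_sym[of P ex ey] H''_sym[of P ex ep] H''_sym[of P ex Defs.eq]
      H''_sym[of P ey ep] H''_sym[of P ey Defs.eq] H''_sym[of P ep Defs.eq]
    by (simp add: algebra_simps)
qed

lemma H'_xiH: "H' P (xiH H P) = 0"
  unfolding xiH_eq linear_R4[OF has_derivative_bounded_linear[OF H']] by simp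

end

lemma Ck_on_hamiltonianE:
  assumes "Ck_on (Suc (Suc n)) UNIV H"
  obtains H' H'' where "hamiltonian H n H' H''"
proof -
  have "Cr (Suc (Suc n)) UNIV H" by (rule Ck_on_imp_Cr[OF open_UNIV assms])
  then obtain H' where H': "\<And>P. (H has_derivative H' P) (at P)" "\<And>v. Cr (Suc n) UNIV (\<lambda>P. H' P v)"
    unfolding Cr.simps(2)[of "Suc n"] by auto
  from H'(2) have "\<forall>v. \<exists>f'. (\<forall>x. ((\<lambda>P. H' P v) has_derivative f' x) (at x)) \<and> (\<forall>w. Cr n UNIV (\<lambda>x. f' x w))"
    by simp
  then obtain G where G: "\<And>v x. ((\<lambda>P. H' P v) has_derivative G v x) (at x)" "\<And>v w. Cr n UNIV (\<lambda>x. G v x w)"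
    by metis
  show thesis
    by (rule that[of H' "\<lambda>P v. G v P"]) (unfold_locales; fact H' G)
qed

section \<open>The linearized problem\<close>

type_synonym C4 = "complex \<times> complex \<times> complex \<times> complex"

definition smc :: "complex \<Rightarrow> C4 \<Rightarrow> C4" where
  "smc z v = (case v of (x, y, p, q) \<Rightarrow> (z * x, z * y, z * p, z * q))"

definition re4 :: "C4 \<Rightarrow> R4" where
  "re4 v = (case v of (x, y, p, q) \<Rightarrow> (Re x, Re y, Re p, Re q))"

definition cx4 :: "R4 \<Rightarrow> C4" where
  "cx4 v = (case v of (x, y, p, q) \<Rightarrow> (of_real x, of_real y, of_real p, of_real q))"

text \<open>Complex bilinear, not sesquilinear: eigenvalues can then be moved out of either argument
  without conjugation.\<close>

definition csymp :: "C4 \<Rightarrow> C4 \<Rightarrow> complex" where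
  "csymp u v = (case u of (x, y, p, q) \<Rightarrow> case v of (x', y', p', q') \<Rightarrow> x * p' + y * q' - p * x' - q * y')"

lemma smc_simps:
  "smc (a + b) v = smc a v + smc b v" "smc a (v + w) = smc a v + smc a w"
  "smc a (smc b v) = smc (a * b) v" "smc (r *\<^sub>R a) v = r *\<^sub>R smc a v" "smc 0 v = 0"
  "smc (a - b) v = smc a v - smc b v" "smc a (v - w) = smc a v - smc a w" "smc (- a) v = - smc a v"
  by (simp_all add: smc_def algebra_simps case_prod_beta prod_eq_iff)

lemma re4_linear: "re4 (v + w) = re4 v + re4 w" "re4 (r *\<^sub>R v) = r *\<^sub>R re4 v" "re4 (cx4 u) = u" "re4 0 = 0"
  by (simp_all add: re4_def cx4_def case_prod_beta prod_eq_iff)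

lemma csymp_linear: "csymp u (v + w) = csymp u v + csymp u w" "csymp u (r *\<^sub>R v) = r *\<^sub>R csymp u v"
  "csymp u (smc z v) = z * csymp u v" "csymp (smc z u) v = z * csymp u v"
  by (simp_all add: csymp_def smc_def algebra_simps case_prod_beta prod_eq_iff)

lemma cx4_linear: "cx4 (v + w) = cx4 v + cx4 w" "cx4 (r *\<^sub>R v) = r *\<^sub>R cx4 v"
  by (simp_all add: cx4_def scaleR_conv_of_real case_prod_beta prod_eq_iff)

lemma bounded_linear_re4_smc: "bounded_linear (\<lambda>z. re4 (smc z v))"
  by (simp add: linear_conv_bounded_linear[symmetric] linear_iff smc_simps re4_linear)

lemma has_vector_derivative_re4_smc:
  "(f has_vector_derivative d) F \<Longrightarrow> ((\<lambda>t. re4 (smc (f t) v)) has_vector_derivative re4 (smc d v)) F"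
  by (rule bounded_linear.has_vector_derivative[OF bounded_linear_re4_smc])

text \<open>The real numbers \<open>hxx\<close>, \<open>hxy\<close>, ... are the entries of a symmetric matrix \<open>S\<close>, and the
  operators below are \<open>J S\<close> on \<open>\<complex>\<^sup>4\<close> and on \<open>\<real>\<^sup>4\<close>.\<close>

locale eigenplane =
  fixes hxx hxy hxp hxq hyy hyp hyq hpp hpq hqq :: real
    and l1 l2 x1 y1 p1 q1 x2 y2 p2 q2 :: complex
    and cL :: "C4 \<Rightarrow> C4" and rL :: "R4 \<Rightarrow> R4" and e1 e2 :: C4
  assumes cL_def: "cL = (\<lambda>(x :: complex, y :: complex, p :: complex, q :: complex).
      (of_real hxp * x + of_real hyp * y + of_real hpp * p + of_real hpq * q,
       of_real hxq * x + of_real hyq * y + of_real hpq * p + of_real hqq * q,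
       - (of_real hxx * x + of_real hxy * y + of_real hxp * p + of_real hxq * q),
       - (of_real hxy * x + of_real hyy * y + of_real hyp * p + of_real hyq * q)))"
    and rL_def: "rL = (\<lambda>(x, y, p, q). (hxp * x + hyp * y + hpp * p + hpq * q, hxq * x + hyq * y + hpq * p + hqq * q,
      - (hxx * x + hxy * y + hxp * p + hxq * q), - (hxy * x + hyy * y + hyp * p + hyq * q)))"
    and e1_def: "e1 = (x1, y1, p1, q1)" and e2_def: "e2 = (x2, y2, p2, q2)"
    and eigen: "cL e1 = smc l1 e1" "cL e2 = smc l2 e2"
    and neg: "Re l1 < 0" "Re l2 < 0"
    and D0: "x1 * y2 - x2 * y1 \<noteq> 0"
begin

definition "D = x1 * y2 - x2 * y1"

lemma D_nz: "D \<noteq> 0" using D0 by (simp add: D_def)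

lemma cL_linear: "cL (v + w) = cL v + cL w" "cL (smc z v) = smc z (cL v)" "cL (r *\<^sub>R v) = r *\<^sub>R cL v"
  unfolding cL_def by (simp_all add: smc_def algebra_simps scaleR_conv_of_real case_prod_beta prod_eq_iff)

lemma re4_cL: "re4 (cL v) = rL (re4 v)"
  unfolding cL_def rL_def by (simp add: re4_def case_prod_beta)

lemma cL_cx4: "cL (cx4 v) = cx4 (rL v)"
  unfolding cL_def rL_def by (simp add: cx4_def case_prod_beta)

text \<open>The linear form of infinitesimal symplecticity, from the symmetry of the matrix of the
  \<open>h\<close> coefficients.\<close>

lemma csymp_cL: "csymp (cL u) v = - csymp u (cL v)"
  unfolding cL_def by (simp add: csymp_def case_prod_beta algebra_simps)

text \<open>Skewness gives \<open>(l1 + l2) * csymp e1 e2 = 0\<close>, and two numbers with negative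
  real part cannot sum to zero.\<close>

lemma isotropic: "csymp e1 e2 = 0"
proof -
  have "l1 * csymp e1 e2 = - (l2 * csymp e1 e2)"
    using csymp_cL[of e1 e2] by (simp add: eigen csymp_linear)
  then have "(l1 + l2) * csymp e1 e2 = 0" by (simp add: algebra_simps)
  moreover have "l1 + l2 \<noteq> 0" using neg by (auto simp: complex_eq_iff)
  ultimately show ?thesis by simp
qed

text \<open>The vertical vectors symplectically dual to \<open>e1\<close>, \<open>e2\<close>.\<close>

definition d1 :: C4 where "d1 = (0, 0, y2 / D, - (x2 / D))"
definition d2 :: C4 where "d2 = (0, 0, - (y1 / D), x1 / D)"

text \<open>Cramer's rule: \<open>w1 v\<close> and \<open>w2 v\<close> express the base components
  of \<open>v\<close> in the basis of base components of \<open>e1\<close> and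
  \<open>e2\<close>.\<close>

definition w1 :: "C4 \<Rightarrow> complex" where "w1 v = (y2 * fst v - x2 * fst (snd v)) / D"
definition w2 :: "C4 \<Rightarrow> complex" where "w2 v = (x1 * fst (snd v) - y1 * fst v) / D"

lemma w_linear: "w1 (v + w) = w1 v + w1 w" "w1 (smc z v) = z * w1 v" "w1 (r *\<^sub>R v) = r *\<^sub>R w1 v"
  "w2 (v + w) = w2 v + w2 w" "w2 (smc z v) = z * w2 v" "w2 (r *\<^sub>R v) = r *\<^sub>R w2 v"
  by (simp_all add: w1_def w2_def smc_def add_divide_distrib diff_divide_distrib algebra_simps scaleR_conv_of_real case_prod_beta)

lemma w_basis: "w1 e1 = 1" "w1 e2 = 0" "w1 d1 = 0" "w1 d2 = 0" "w2 e1 = 0" "w2 e2 = 1" "w2 d1 = 0" "w2 d2 = 0"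
  using D_nz by (simp_all add: w1_def w2_def e1_def e2_def d1_def d2_def) (simp_all add: D_def field_simps)

lemma symp_basis: "csymp e1 d1 = 1" "csymp e1 d2 = 0" "csymp e2 d1 = 0" "csymp e2 d2 = 1"
  using D_nz by (simp_all add: csymp_def e1_def e2_def d1_def d2_def field_simps) (simp_all add: D_def field_simps)

text \<open>The four functionals form the basis dual to \<open>e1\<close>, \<open>e2\<close>,
  \<open>d1\<close>, \<open>d2\<close>. Isotropy is indispensable here, since
  \<open>csymp e1\<close> has to annihilate \<open>e2\<close> and conversely.\<close>

lemma decomp: "v = smc (w1 v) e1 + smc (w2 v) e2 + smc (csymp e1 v) d1 + smc (csymp e2 v) d2"
proof -
  obtain x y p q where v: "v = (x, y, p, q)" by (metis surj_pair)
  have iso: "x1 * p2 + y1 * q2 - p1 * x2 - q1 * y2 = 0"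
    using isotropic by (simp add: csymp_def e1_def e2_def)
  have "D * x = (y2 * x - x2 * y) * x1 + (x1 * y - y1 * x) * x2"
    unfolding D_def by (simp add: algebra_simps)
  then have X: "x = (y2 * x - x2 * y) / D * x1 + (x1 * y - y1 * x) / D * x2"
    using D_nz by (simp add: eq_divide_eq mult.commute[of D] flip: add_divide_distrib)
  have "D * y = (y2 * x - x2 * y) * y1 + (x1 * y - y1 * x) * y2"
    unfolding D_def by (simp add: algebra_simps)
  then have Y: "y = (y2 * x - x2 * y) / D * y1 + (x1 * y - y1 * x) / D * y2"
    using D_nz by (simp add: eq_divide_eq mult.commute[of D] flip: add_divide_distrib)
  \<comment> \<open>The two sides differ by \<open>y\<close> times the isotropy relation
    \<open>iso\<close>; for \<open>q\<close> below the factor is \<open>- x\<close>.\<close>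
  have "D * p = (y2 * x - x2 * y) * p1 + (x1 * y - y1 * x) * p2
     + (x1 * p + y1 * q - p1 * x - q1 * y) * y2 + (x2 * p + y2 * q - p2 * x - q2 * y) * (- y1)"
    proof -
    have "(y2 * x - x2 * y) * p1 + (x1 * y - y1 * x) * p2
     + (x1 * p + y1 * q - p1 * x - q1 * y) * y2 + (x2 * p + y2 * q - p2 * x - q2 * y) * (- y1)
     = D * p + y * (x1 * p2 + y1 * q2 - p1 * x2 - q1 * y2)"
      unfolding D_def by (simp add: algebra_simps)
    then show ?thesis using iso by simp
  qed
  then have P: "p = (y2 * x - x2 * y) / D * p1 + (x1 * y - y1 * x) / D * p2
     + (x1 * p + y1 * q - p1 * x - q1 * y) * (y2 / D) + (x2 * p + y2 * q - p2 * x - q2 * y) * - (y1 / D)"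
    using D_nz by (simp add: eq_divide_eq mult.commute[of D] flip: add_divide_distrib diff_divide_distrib)
  have "D * q = (y2 * x - x2 * y) * q1 + (x1 * y - y1 * x) * q2
     + (x1 * p + y1 * q - p1 * x - q1 * y) * (- x2) + (x2 * p + y2 * q - p2 * x - q2 * y) * x1"
    proof -
    have "(y2 * x - x2 * y) * q1 + (x1 * y - y1 * x) * q2
     + (x1 * p + y1 * q - p1 * x - q1 * y) * (- x2) + (x2 * p + y2 * q - p2 * x - q2 * y) * x1
     = D * q - x * (x1 * p2 + y1 * q2 - p1 * x2 - q1 * y2)"
      unfolding D_def by (simp add: algebra_simps)
    then show ?thesis using iso by simp
  qed
  then have Q: "q = (y2 * x - x2 * y) / D * q1 + (x1 * y - y1 * x) / D * q2
     + (x1 * p + y1 * q - p1 * x - q1 * y) * - (x2 / D) + (x2 * p + y2 * q - p2 * x - q2 * y) * (x1 / D)"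
    using D_nz by (simp add: eq_divide_eq mult.commute[of D] flip: add_divide_distrib diff_divide_distrib)
  show ?thesis
    unfolding v smc_def e1_def e2_def d1_def d2_def w1_def w2_def csymp_def prod.case fst_conv snd_conv add_Pair
      mult_zero_right add_0_right prod.inject
    by (intro conjI X Y P Q)
qed

lemma csymp_e_cL: "csymp e1 (cL v) = - l1 * csymp e1 v" "csymp e2 (cL v) = - l2 * csymp e2 v"
  using csymp_cL[of e1 v] csymp_cL[of e2 v] by (simp_all add: eigen csymp_linear)

section \<open>Solution operators of the linearized problem\<close>

definition "C11 = w1 (cL d1)"
definition "C12 = w1 (cL d2)"
definition "C21 = w2 (cL d1)"
definition "C22 = w2 (cL d2)"

text \<open>The system is block triangular: since \<open>csymp e1\<close> and
  \<open>csymp e2\<close> are left eigenvectors, \<open>cL d1\<close> has no component along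
  \<open>d2\<close> and conversely, but both leak into \<open>e1\<close> and
  \<open>e2\<close>.\<close>

lemma cL_d: "cL d1 = smc C11 e1 + smc C21 e2 + smc (- l1) d1" "cL d2 = smc C12 e1 + smc C22 e2 + smc (- l2) d2"
  using decomp[of "cL d1"] decomp[of "cL d2"]
  by (simp_all add: csymp_e_cL symp_basis smc_simps C11_def C12_def C21_def C22_def)

definition "M1 = post (\<lambda>v. csymp e1 (cx4 v))"
definition "M2 = post (\<lambda>v. csymp e2 (cx4 v))"
definition "W1 = post (\<lambda>v. w1 (cx4 v))"
definition "W2 = post (\<lambda>v. w2 (cx4 v))"

lemma bounded_linear_coords: "bounded_linear (\<lambda>v. csymp u (cx4 v))" "bounded_linear (\<lambda>v. w1 (cx4 v))" "bounded_linear (\<lambda>v. w2 (cx4 v))"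
  by (simp_all add: linear_conv_bounded_linear[symmetric] linear_iff cx4_linear csymp_linear w_linear)

text \<open>The coefficients of \<open>d1\<close>, \<open>d2\<close> solve decoupled growing
  equations, where boundedness fixes the solution. They then act as forcing for the coefficients
  \<open>n1\<close>, \<open>n2\<close> of \<open>e1\<close>, \<open>e2\<close>, which start at 0; at
  time 0 only vertical vectors remain, whence \<open>K_proj\<close>.\<close>

definition "m1 f = solU (- l1) (M1 f)"
definition "m2 f = solU (- l2) (M2 f)"
definition "n1 f = solW l1 (W1 f + post ((*) C11) (m1 f) + post ((*) C12) (m2 f))"
definition "n2 f = solW l2 (W2 f + post ((*) C21) (m1 f) + post ((*) C22) (m2 f))"

definition "K f = post (\<lambda>z. re4 (smc z e1)) (n1 f) + post (\<lambda>z. re4 (smc z e2)) (n2 f)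
   + post (\<lambda>z. re4 (smc z d1)) (m1 f) + post (\<lambda>z. re4 (smc z d2)) (m2 f)"

lemma pos: "Re (- l1) > 0" "Re (- l2) > 0" using neg by auto

lemma bounded_linear_K: "bounded_linear K"
proof -
  note c = bounded_linear_compose
  have m: "bounded_linear m1" "bounded_linear m2"
    unfolding m1_def [abs_def] m2_def [abs_def] M1_def M2_def
    by (auto intro!: c[OF bounded_linear_solU[OF pos(1)]] c[OF bounded_linear_solU[OF pos(2)]] bounded_linear_post bounded_linear_coords)
  have n: "bounded_linear n1" "bounded_linear n2"
    unfolding n1_def [abs_def] n2_def [abs_def] W1_def W2_def
    by (auto intro!: c[OF bounded_linear_solW[OF neg(1)]] c[OF bounded_linear_solW[OF neg(2)]] bounded_linear_add bounded_linear_post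
        bounded_linear_coords c[OF bounded_linear_post[OF bounded_linear_mult_right]] m)
  show ?thesis unfolding K_def [abs_def]
    by (intro bounded_linear_add c[OF bounded_linear_post[OF bounded_linear_re4_smc]] m n)
qed

lemma apply_K: "apply_bcontfun (K f) = (\<lambda>t. re4 (smc (n1 f t) e1) + re4 (smc (n2 f t) e2) + re4 (smc (m1 f t) d1) + re4 (smc (m2 f t) d2))"
  by (rule ext) (simp add: K_def apply_post bounded_linear_re4_smc)

text \<open>The equation is solved in complex coordinates. Taking real parts commutes with the real
  operator, and \<open>decomp\<close> reassembles the four forcing terms into
  \<open>f\<close>.\<close>

lemma K_deriv:
  assumes t: "t \<ge> 0"
  shows "(apply_bcontfun (K f) has_vector_derivative rL (K f t) + f t) (at t within {0..})"
proof -
  let ?v = "cx4 (f t)"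
  have m: "(m1 f has_vector_derivative - l1 * m1 f t + csymp e1 ?v) (at t within {0..})"
    "(m2 f has_vector_derivative - l2 * m2 f t + csymp e2 ?v) (at t within {0..})"
    using solU_deriv[OF pos(1) t, of "M1 f"] solU_deriv[OF pos(2) t, of "M2 f"]
    by (simp_all add: m1_def m2_def M1_def M2_def apply_post bounded_linear_coords)
  have n: "(n1 f has_vector_derivative l1 * n1 f t + (w1 ?v + C11 * m1 f t + C12 * m2 f t)) (at t within {0..})"
    "(n2 f has_vector_derivative l2 * n2 f t + (w2 ?v + C21 * m1 f t + C22 * m2 f t)) (at t within {0..})"
    using solW_deriv[OF neg(1) t, of "W1 f + post ((*) C11) (m1 f) + post ((*) C12) (m2 f)"]
       solW_deriv[OF neg(2) t, of "W2 f + post ((*) C21) (m1 f) + post ((*) C22) (m2 f)"]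
    by (simp_all add: n1_def n2_def W1_def W2_def apply_post bounded_linear_coords bounded_linear_mult_right)
  let ?G = "smc (n1 f t) e1 + smc (n2 f t) e2 + smc (m1 f t) d1 + smc (m2 f t) d2"
  have "(apply_bcontfun (K f) has_vector_derivative
     re4 (smc (l1 * n1 f t + (w1 ?v + C11 * m1 f t + C12 * m2 f t)) e1)
   + re4 (smc (l2 * n2 f t + (w2 ?v + C21 * m1 f t + C22 * m2 f t)) e2)
   + re4 (smc (- l1 * m1 f t + csymp e1 ?v) d1) + re4 (smc (- l2 * m2 f t + csymp e2 ?v) d2)) (at t within {0..})"
    unfolding apply_K by (intro has_vector_derivative_add has_vector_derivative_re4_smc m n)
  moreover have "re4 (smc (l1 * n1 f t + (w1 ?v + C11 * m1 f t + C12 * m2 f t)) e1)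
   + re4 (smc (l2 * n2 f t + (w2 ?v + C21 * m1 f t + C22 * m2 f t)) e2)
   + re4 (smc (- l1 * m1 f t + csymp e1 ?v) d1) + re4 (smc (- l2 * m2 f t + csymp e2 ?v) d2)
   = re4 (cL ?G) + re4 (smc (w1 ?v) e1 + smc (w2 ?v) e2 + smc (csymp e1 ?v) d1 + smc (csymp e2 ?v) d2)"
    by (simp add: re4_linear[symmetric] cL_linear eigen cL_d smc_simps algebra_simps del: re4_linear)
  moreover have "re4 (smc (w1 ?v) e1 + smc (w2 ?v) e2 + smc (csymp e1 ?v) d1 + smc (csymp e2 ?v) d2) = f t"
    unfolding decomp[of ?v, symmetric] by (rule re4_linear)
  moreover have "re4 ?G = K f t" by (simp add: apply_K re4_linear)
  ultimately show ?thesis by (simp add: re4_cL)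
qed

lemma tendsto_re4_smc: "(g \<longlongrightarrow> 0) F \<Longrightarrow> ((\<lambda>t. re4 (smc (g t) v)) \<longlongrightarrow> 0) F"
  using bounded_linear.tendsto[OF bounded_linear_re4_smc, of g 0 F v] by (simp add: smc_simps re4_linear)

lemma K_lim:
  assumes f: "(apply_bcontfun f \<longlongrightarrow> 0) at_top"
  shows "(apply_bcontfun (K f) \<longlongrightarrow> 0) at_top"
proof -
  have post0: "(apply_bcontfun (post T g) \<longlongrightarrow> 0) at_top"
    if "bounded_linear T" "(apply_bcontfun g \<longlongrightarrow> 0) at_top" for T :: "'x::real_normed_vector \<Rightarrow> complex" and g
  proof -
    have "apply_bcontfun (post T g) = (\<lambda>t. T (g t))" by (rule ext) (rule apply_post[OF that(1)])
    then show ?thesis using bounded_linear.tendsto_zero[OF that] by simp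
  qed
  have m: "(apply_bcontfun (m1 f) \<longlongrightarrow> 0) at_top" "(apply_bcontfun (m2 f) \<longlongrightarrow> 0) at_top"
    unfolding m1_def m2_def M1_def M2_def
    by (intro solU_lim pos post0 bounded_linear_coords f)+
  have n: "(apply_bcontfun (n1 f) \<longlongrightarrow> 0) at_top" "(apply_bcontfun (n2 f) \<longlongrightarrow> 0) at_top"
    unfolding n1_def n2_def W1_def W2_def
    by (intro solW_lim neg; simp only: plus_bcontfun.rep_eq;
        intro tendsto_add_zero post0 bounded_linear_coords bounded_linear_mult_right m f)+
  show ?thesis unfolding apply_K
    by (intro tendsto_add_zero tendsto_re4_smc m n)
qed

lemma proj_linear: "proj (v + w) = proj v + proj w" "proj (r *\<^sub>R v) = r *\<^sub>R proj v"
  by (simp_all add: proj_def case_prod_beta prod_eq_iff)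

lemma proj_d: "proj (re4 (smc z d1)) = 0" "proj (re4 (smc z d2)) = 0"
  by (simp_all add: proj_def re4_def smc_def d1_def d2_def zero_prod_def)

lemma K_proj: "proj (K f 0) = 0"
  by (simp add: apply_K proj_linear proj_d n1_def n2_def solW_0 neg smc_simps re4_linear)

lemma K_neg:
  assumes "t < 0" shows "apply_bcontfun (K f) t = K f 0"
  using assms by (simp add: apply_K n1_def n2_def m1_def m2_def apply_solU[OF pos(1)] apply_solU[OF pos(2)]
      apply_solW[OF neg(1)] apply_solW[OF neg(2)])

definition "c4 x = cx4 (fst x, snd x, 0, 0)"

text \<open>The base point is lifted with zero momentum and only its components along
  \<open>e1\<close>, \<open>e2\<close> are propagated; the real part of this complex decaying
  solution is real and decaying.\<close>

definition "E x = post (\<lambda>z. re4 (smc z (smc (w1 (c4 x)) e1))) (expc l1) + post (\<lambda>z. re4 (smc z (smc (w2 (c4 x)) e2))) (expc l2)"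

lemma apply_E: "apply_bcontfun (E x) = (\<lambda>t. re4 (smc (expc l1 t) (smc (w1 (c4 x)) e1)) + re4 (smc (expc l2 t) (smc (w2 (c4 x)) e2)))"
  by (rule ext) (simp add: E_def apply_post bounded_linear_re4_smc)

lemma bounded_linear_E: "bounded_linear E"
proof -
  have c4: "c4 (x + y) = c4 x + c4 y" "c4 (r *\<^sub>R x) = r *\<^sub>R c4 x" for x y r
    by (simp_all add: c4_def cx4_linear[symmetric])
  have sc: "smc a (r *\<^sub>R v) = r *\<^sub>R smc a v" for a r v
    by (cases v; simp add: smc_def)
  have "linear E"
    unfolding linear_iff
    by (intro conjI allI; intro bcontfun_eqI) (simp_all add: apply_E c4 w_linear smc_simps sc re4_linear scaleR_add_right)
  then show ?thesis by (simp add: linear_conv_bounded_linear)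
qed

lemma E_deriv:
  assumes "t \<ge> 0"
  shows "(apply_bcontfun (E x) has_vector_derivative rL (E x t)) (at t within {0..})"
proof -
  have "(apply_bcontfun (E x) has_vector_derivative re4 (smc (l1 * expc l1 t) (smc (w1 (c4 x)) e1)) +
      re4 (smc (l2 * expc l2 t) (smc (w2 (c4 x)) e2))) (at t within {0..})"
    unfolding apply_E by (intro has_vector_derivative_add has_vector_derivative_re4_smc expc_deriv neg assms)
  moreover have "re4 (smc (l1 * expc l1 t) (smc (w1 (c4 x)) e1)) + re4 (smc (l2 * expc l2 t) (smc (w2 (c4 x)) e2))
     = rL (E x t)"
    by (simp add: apply_E re4_linear(1)[symmetric] re4_cL[symmetric] cL_linear eigen smc_simps ac_simps del: re4_linear)
  ultimately show ?thesis by simp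
qed

text \<open>The zero-momentum lift and \<open>E x 0\<close> differ by a combination of
  \<open>d1\<close> and \<open>d2\<close>, which is vertical and invisible to
  \<open>proj\<close>.\<close>

lemma E_proj: "proj (E x 0) = x"
proof -
  have "proj (re4 (c4 x)) = x" by (simp add: c4_def re4_linear proj_def)
  also have "re4 (c4 x) = E x 0 + (re4 (smc (csymp e1 (c4 x)) d1) + re4 (smc (csymp e2 (c4 x)) d2))"
    by (subst decomp) (simp add: apply_E expc_0 neg re4_linear smc_simps)
  finally show ?thesis by (simp add: proj_linear proj_d)
qed

lemma E_lim: "(apply_bcontfun (E x) \<longlongrightarrow> 0) at_top"
  unfolding apply_E by (intro tendsto_add_zero tendsto_re4_smc expc_lim neg)

lemma E_neg:
  assumes "t < 0" shows "apply_bcontfun (E x) t = E x 0"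
  using assms by (simp add: apply_E expc_neg neg)

text \<open>Boundedness kills the two growing symplectic coordinates. The remaining coordinates
  \<open>w1\<close>, \<open>w2\<close> then decouple into scalar equations whose initial values
  depend only on the base point, hence are 0.\<close>

lemma linear_unique:
  assumes u: "\<And>t. t \<ge> 0 \<Longrightarrow> (u has_vector_derivative rL (u t)) (at t within {0..})"
    and B: "\<And>t. t \<ge> 0 \<Longrightarrow> norm (u t) \<le> B" and p: "proj (u 0) = 0" and t: "t \<ge> 0"
  shows "u t = 0"
proof -
  have m: "csymp e (cx4 (u t)) = 0"
    if "\<And>v. csymp e (cL v) = - l * csymp e v" "Re l < 0" "t \<ge> 0" for e l t
  proof -
    obtain k where k: "\<And>v. norm (csymp e (cx4 v)) \<le> norm v * k" "k \<ge> 0"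
      using bounded_linear.nonneg_bounded[OF bounded_linear_coords(1)[of e]] by blast
    show ?thesis
    proof (rule bounded_growing_ode_zero[where m = "\<lambda>t. csymp e (cx4 (u t))" and \<mu> = "- l" and B = "B * k", OF _ _ _ that(3)])
      show "norm (csymp e (cx4 (u s))) \<le> B * k" if "s \<ge> 0" for s
        using order_trans[OF k(1) mult_right_mono[OF B[OF that] k(2)]] .
      show "((\<lambda>t. csymp e (cx4 (u t))) has_vector_derivative - l * csymp e (cx4 (u s))) (at s within {0..})" if "s \<ge> 0" for s
        using bounded_linear.has_vector_derivative[OF bounded_linear_coords(1)[of e] u[OF that]]
        by (simp add: cL_cx4[symmetric] \<open>\<And>v. csymp e (cL v) = - l * csymp e v\<close>)
    qed (use that in auto)
  qed
  note m1 = m[OF csymp_e_cL(1) neg(1)] and m2 = m[OF csymp_e_cL(2) neg(2)]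
  have rep: "cx4 (u s) = smc (w1 (cx4 (u s))) e1 + smc (w2 (cx4 (u s))) e2" if "s \<ge> 0" for s
    using decomp[of "cx4 (u s)"] m1[OF that] m2[OF that] by (simp add: smc_simps)
  have wd: "w1 (cL (cx4 (u s))) = l1 * w1 (cx4 (u s))" "w2 (cL (cx4 (u s))) = l2 * w2 (cx4 (u s))" if "s \<ge> 0" for s
    by (subst rep[OF that]; simp add: cL_linear eigen w_linear w_basis)+
  have p0: "fst (cx4 (u 0)) = 0 \<and> fst (snd (cx4 (u 0))) = 0"
    using p by (cases "u 0") (simp add: proj_def cx4_def zero_prod_def)
  have "w1 (cx4 (u t)) = exp (l1 * complex_of_real t) * w1 (cx4 (u 0))"
  proof (rule exp_linear_ode[OF _ t])
    show "((\<lambda>t. w1 (cx4 (u t))) has_vector_derivative l1 * w1 (cx4 (u s))) (at s within {0..})" if "s \<ge> 0" for s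
      using bounded_linear.has_vector_derivative[OF bounded_linear_coords(2) u[OF that]]
      by (simp add: cL_cx4[symmetric] wd that)
  qed
  moreover have "w2 (cx4 (u t)) = exp (l2 * complex_of_real t) * w2 (cx4 (u 0))"
  proof (rule exp_linear_ode[OF _ t])
    show "((\<lambda>t. w2 (cx4 (u t))) has_vector_derivative l2 * w2 (cx4 (u s))) (at s within {0..})" if "s \<ge> 0" for s
      using bounded_linear.has_vector_derivative[OF bounded_linear_coords(3) u[OF that]]
      by (simp add: cL_cx4[symmetric] wd that)
  qed
  moreover have "w1 (cx4 (u 0)) = 0" "w2 (cx4 (u 0)) = 0" using p0 by (simp_all add: w1_def w2_def)
  ultimately have "w1 (cx4 (u t)) = 0" "w2 (cx4 (u t)) = 0" by simp_all
  with rep[OF t] have "cx4 (u t) = 0" by (simp add: smc_simps)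
  then show ?thesis using re4_linear(3)[of "u t"] re4_linear(4) by simp
qed

lemma bounded_linear_rL: "bounded_linear rL"
proof -
  have "linear rL" unfolding linear_iff by (auto simp: rL_def algebra_simps)
  then show ?thesis by (simp add: linear_conv_bounded_linear)
qed

lemma bounded_linear_proj: "bounded_linear proj"
  by (simp add: linear_conv_bounded_linear[symmetric] linear_iff proj_linear)

lemma norm_proj: "norm (proj P) \<le> norm P"
proof -
  obtain x y p q where P: "P = (x, y, p, q)" by (metis surj_pair)
  show ?thesis unfolding P proj_def prod.case norm_Pair by (simp add: real_le_rsqrt) 
qed

sublocale stable_splitting rL proj K E
  by (rule stable_splitting.intro)
     (fact bounded_linear_rL bounded_linear_proj norm_proj bounded_linear_K bounded_linear_E
       K_deriv K_proj K_lim K_neg E_deriv E_proj E_lim E_neg linear_unique)+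

end

section \<open>The spectrum of the linearization\<close>

lemma Lc_carrier: "Lc H \<in> carrier_mat 4 4"
  unfolding Lc_def Lmat_def mat_of_rows_list_def by (rule carrier_matI) simp_all

definition Jmat :: "complex mat" where
  "Jmat = mat_of_rows_list 4 [[0, 0, 1, 0], [0, 0, 0, 1], [-1, 0, 0, 0], [0, -1, 0, 0]]"

lemma Jmat_carrier: "Jmat \<in> carrier_mat 4 4"
  unfolding Jmat_def mat_of_rows_list_def by (rule carrier_matI) simp_all

lemma less_4_cases: "i < 4 \<Longrightarrow> i = 0 \<or> i = 1 \<or> i = 2 \<or> i = (3::nat)"
  by auto

lemma mat_mult_entry4:
  fixes A B :: "'a::comm_ring_1 mat"
  assumes "A \<in> carrier_mat 4 4" "B \<in> carrier_mat 4 4" "i < 4" "j < 4"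
  shows "(A * B) $$ (i, j) = A $$ (i, 0) * B $$ (0, j) + A $$ (i, 1) * B $$ (1, j) + A $$ (i, 2) * B $$ (2, j) + A $$ (i, 3) * B $$ (3, j)"
proof -
  have "sum f {0..<4} = f 0 + f 1 + f 2 + f (3::nat)" for f :: "nat \<Rightarrow> 'a"
    by (simp add: eval_nat_numeral)
  moreover have "(A * B) $$ (i, j) = (\<Sum>k = 0..<4. A $$ (i, k) * B $$ (k, j))"
    using carrier_matD[OF assms(1)] carrier_matD[OF assms(2)] assms(3,4) by (simp add: scalar_prod_def)
  ultimately show ?thesis by simp
qed

text \<open>\<open>- Jmat\<close> is the inverse of \<open>Jmat\<close>, which spares expanding the
  determinant.\<close>

lemma det_Jmat: "det Jmat \<noteq> 0"
proof
  have "Jmat * (- Jmat) = 1\<^sub>m 4"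
  proof (rule eq_matI)
    fix i j assume "i < dim_row (1\<^sub>m 4 :: complex mat)" "j < dim_col (1\<^sub>m 4 :: complex mat)"
    then have ij: "i < 4" "j < 4" by auto
    show "(Jmat * (- Jmat)) $$ (i, j) = 1\<^sub>m 4 $$ (i, j)"
      unfolding mat_mult_entry4[OF Jmat_carrier uminus_carrier_mat[OF Jmat_carrier] ij]
      using less_4_cases[OF ij(1)] less_4_cases[OF ij(2)]
      by (elim disjE) (simp_all add: Jmat_def mat_of_rows_list_def)
  qed (use Jmat_carrier in auto)
  then have "det Jmat * det (- Jmat) = 1"
    using det_mult[OF Jmat_carrier uminus_carrier_mat[OF Jmat_carrier]] by (metis det_one)
  moreover assume "det Jmat = 0"
  ultimately show False by simp
qed

text \<open>With \<open>L = J S\<close>, \<open>S\<close> symmetric, one has \<open>J L\<^sup>T = - L J\<close>, so the characteristic polynomial is even.\<close>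

lemma poly_char_poly_even: "poly (char_poly (Lc H)) (- x) = poly (char_poly (Lc H)) x"
proof -
  define M where "M = Lc H"
  have M: "M \<in> carrier_mat 4 4" unfolding M_def by (rule Lc_carrier)
  define N where "N y = y \<cdot>\<^sub>m 1\<^sub>m 4 - M" for y
  have N: "N y \<in> carrier_mat 4 4" for y using minus_carrier_mat[OF M] by (simp add: N_def)
  have p: "poly (char_poly M) y = det (N y)" for y
  proof -
    have "- char_matrix M y = N y"
      using M by (intro eq_matI) (auto simp: N_def char_matrix_def)
    then show ?thesis using char_poly_matrix[OF M, of y] by simp
  qed
  define N' where "N' = x \<cdot>\<^sub>m 1\<^sub>m 4 + M"
  have N': "N' \<in> carrier_mat 4 4" using M by (simp add: N'_def)
  have "N (- x) = (- 1) \<cdot>\<^sub>m N'"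
    using M by (intro eq_matI) (auto simp: N_def N'_def)
  \<comment> \<open>The dimension 4 is even, so the factor \<open>- 1\<close> disappears from the
    determinant.\<close>
  then have "det (N (- x)) = det N'" using det_smult[of "- 1" N'] N' by simp
  moreover have "Jmat * transpose_mat (N x) = N' * Jmat"
  proof (rule eq_matI)
    fix i j assume "i < dim_row (N' * Jmat)" "j < dim_col (N' * Jmat)"
    then have ij: "i < 4" "j < 4" using N' Jmat_carrier by auto
    show "(Jmat * transpose_mat (N x)) $$ (i, j) = (N' * Jmat) $$ (i, j)"
      unfolding mat_mult_entry4[OF Jmat_carrier transpose_carrier_mat[THEN iffD2, OF N] ij] mat_mult_entry4[OF N' Jmat_carrier ij]
      using less_4_cases[OF ij(1)] less_4_cases[OF ij(2)]
      by (elim disjE) (simp_all add: Jmat_def mat_of_rows_list_def N_def N'_def M_def Lc_def Lmat_def)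
  qed (use N N' Jmat_carrier in auto)
  then have "det Jmat * det (N x) = det N' * det Jmat"
    using det_mult[OF Jmat_carrier transpose_carrier_mat[THEN iffD2, OF N], of x] det_mult[OF N' Jmat_carrier] det_transpose[OF N, of x]
    by argo
  then have "det (N x) = det N'" using det_Jmat by simp
  ultimately show ?thesis unfolding M_def[symmetric] p by simp
qed

text \<open>Evenness of the characteristic polynomial makes the multiset of its four roots invariant
  under negation, multiplicities included. None lies on the imaginary axis, so negation matches the
  two halves and each has size 2.\<close>

lemma eigvals_filter:
  assumes "\<forall>\<mu>. eigenvalue (Lc H) \<mu> \<longrightarrow> Re \<mu> \<noteq> 0"
  shows "\<exists>l1 l2. filter_mset (\<lambda>\<mu>. Re \<mu> > 0) (eigvals H) = {#l1, l2#}"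
proof -
  define p where "p = char_poly (Lc H)"
  obtain as where as: "p = (\<Prod>a\<leftarrow>as. [:- a, 1:])" "length as = 4"
    using char_poly_factorized[OF Lc_carrier[of H]] unfolding p_def by blast
  have proots_as: "proots (\<Prod>a\<leftarrow>as. [:- a, 1:]) = mset as" for as :: "complex list"
  proof (induction as)
    case (Cons a as)
    have "(\<Prod>a\<leftarrow>as. [:- a, 1:]) \<noteq> 0" by (auto simp: prod_list_zero_iff)
    then show ?case using Cons by (simp add: proots_mult del: mult_pCons_left)
  qed simp
  have "poly p x = poly (\<Prod>a\<leftarrow>map uminus as. [:- a, 1:]) x" for x
  proof -
    have "poly p x = poly p (- x)" using poly_char_poly_even[of H x] by (simp add: p_def)
    also have "\<dots> = (-1) ^ length as * poly (\<Prod>a\<leftarrow>map uminus as. [:- a, 1:]) x"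
      unfolding as(1) by (induction as) (auto simp: algebra_simps)
    also have "\<dots> = poly (\<Prod>a\<leftarrow>map uminus as. [:- a, 1:]) x"
      unfolding as(2) by simp
    finally show ?thesis .
  qed
  then have "p = (\<Prod>a\<leftarrow>map uminus as. [:- a, 1:])" by (intro poly_eq_poly_eq_iff[THEN iffD1] ext)
  then have eq: "mset (map uminus as) = mset as"
    using proots_as[of as] proots_as[of "map uminus as"] as(1) by simp
  have ev: "eigvals H = mset as" unfolding eigvals_def p_def[symmetric] using proots_as[of as] as(1) by simp
  have nz: "Re a \<noteq> 0" if "a \<in># mset as" for a
  proof -
    have "p \<noteq> 0" using as(1) by (auto simp: prod_list_zero_iff)
    have "a \<in># proots p" using that ev by (simp only: eigvals_def p_def)
    then have "poly p a = 0" unfolding set_count_proots[OF \<open>p \<noteq> 0\<close>] by (rule CollectD)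
    then show ?thesis using assms eigenvalue_root_char_poly[OF Lc_carrier[of H]] by (simp add: p_def)
  qed
  define P where "P = filter_mset (\<lambda>\<mu>. Re \<mu> > 0) (mset as)"
  define Q where "Q = filter_mset (\<lambda>\<mu>. \<not> Re \<mu> > 0) (mset as)"
  have "size P + size Q = 4"
    unfolding P_def Q_def size_union[symmetric] multiset_partition[symmetric] using as(2) by simp
  moreover have "size P = size Q"
  proof -
    have "P = filter_mset (\<lambda>\<mu>. Re \<mu> > 0) (image_mset uminus (mset as))"
      using eq by (simp add: P_def)
    also have "\<dots> = image_mset uminus (filter_mset (\<lambda>\<mu>. Re (- \<mu>) > 0) (mset as))"
      by (simp add: filter_mset_image_mset)
    also have "filter_mset (\<lambda>\<mu>. Re (- \<mu>) > 0) (mset as) = Q"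
      unfolding Q_def using nz by (intro filter_mset_cong) (auto simp: less_le)
    finally show ?thesis by simp
  qed
  ultimately have "size P = Suc (Suc 0)" by simp
  then obtain l1 P' where P': "P = add_mset l1 P'" by (blast dest: size_eq_Suc_imp_eq_union)
  with \<open>size P = Suc (Suc 0)\<close> have "size P' = Suc 0" by simp
  then obtain l2 where "P' = {#l2#}" by (blast dest: size_1_singleton_mset[unfolded One_nat_def])
  with P' have "P = {#l1, l2#}" by simp
  then show ?thesis by (auto simp: ev P_def)
qed

section \<open>The stable manifold as a jet\<close>

definition radial_potential :: "('a::euclidean_space \<Rightarrow> 'a) \<Rightarrow> 'a \<Rightarrow> real" where
  "radial_potential g x = integral {0..1} (\<lambda>t. inner (g (t *\<^sub>R x)) x)"

text \<open>Differentiation under the integral sign followed by symmetry of \<open>g'\<close>: the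
  resulting integrand is the derivative in \<open>t\<close> of \<open>t\<close> times
  \<open>inner (g (t *\<^sub>R y)) b\<close>, so it integrates to the \<open>b\<close>-component of
  \<open>g y\<close>.\<close>

lemma radial_potential_has_derivative:
  fixes g :: "'a::euclidean_space \<Rightarrow> 'a"
  assumes g': "\<And>x. x \<in> ball 0 r \<Longrightarrow> (g has_derivative g' x) (at x)"
    and cont: "\<And>v. continuous_on (ball 0 r) (\<lambda>x. g' x v)"
    and sym: "\<And>x a b. x \<in> ball 0 r \<Longrightarrow> inner (g' x a) b = inner (g' x b) a"
    and x: "x \<in> ball 0 r"
  shows "(radial_potential g has_derivative (\<lambda>h. inner (g x) h)) (at x)"
proof -
  have g_cont: "continuous_on (ball 0 r) g"
    using has_derivative_continuous[OF g'] by (intro continuous_at_imp_continuous_on ballI)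
  have star: "t *\<^sub>R w \<in> ball 0 r" if "w \<in> ball 0 r" "t \<in> {0..1}" for w :: 'a and t
  proof -
    have "\<bar>t\<bar> * norm w \<le> 1 * norm w" using that by (intro mult_right_mono) auto
    then show ?thesis using that by simp
  qed
  have partials: "((\<lambda>s. radial_potential g (y + s *\<^sub>R b)) has_real_derivative inner (g y) b) (at 0)"
    if y: "y \<in> ball 0 r" for y b
  proof -
    \<comment> \<open>For parameters below this bound \<open>y + s *\<^sub>R b\<close> stays in the
      ball; the denominator is positive even for \<open>b = 0\<close>.\<close>
    define e where "e = (r - norm y) / (norm b + 1)"
    have nb: "norm b + 1 > 0" by (simp add: add_nonneg_pos)
    have e: "e > 0" using y nb by (simp add: e_def)
    define U where "U = ball (0::real) e"
    have in_ball: "y + s *\<^sub>R b \<in> ball 0 r" if "s \<in> U" for s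
    proof -
      have "norm (y + s *\<^sub>R b) \<le> norm y + \<bar>s\<bar> * norm b"
        using norm_triangle_ineq[of y "s *\<^sub>R b"] by simp
      also have "\<bar>s\<bar> * norm b \<le> \<bar>s\<bar> * (norm b + 1)" by (intro mult_left_mono) auto
      also have "\<bar>s\<bar> * (norm b + 1) < e * (norm b + 1)"
        using that nb by (intro mult_strict_right_mono) (auto simp: U_def)
      also have "e * (norm b + 1) = r - norm y" using nb by (simp add: e_def)
      finally show ?thesis by simp
    qed
    define f where "f s t = inner (g (t *\<^sub>R (y + s *\<^sub>R b))) (y + s *\<^sub>R b)" for s t
    define fs where "fs s t = t * inner (g' (t *\<^sub>R (y + s *\<^sub>R b)) b) (y + s *\<^sub>R b) + inner (g (t *\<^sub>R (y + s *\<^sub>R b))) b" for s t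
    have D: "((\<lambda>s. f s t) has_real_derivative fs s t) (at s within U)" if "s \<in> U" "t \<in> cbox 0 1" for s t
    proof -
      have w: "t *\<^sub>R (y + s *\<^sub>R b) \<in> ball 0 r" using that by (intro star in_ball) auto
      have "((\<lambda>s. t *\<^sub>R (y + s *\<^sub>R b)) has_derivative (\<lambda>s. s *\<^sub>R (t *\<^sub>R b))) (at s)"
        by (auto intro!: derivative_eq_intros simp: fun_eq_iff mult.commute)
      from has_derivative_compose[OF this g'[OF w]]
      have 1: "((\<lambda>s. g (t *\<^sub>R (y + s *\<^sub>R b))) has_derivative (\<lambda>u. u *\<^sub>R (t *\<^sub>R g' (t *\<^sub>R (y + s *\<^sub>R b)) b))) (at s)"
        using has_derivative_bounded_linear[OF g'[OF w]] by (simp add: linear_simps)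
      have 2: "((\<lambda>s. y + s *\<^sub>R b) has_derivative (\<lambda>s. s *\<^sub>R b)) (at s)"
        by (auto intro!: derivative_eq_intros)
      have "((\<lambda>s. f s t) has_real_derivative fs s t) (at s)"
        unfolding f_def has_field_derivative_def
        by (rule has_derivative_eq_rhs[OF has_derivative_inner[OF 1 2]]) (auto simp: fs_def fun_eq_iff algebra_simps)
      then show ?thesis by (rule has_field_derivative_at_within)
    qed
    have c: "continuous_on (U \<times> cbox 0 1) (\<lambda>(s, t). fs s t)"
      unfolding fs_def case_prod_beta
      by (intro continuous_intros continuous_on_compose2[OF cont] continuous_on_compose2[OF g_cont])
         (auto intro!: star in_ball simp del: mem_ball)
    have i: "f s integrable_on cbox 0 1" if "s \<in> U" for s
      unfolding f_def
      by (intro integrable_continuous continuous_intros continuous_on_compose2[OF g_cont])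
         (use that in \<open>auto intro!: star in_ball simp del: mem_ball\<close>)
    have "((\<lambda>s. integral (cbox 0 1) (f s)) has_real_derivative integral (cbox 0 1) (fs 0)) (at 0 within U)"
      by (rule leibniz_rule_field_derivative[OF D i c]) (auto simp: U_def e)
    moreover have "at 0 within U = at 0" using e by (intro at_within_open) (auto simp: U_def)
    moreover have "(fs 0 has_integral (1 *\<^sub>R inner (g (1 *\<^sub>R y)) b - 0 *\<^sub>R inner (g (0 *\<^sub>R y)) b)) {0..1}"
    proof (rule fundamental_theorem_of_calculus)
      fix t :: real assume t: "t \<in> {0..1}"
      note w = star[OF y t]
      have "((\<lambda>t. t *\<^sub>R y) has_derivative (\<lambda>t. t *\<^sub>R y)) (at t)"
        by (auto intro!: derivative_eq_intros)
      from has_derivative_compose[OF this g'[OF w]]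
      have "((\<lambda>t. g (t *\<^sub>R y)) has_derivative (\<lambda>u. u *\<^sub>R g' (t *\<^sub>R y) y)) (at t)"
        using has_derivative_bounded_linear[OF g'[OF w]] by (simp add: linear_simps)
      then have "((\<lambda>t. g (t *\<^sub>R y)) has_vector_derivative g' (t *\<^sub>R y) y) (at t)"
        by (simp add: has_vector_derivative_def)
      then have "((\<lambda>t. inner (g (t *\<^sub>R y)) b) has_vector_derivative inner (g' (t *\<^sub>R y) y) b) (at t)"
        by (rule bounded_linear.has_vector_derivative[OF bounded_linear_inner_left])
      then have "((\<lambda>t. t *\<^sub>R inner (g (t *\<^sub>R y)) b) has_vector_derivative fs 0 t) (at t)"
        using sym[OF w, of y b]
        by (auto intro!: derivative_eq_intros simp: has_real_derivative_iff_has_vector_derivative[symmetric] fs_def)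
      then show "((\<lambda>t. t *\<^sub>R inner (g (t *\<^sub>R y)) b) has_vector_derivative fs 0 t) (at t within {0..1})"
        by (rule has_vector_derivative_at_within)
    qed simp
    then have "integral (cbox 0 1) (fs 0) = inner (g y) b" by (simp add: integral_unique)
    ultimately show ?thesis by (simp add: radial_potential_def f_def[abs_def])
  qed
  \<comment> \<open>So far only directional derivatives are known; they are continuous because
    \<open>g\<close> is, so they combine into a total derivative.\<close>
  have "(radial_potential g has_derivative (\<lambda>h. \<Sum>b\<in>Basis. inner h b * inner (g x) b)) (at x)"
    by (rule has_derivative_continuous_partials[OF open_ball x partials]) (auto intro!: continuous_intros g_cont)
  moreover have "(\<Sum>b\<in>Basis. inner h b * inner (g x) b) = inner (g x) h" for h
    by (subst euclidean_inner[of "g x" h]) (rule sum.cong, auto simp: mult.commute)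
  ultimately show ?thesis by simp
qed

section \<open>From matrix eigenvectors to the coordinates of \<open>C4\<close>\<close>

definition cham :: "(R4 \<Rightarrow> real) \<Rightarrow> C4 \<Rightarrow> C4" where
  "cham H = (\<lambda>(x, y, p, q).
      (of_real (pd2 H ex ep) * x + of_real (pd2 H ey ep) * y + of_real (pd2 H ep ep) * p + of_real (pd2 H ep Defs.eq) * q,
       of_real (pd2 H ex Defs.eq) * x + of_real (pd2 H ey Defs.eq) * y + of_real (pd2 H ep Defs.eq) * p + of_real (pd2 H Defs.eq Defs.eq) * q,
       - (of_real (pd2 H ex ex) * x + of_real (pd2 H ex ey) * y + of_real (pd2 H ex ep) * p + of_real (pd2 H ex Defs.eq) * q),
       - (of_real (pd2 H ex ey) * x + of_real (pd2 H ey ey) * y + of_real (pd2 H ey ep) * p + of_real (pd2 H ey Defs.eq) * q)))"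

definition vec_C4 :: "complex vec \<Rightarrow> C4" where
  "vec_C4 v = (vec_index v 0, vec_index v 1, vec_index v 2, vec_index v 3)"

lemma eigenvector_cham:
  assumes "eigenvector (Lc H) v l"
  shows "cham H (vec_C4 v) = smc l (vec_C4 v)"
proof -
  have v: "v \<in> carrier_vec 4" and eq: "Lc H *\<^sub>v v = l \<cdot>\<^sub>v v"
    using assms Lc_carrier[of H] by (auto simp: eigenvector_def)
  have sum4: "sum f {0..<4} = f 0 + f 1 + f 2 + f (3::nat)" for f :: "nat \<Rightarrow> complex"
    by (simp add: eval_nat_numeral)
  have "Lc H $$ (i, 0) * vec_index v 0 + Lc H $$ (i, 1) * vec_index v 1 + Lc H $$ (i, 2) * vec_index v 2 + Lc H $$ (i, 3) * vec_index v 3 = l * vec_index v i"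
    if "i < 4" for i
  proof -
    have "vec_index (Lc H *\<^sub>v v) i = (\<Sum>k = 0..<4. Lc H $$ (i, k) * vec_index v k)"
      using carrier_matD[OF Lc_carrier[of H]] v that by (simp add: scalar_prod_def)
    moreover have "vec_index (l \<cdot>\<^sub>v v) i = l * vec_index v i" using v that by simp
    ultimately show ?thesis using eq by (simp add: sum4)
  qed
  from this[of 0] this[of 1] this[of 2] this[of 3] show ?thesis
    by (simp add: cham_def vec_C4_def smc_def Lc_def Lmat_def mat_of_rows_list_def)
qed

text \<open>Preimages of \<open>(1, 0)\<close> and \<open>(0, 1)\<close> supply a complex
  coefficient matrix whose product with the matrix of base components is the identity;
  multiplicativity of the 2 by 2 determinant excludes 0.\<close>

lemma span2_nondegenerate:
  fixes v1 v2 :: "complex vec"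
  assumes "bij_betw proj (span2 v1 v2) UNIV" "v1 \<in> carrier_vec 4" "v2 \<in> carrier_vec 4"
  shows "vec_index v1 0 * vec_index v2 1 - vec_index v2 0 * vec_index v1 1 \<noteq> 0"
proof
  assume D: "vec_index v1 0 * vec_index v2 1 - vec_index v2 0 * vec_index v1 1 = 0"
  have ex_ab: "\<exists>a b. of_real x = a * vec_index v1 0 + b * vec_index v2 0 \<and> of_real y = a * vec_index v1 1 + b * vec_index v2 1" for x y
  proof -
    have "(x, y) \<in> proj ` span2 v1 v2" using assms(1) by (simp add: bij_betw_def)
    then obtain P where "P \<in> span2 v1 v2" "proj P = (x, y)" by force
    moreover obtain x' y' p q where "P = (x', y', p, q)" by (metis surj_pair)
    ultimately obtain p q a b where P: "cvec (x, y, p, q) = a \<cdot>\<^sub>v v1 + b \<cdot>\<^sub>v v2"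
      by (auto simp: span2_def proj_def)
    from arg_cong[OF P, of "\<lambda>v. vec_index v 0"] arg_cong[OF P, of "\<lambda>v. vec_index v 1"] show ?thesis
      using assms(2,3) by (intro exI[of _ a] exI[of _ b]) (auto simp: cvec_def)
  qed
  from ex_ab[of 1 0] obtain a b where 1: "1 = a * vec_index v1 0 + b * vec_index v2 0" "0 = a * vec_index v1 1 + b * vec_index v2 1" by auto
  from ex_ab[of 0 1] obtain c d where 2: "0 = c * vec_index v1 0 + d * vec_index v2 0" "1 = c * vec_index v1 1 + d * vec_index v2 1" by auto
  have "(a * vec_index v1 0 + b * vec_index v2 0) * (c * vec_index v1 1 + d * vec_index v2 1) - (a * vec_index v1 1 + b * vec_index v2 1) * (c * vec_index v1 0 + d * vec_index v2 0)
     = (a * d - b * c) * (vec_index v1 0 * vec_index v2 1 - vec_index v2 0 * vec_index v1 1)" by (simp add: algebra_simps)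
  then show False unfolding D 1[symmetric] 2[symmetric] by simp
qed

text \<open>The fibre part \<open>g\<close> of the initial values has class \<open>k - 1\<close> and
  a symmetric derivative, hence a potential \<open>z\<close> of class \<open>k\<close> with gradient
  \<open>g\<close>. The jet of \<open>z\<close> is then the graph itself.\<close>

lemma stable_jet:
  fixes H :: "R4 \<Rightarrow> real"
  assumes "k \<ge> 2" "Ck_on k UNIV H" "H 0 = 0" "\<And>i. i < 4 \<Longrightarrow> partial (e4 i) H 0 = 0"
    and e: "e1 = (x1, y1, p1, q1)" "e2 = (x2, y2, p2, q2)"
    and eigen: "cham H e1 = smc l1 e1" "cham H e2 = smc l2 e2" "Re l1 < 0" "Re l2 < 0"
    and D0: "x1 * y2 - x2 * y1 \<noteq> 0"
  shows "\<exists>U \<Omega> z. open U \<and> 0 \<in> U \<and> open \<Omega> \<and> (0, 0) \<in> \<Omega>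
           \<and> Ck_solution k H \<Omega> z \<and> stable_loc H U = jet z \<Omega> \<inter> U"
proof -
  obtain n where k: "k = Suc (Suc n)" using \<open>k \<ge> 2\<close> by (metis add_2_eq_Suc le_Suc_ex)
  obtain H' H'' where "hamiltonian H n H' H''"
    using Ck_on_hamiltonianE assms(2) unfolding k by blast
  then interpret hamiltonian H n H' H'' .
  define rham :: "R4 \<Rightarrow> R4" where "rham = (\<lambda>(x, y, p, q).
      (pd2 H ex ep * x + pd2 H ey ep * y + pd2 H ep ep * p + pd2 H ep Defs.eq * q,
       pd2 H ex Defs.eq * x + pd2 H ey Defs.eq * y + pd2 H ep Defs.eq * p + pd2 H Defs.eq Defs.eq * q,
       - (pd2 H ex ex * x + pd2 H ex ey * y + pd2 H ex ep * p + pd2 H ex Defs.eq * q),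
       - (pd2 H ex ey * x + pd2 H ey ey * y + pd2 H ey ep * p + pd2 H ey Defs.eq * q)))"
  interpret eigenplane "pd2 H ex ex" "pd2 H ex ey" "pd2 H ex ep" "pd2 H ex Defs.eq" "pd2 H ey ey" "pd2 H ey ep"
      "pd2 H ey Defs.eq" "pd2 H ep ep" "pd2 H ep Defs.eq" "pd2 H Defs.eq Defs.eq"
      l1 l2 x1 y1 p1 q1 x2 y2 p2 q2 "cham H" rham e1 e2
    by (rule eigenplane.intro) (fact cham_def rham_def e eigen D0)+
  interpret stable_vector_field rham proj K E "xiH H" xi'
  proof (intro stable_vector_field.intro stable_vector_field_axioms.intro)
    show "xiH H 0 = 0"
      using assms(4)[of 0] assms(4)[of 1] assms(4)[of 2] assms(4)[of 3]
      by (simp add: xiH_def e4_def zero_prod_def)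
    show "xi' 0 v = rham v" for v
    proof -
      obtain x y p q where v: "v = (x, y, p, q)" by (metis surj_pair)
      show ?thesis
        unfolding v xi'_def rham_def pd2_H linear_R4[OF has_derivative_bounded_linear[OF H'']]
        using H''_sym[of 0 ex ey] H''_sym[of 0 ex ep] H''_sym[of 0 ex Defs.eq]
          H''_sym[of 0 ey ep] H''_sym[of 0 ey Defs.eq] H''_sym[of 0 ep Defs.eq]
        by (simp add: mult.commute)
    qed
    show "continuous_on UNIV (\<lambda>P. xi' P v)" for v by (rule Cr_imp_continuous_on[OF xi'_Cr])
  qed (rule stable_splitting_axioms xiH_has_derivative)+
  obtain r \<gamma> \<gamma>' where r: "r > 0"
    and sol: "\<And>x t. x \<in> ball 0 r \<Longrightarrow> t \<ge> 0 \<Longrightarrow> (apply_bcontfun (\<gamma> x) has_vector_derivative xiH H (\<gamma> x t)) (at t within {0..})"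
    and lim: "\<And>x. x \<in> ball 0 r \<Longrightarrow> (apply_bcontfun (\<gamma> x) \<longlongrightarrow> 0) at_top"
    and pr: "\<And>x. x \<in> ball 0 r \<Longrightarrow> proj (\<gamma> x 0) = x"
    and der: "\<And>x. x \<in> ball 0 r \<Longrightarrow> (\<gamma> has_derivative \<gamma>' x) (at x)"
    and dsol: "\<And>x h t. x \<in> ball 0 r \<Longrightarrow> t \<ge> 0 \<Longrightarrow>
       (apply_bcontfun (\<gamma>' x h) has_vector_derivative xi' (\<gamma> x t) (\<gamma>' x h t)) (at t within {0..})"
    and dlim: "\<And>x h. x \<in> ball 0 r \<Longrightarrow> (apply_bcontfun (\<gamma>' x h) \<longlongrightarrow> 0) at_top"
    and smooth: "\<And>m. (\<And>v. Cr m UNIV (\<lambda>P. xi' P v)) \<Longrightarrow> Cr (Suc m) (ball 0 r) \<gamma>"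
    and man: "\<exists>U \<Omega>. open U \<and> 0 \<in> U \<and> open \<Omega> \<and> 0 \<in> \<Omega> \<and> \<Omega> \<subseteq> ball 0 r \<and>
        stable_set (xiH H) U = (\<lambda>x. \<gamma> x 0) ` \<Omega> \<inter> U"
    by (rule local_stable_manifold) blast
  define fib :: "R4 \<Rightarrow> real \<times> real" where "fib P = snd (snd P)" for P
  have fib: "bounded_linear fib"
    unfolding fib_def by (intro bounded_linear_compose[OF bounded_linear_snd] bounded_linear_snd)
  have split: "P = (fst (proj P), snd (proj P), fst (fib P), snd (fib P))" for P
    by (cases P) (simp add: fib_def proj_def)
  define g where "g x = fib (\<gamma> x 0)" for x
  define g' where "g' x h = fib (\<gamma>' x h 0)" for x h
  have ev: "bounded_linear (\<lambda>u :: real \<Rightarrow>\<^sub>C R4. apply_bcontfun u 0)" by (rule bounded_linear_apply_bcontfun)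
  have g_der: "(g has_derivative g' x) (at x)" if "x \<in> ball 0 r" for x
    unfolding g_def [abs_def] g'_def [abs_def]
    by (intro bounded_linear.has_derivative[OF fib] bounded_linear.has_derivative[OF ev] der that)
  have "Cr (Suc n) (ball 0 r) \<gamma>" by (rule smooth[OF xi'_Cr])
  then have g_smooth: "Cr (Suc n) (ball 0 r) g"
    unfolding g_def by (intro Cr_bounded_linear[OF fib] Cr_bounded_linear[OF ev])
  \<comment> \<open>\<open>Cr\<close> provides continuity for some derivative of \<open>g\<close>;
    uniqueness of derivatives identifies it with \<open>g'\<close>.\<close>
  have g'_cont: "continuous_on (ball 0 r) (\<lambda>x. g' x v)" for v
  proof -
    from g_smooth have "\<exists>f'. (\<forall>x\<in>ball 0 r. (g has_derivative f' x) (at x)) \<and> (\<forall>v. Cr n (ball 0 r) (\<lambda>x. f' x v))"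
      by (simp only: Cr.simps)
    then obtain f' where f': "\<And>x. x \<in> ball 0 r \<Longrightarrow> (g has_derivative f' x) (at x)" "\<And>v. Cr n (ball 0 r) (\<lambda>x. f' x v)"
      by blast
    have "f' x = g' x" if "x \<in> ball 0 r" for x
      by (rule has_derivative_unique[OF f'(1)[OF that] g_der[OF that]])
    then show ?thesis
      using continuous_on_cong[OF refl, of "ball 0 r" "\<lambda>x. f' x v" "\<lambda>x. g' x v"] Cr_imp_continuous_on[OF f'(2)[of v]] by metis
  qed
  \<comment> \<open>Obtained by differentiating \<open>proj (\<gamma> x 0) = x\<close>.\<close>
  have proj_\<gamma>': "proj (\<gamma>' x h 0) = h" if x: "x \<in> ball 0 r" for x h
  proof -
    have "((\<lambda>x. proj (\<gamma> x 0)) has_derivative (\<lambda>h. proj (\<gamma>' x h 0))) (at x)"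
      by (intro bounded_linear.has_derivative[OF bounded_linear_proj] bounded_linear.has_derivative[OF ev] der x)
    moreover have "((\<lambda>x. proj (\<gamma> x 0)) has_derivative (\<lambda>h. h)) (at x)"
      by (rule has_derivative_transform_within_open[OF has_derivative_ident open_ball x]) (simp add: pr)
    ultimately have "(\<lambda>h. proj (\<gamma>' x h 0)) = (\<lambda>h. h)" by (rule has_derivative_unique)
    then show ?thesis by meson
  qed
  have lagrangian: "symp (\<gamma>' x a 0) (\<gamma>' x b 0) = 0" if x: "x \<in> ball 0 r" for x a b
  proof -
    let ?f = "\<lambda>t. symp (\<gamma>' x a t) (\<gamma>' x b t)"
    have "(?f has_vector_derivative 0) (at t within {0..})" if "t \<in> {0..}" for t
      using bounded_bilinear.has_vector_derivative[OF bounded_bilinear_symp dsol[OF x, of t a] dsol[OF x, of t b]] that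
      by (simp add: trans[OF add.commute symp_xi'])
    then obtain c where c: "\<And>t. t \<in> {0..} \<Longrightarrow> ?f t = c"
      using has_vector_derivative_zero_constant[of "{0..}" ?f] by blast
    have "(?f \<longlongrightarrow> 0) at_top"
      by (rule bounded_bilinear.tendsto_zero[OF bounded_bilinear_symp dlim[OF x] dlim[OF x]])
    moreover have "(?f \<longlongrightarrow> c) at_top"
      by (rule tendsto_eventually) (auto simp: eventually_at_top_linorder c intro!: exI[of _ 0])
    ultimately have "c = 0" using tendsto_unique trivial_limit_at_top_linorder by blast
    then show ?thesis using c[of 0] by simp
  qed
  \<comment> \<open>Tangent vectors of the graph are pairs of \<open>h\<close> and
    \<open>g' x h\<close>, so their symplectic product is exactly the antisymmetric part of
    \<open>g' x\<close>.\<close>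
  have sym: "inner (g' x a) b = inner (g' x b) a" if x: "x \<in> ball 0 r" for x a b
  proof -
    have "\<gamma>' x h 0 = (fst h, snd h, fst (g' x h), snd (g' x h))" for h
      using split[of "\<gamma>' x h 0", unfolded proj_\<gamma>'[OF x]] unfolding g'_def .
    then show ?thesis
      using lagrangian[OF x, of a b] by (simp add: symp_def inner_prod_def case_prod_beta algebra_simps)
  qed
  define z where "z = radial_potential g"
  have z_der: "(z has_derivative (\<lambda>h. inner (g x) h)) (at x)" if "x \<in> ball 0 r" for x
    unfolding z_def by (rule radial_potential_has_derivative[OF g_der g'_cont sym that])
  \<comment> \<open>The lost derivative returns here: the derivative of \<open>z\<close> is the
    inner product with \<open>g\<close>, of class \<open>Suc n = k - 1\<close>.\<close>
  have z_smooth: "Cr k (ball 0 r) z"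
    unfolding k by (rule Cr_SucI[OF z_der], assumption) (rule Cr_bounded_linear[OF bounded_linear_inner_left g_smooth])
  have zxy: "zx z x = fst (g x)" "zy z x = snd (g x)" if "x \<in> ball 0 r" for x
    using partial_eq(2)[OF z_der[OF that]] by (simp_all add: zx_def zy_def inner_prod_def)
  have \<gamma>_jet: "\<gamma> (x, y) 0 = (x, y, zx z (x, y), zy z (x, y))" if "(x, y) \<in> ball 0 r" for x y
    using split[of "\<gamma> (x, y) 0", unfolded pr[OF that]] unfolding zxy[OF that] g_def fst_conv snd_conv .
  have H0: "H (\<gamma> x 0) = 0" if x: "x \<in> ball 0 r" for x
  proof -
    let ?f = "\<lambda>t. H (\<gamma> x t)"
    have "(?f has_vector_derivative 0) (at t within {0..})" if "t \<in> {0..}" for t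
    proof -
      have "(apply_bcontfun (\<gamma> x) has_derivative (\<lambda>s. s *\<^sub>R xiH H (\<gamma> x t))) (at t within {0..})"
        using sol[OF x, of t] that by (simp add: has_vector_derivative_def)
      from has_derivative_compose[OF this H']
      have "(?f has_derivative (\<lambda>s. H' (\<gamma> x t) (s *\<^sub>R xiH H (\<gamma> x t)))) (at t within {0..})" .
      moreover have "H' (\<gamma> x t) (s *\<^sub>R xiH H (\<gamma> x t)) = 0" for s
        using has_derivative_bounded_linear[OF H'] by (simp add: linear_simps H'_xiH)
      ultimately show ?thesis by (simp add: has_vector_derivative_def)
    qed
    then obtain c where c: "\<And>t. t \<in> {0..} \<Longrightarrow> ?f t = c"
      using has_vector_derivative_zero_constant[of "{0..}" ?f] by blast
    have "(?f \<longlongrightarrow> H 0) at_top"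
      by (rule isCont_tendsto_compose[OF has_derivative_continuous[OF H'] lim[OF x]])
    moreover have "(?f \<longlongrightarrow> c) at_top"
      by (rule tendsto_eventually) (auto simp: eventually_at_top_linorder c intro!: exI[of _ 0])
    ultimately have "c = H 0" using tendsto_unique trivial_limit_at_top_linorder by blast
    then show ?thesis using c[of 0] assms(3) by simp
  qed
  from man obtain U \<Omega> where U: "open U" "0 \<in> U" "open \<Omega>" "0 \<in> \<Omega>" "\<Omega> \<subseteq> ball 0 r"
    "stable_set (xiH H) U = (\<lambda>x. \<gamma> x 0) ` \<Omega> \<inter> U" by blast
  have "Ck_solution k H \<Omega> z"
    unfolding Ck_solution_def
  proof (intro conjI allI impI)
    show "Ck_on k \<Omega> z" by (rule Cr_imp_Ck_on[OF U(3) Cr_subset[OF z_smooth U(5)]])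
    fix x y assume "(x, y) \<in> \<Omega>"
    then have xy: "(x, y) \<in> ball 0 r" using U(5) by blast
    show "H (x, y, zx z (x, y), zy z (x, y)) = 0"
      using H0[OF xy] unfolding \<gamma>_jet[OF xy] .
  qed
  moreover have "(\<lambda>x. \<gamma> x 0) ` \<Omega> = jet z \<Omega>"
  proof -
    have "(\<lambda>x. \<gamma> x 0) ` \<Omega> = {\<gamma> (x, y) 0 | x y. (x, y) \<in> \<Omega>}" by auto
    also have "\<dots> = jet z \<Omega>"
      unfolding jet_def using \<gamma>_jet U(5) by (metis (no_types, opaque_lifting) subsetD)
    finally show ?thesis .
  qed
  moreover have "stable_loc H U = stable_set (xiH H) U" by (simp add: stable_loc_def stable_set_def)
  ultimately show ?thesis using U by (intro exI[of _ U] exI[of _ \<Omega>] exI[of _ z]) (simp add: zero_prod_def)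
qed

section \<open>Reversal of time\<close>

lemma has_vector_derivative_reflect_halfline:
  fixes c :: "real \<Rightarrow> 'a::real_normed_vector"
  assumes "(c has_vector_derivative d) (at (- t) within uminus ` S)"
  shows "((\<lambda>t. c (- t)) has_vector_derivative - d) (at t within S)"
proof -
  have "(uminus has_vector_derivative - 1) (at t within S)"
    by (auto intro!: derivative_eq_intros)
  from vector_diff_chain_within[OF this assms] show ?thesis by (simp add: o_def)
qed

text \<open>The substitution of \<open>- t\<close> for \<open>t\<close> turns backward solutions of
  one field into forward solutions of its negative, inside the same neighborhood.\<close>

lemma unstable_loc_eq:
  assumes "\<And>P. xiH G P = - xiH H P"
  shows "unstable_loc H U = stable_loc G U"
proof -
  have img: "uminus ` {0..} = {..0::real}" "uminus ` {..0} = {0::real..}" by force+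
  have "P \<in> stable_loc G U" if "P \<in> unstable_loc H U" for P
  proof -
    from that obtain c where c: "P \<in> U" "c 0 = P" "(c \<longlongrightarrow> 0) at_bot"
      "\<And>t. t \<le> 0 \<Longrightarrow> c t \<in> U \<and> (c has_vector_derivative xiH H (c t)) (at t within {..0})"
      unfolding unstable_loc_def by blast
    have "((\<lambda>t. c (- t)) has_vector_derivative xiH G (c (- t))) (at t within {0..})" if "t \<ge> 0" for t
      unfolding assms by (rule has_vector_derivative_reflect_halfline) (use c(4)[of "- t"] that in \<open>simp add: img\<close>)
    moreover have "((\<lambda>t. c (- t)) \<longlongrightarrow> 0) at_top"
      by (rule filterlim_compose[OF c(3) filterlim_uminus_at_bot_at_top])
    ultimately show ?thesis
      unfolding stable_loc_def using c(1,2,4) by (intro CollectI conjI exI[of _ "\<lambda>t. c (- t)"]) auto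
  qed
  moreover have "P \<in> unstable_loc H U" if "P \<in> stable_loc G U" for P
  proof -
    from that obtain c where c: "P \<in> U" "c 0 = P" "(c \<longlongrightarrow> 0) at_top"
      "\<And>t. t \<ge> 0 \<Longrightarrow> c t \<in> U \<and> (c has_vector_derivative xiH G (c t)) (at t within {0..})"
      unfolding stable_loc_def by blast
    have "((\<lambda>t. c (- t)) has_vector_derivative - xiH G (c (- t))) (at t within {..0})" if "t \<le> 0" for t
      by (rule has_vector_derivative_reflect_halfline) (use c(4)[of "- t"] that in \<open>simp add: img\<close>)
    moreover have "((\<lambda>t. c (- t)) \<longlongrightarrow> 0) at_bot"
      by (rule filterlim_compose[OF c(3) filterlim_uminus_at_top_at_bot])
    ultimately show ?thesis
      unfolding unstable_loc_def using c(1,2,4) by (intro CollectI conjI exI[of _ "\<lambda>t. c (- t)"]) (auto simp: assms)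
  qed
  ultimately show ?thesis by blast
qed

lemma
  assumes "k \<ge> 2" "Ck_on k UNIV H"
  shows Ck_on_uminus: "Ck_on k UNIV (\<lambda>P. - H P)"
    and partial_uminus: "partial v (\<lambda>P. - H P) P = - partial v H P"
    and cham_uminus: "cham (\<lambda>P. - H P) w = - cham H w"
proof -
  have "Cr k UNIV (\<lambda>P. - H P)"
    by (rule Cr_bounded_linear[OF bounded_linear_minus[OF bounded_linear_ident] Ck_on_imp_Cr[OF open_UNIV assms(2)]])
  then show "Ck_on k UNIV (\<lambda>P. - H P)" by (rule Cr_imp_Ck_on[OF open_UNIV])
  obtain n where k: "k = Suc (Suc n)" using \<open>k \<ge> 2\<close> by (metis add_2_eq_Suc le_Suc_ex)
  obtain H' H'' where "hamiltonian H n H' H''"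
    using Ck_on_hamiltonianE assms(2) unfolding k by blast
  then interpret hamiltonian H n H' H'' .
  have p: "partial v (\<lambda>P. - H P) = (\<lambda>P. - H' P v)" for v
    by (rule ext) (rule partial_eq(2)[OF has_derivative_minus[OF H']])
  show "partial v (\<lambda>P. - H P) P = - partial v H P"
    by (simp add: p partial_H)
  have "pd2 (\<lambda>P. - H P) u v = - pd2 H u v" for u v
    unfolding pd2_H unfolding pd2_def p by (rule partial_eq(2)[OF has_derivative_minus[OF H'']])
  then show "cham (\<lambda>P. - H P) w = - cham H w"
    by (cases w) (simp add: cham_def)
qed

theorem theorem2p5:
  fixes H :: "R4 \<Rightarrow> real" and k :: nat
  assumes "k \<ge> 2"
    and "Ck_on k UNIV H"
    and "nondeg_crit0 H"
    and "H 0 = 0"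
    and "\<forall>\<mu>. eigenvalue (Lc H) \<mu> \<longrightarrow> Re \<mu> \<noteq> 0"
  shows "(\<exists>l1 l2. filter_mset (\<lambda>\<mu>. Re \<mu> > 0) (eigvals H) = {#l1, l2#})
    \<and> (\<forall>l1 l2 e1 e2.
          filter_mset (\<lambda>\<mu>. Re \<mu> > 0) (eigvals H) = {#l1, l2#}
          \<and> eigenvector (Lc H) e1 l1 \<and> eigenvector (Lc H) e2 l2
          \<and> bij_betw proj (span2 e1 e2) UNIV
          \<longrightarrow> (\<exists>U \<Omega> z. open U \<and> 0 \<in> U \<and> open \<Omega> \<and> (0, 0) \<in> \<Omega>
                 \<and> Ck_solution k H \<Omega> z \<and> unstable_loc H U = jet z \<Omega> \<inter> U))
    \<and> (\<forall>l1 l2 e1 e2.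
          filter_mset (\<lambda>\<mu>. Re \<mu> < 0) (eigvals H) = {#l1, l2#}
          \<and> eigenvector (Lc H) e1 l1 \<and> eigenvector (Lc H) e2 l2
          \<and> bij_betw proj (span2 e1 e2) UNIV
          \<longrightarrow> (\<exists>U \<Omega> z. open U \<and> 0 \<in> U \<and> open \<Omega> \<and> (0, 0) \<in> \<Omega>
                 \<and> Ck_solution k H \<Omega> z \<and> stable_loc H U = jet z \<Omega> \<inter> U))"
  proof -
  have crit: "partial (e4 i) H 0 = 0" if "i < 4" for i
    using assms(3) that by (simp add: nondeg_crit0_def)
  let ?G = "\<lambda>P. - H P"
  have eigen: "cham H (vec_C4 e) = smc l (vec_C4 e) \<and> e \<in> carrier_vec 4" if "eigenvector (Lc H) e l" for e l
    using eigenvector_cham[OF that] that Lc_carrier[of H] by (auto simp: eigenvector_def)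
  have member: "P l1 \<and> P l2" if "filter_mset P (eigvals H) = {#l1, l2#}" for P l1 l2
  proof -
    have "l1 \<in># filter_mset P (eigvals H)" "l2 \<in># filter_mset P (eigvals H)" by (simp_all add: that)
    then show ?thesis by simp
  qed
  show ?thesis
  proof (intro conjI allI impI; (elim conjE)?)
    show "\<exists>l1 l2. filter_mset (\<lambda>\<mu>. Re \<mu> > 0) (eigvals H) = {#l1, l2#}"
      by (rule eigvals_filter[OF assms(5)])
  next
    fix l1 l2 e1 e2
    assume l: "filter_mset (\<lambda>\<mu>. Re \<mu> > 0) (eigvals H) = {#l1, l2#}"
      and e: "eigenvector (Lc H) e1 l1" "eigenvector (Lc H) e2 l2"
      and bij: "bij_betw proj (span2 e1 e2) UNIV"
    \<comment> \<open>For \<open>- H\<close> the linearization changes sign: the eigenvectors are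
      kept, and eigenvalues with positive real part become negative ones.\<close>
    have "\<exists>U \<Omega> z. open U \<and> 0 \<in> U \<and> open \<Omega> \<and> (0, 0) \<in> \<Omega>
                 \<and> Ck_solution k ?G \<Omega> z \<and> stable_loc ?G U = jet z \<Omega> \<inter> U"
    proof (rule stable_jet[OF assms(1) Ck_on_uminus[OF assms(1,2)] _ _ vec_C4_def vec_C4_def])
      show "- H 0 = 0" using assms(4) by simp
      show "partial (e4 i) ?G 0 = 0" if "i < 4" for i
        using crit[OF that] by (simp add: partial_uminus[OF assms(1,2)])
      show "cham ?G (vec_C4 e1) = smc (- l1) (vec_C4 e1)" "cham ?G (vec_C4 e2) = smc (- l2) (vec_C4 e2)"
        using eigen[OF e(1)] eigen[OF e(2)] by (simp_all add: cham_uminus[OF assms(1,2)] smc_simps)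
      show "Re (- l1) < 0" "Re (- l2) < 0" using member[OF l] by simp_all
    qed (rule span2_nondegenerate[OF bij]; use eigen e in blast)
    moreover have "unstable_loc H U = stable_loc ?G U" for U
      by (rule unstable_loc_eq) (simp add: xiH_def partial_uminus[OF assms(1,2)])
    \<comment> \<open>\<open>Ck_solution\<close> involves \<open>H\<close> only through its zeros,
      so it is the same for \<open>- H\<close>.\<close>
    ultimately show "\<exists>U \<Omega> z. open U \<and> 0 \<in> U \<and> open \<Omega> \<and> (0, 0) \<in> \<Omega>
                 \<and> Ck_solution k H \<Omega> z \<and> unstable_loc H U = jet z \<Omega> \<inter> U"
      by (simp add: Ck_solution_def)
  next
    fix l1 l2 e1 e2
    assume l: "filter_mset (\<lambda>\<mu>. Re \<mu> < 0) (eigvals H) = {#l1, l2#}"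
      and e: "eigenvector (Lc H) e1 l1" "eigenvector (Lc H) e2 l2"
      and bij: "bij_betw proj (span2 e1 e2) UNIV"
    show "\<exists>U \<Omega> z. open U \<and> 0 \<in> U \<and> open \<Omega> \<and> (0, 0) \<in> \<Omega>
                 \<and> Ck_solution k H \<Omega> z \<and> stable_loc H U = jet z \<Omega> \<inter> U"
    proof (rule stable_jet[OF assms(1,2,4) crit vec_C4_def vec_C4_def])
      show "cham H (vec_C4 e1) = smc l1 (vec_C4 e1)" "cham H (vec_C4 e2) = smc l2 (vec_C4 e2)"
        using eigen[OF e(1)] eigen[OF e(2)] by simp_all
      show "Re l1 < 0" "Re l2 < 0" using member[OF l] by simp_all
    qed (assumption | rule span2_nondegenerate[OF bij]; use eigen e in blast)+
  qed
qed

end
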